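(* Let $A$ be a finite local commutative ring. Then the line graph $L(EG(A))$ of the essential graph of $A$ is outerplanar if and only if $A$ is isomorphic to one of the following 11 rings: $\mathbb{Z}_4$, $\mathbb{Z}_9$, $\mathbb{Z}_8$, $\frac{\mathbb{Z}_2[x]}{\langle x^2\rangle}$, $\frac{\mathbb{Z}_3[x]}{\langle x^2\rangle}$, $\frac{\mathbb{Z}_2[x]}{\langle x^3\rangle}$, $\frac{\mathbb{Z}_4[x]}{\langle x^3, x^2-2\rangle}$, $\frac{\mathbb{F}_4[x]}{\langle x^2\rangle}$, $\frac{\mathbb{Z}_4[x]}{\langle 2x, x^2\rangle}$, $\frac{\mathbb{Z}_2[x,y]}{\langle x^2, xy, y^2\rangle}$, $\frac{\mathbb{Z}_4[x]}{\langle x^2+x+1\rangle}$.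
   Context: All rings are finite, commutative and have unity $1\neq 0$. $\mathbb{Z}_n$ is the ring of integers modulo $n$ and $\mathbb{F}_n$ the finite field with $n$ elements. A ring is local if it has exactly one maximal ideal. An ideal $I$ of a ring $A$ is essential if $I\cap J\neq 0$ for every non-zero ideal $J$ of $A$ (so $A$ itself is essential). For $s\in A$, $\mathrm{ann}_A(s)=\{r\in A : sr=0\}$. The essential graph $EG(A)$ is the simple undirected graph whose vertices are the non-zero zero-divisors of $A$, two distinct vertices $u,v$ being adjacent if and only if $\mathrm{ann}_A(uv)$ is an essential ideal of $A$. The line graph $L(G)$ of a graph $G$ has the edges of $G$ as vertices, two distinct ones being adjacent exactly when the corresponding edges share an endpoint in $G$. A graph is outerplanar if it can be drawn in the plane without edge crossings and with all vertices on the boundary of the unbounded region.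
   Formalization: The ring A is additionally assumed not to be a field: for a finite field the essential graph has no vertices, so its line graph is the null graph and (as for Z_4) outerplanar, but no field is among the 11 rings. *)

theory Defs
  imports
    "HOL-Analysis.Analysis"
    "HOL-Algebra.UnivPoly"
    "HOL-Algebra.QuotRing"
    "HOL-Number_Theory.Residues"
begin

section \<open>Rings\<close>

definition local_ring :: "('a, 'm) ring_scheme \<Rightarrow> bool" where
  "local_ring A \<longleftrightarrow> (\<exists>!M. maximalideal M A)"

definition zero_divisors :: "('a, 'm) ring_scheme \<Rightarrow> 'a set" where
  "zero_divisors A =
     {a \<in> carrier A. \<exists>b \<in> carrier A. b \<noteq> \<zero>\<^bsub>A\<^esub> \<and> a \<otimes>\<^bsub>A\<^esub> b = \<zero>\<^bsub>A\<^esub>}"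

definition annihilator :: "('a, 'm) ring_scheme \<Rightarrow> 'a \<Rightarrow> 'a set" where
  "annihilator A s = {r \<in> carrier A. s \<otimes>\<^bsub>A\<^esub> r = \<zero>\<^bsub>A\<^esub>}"

definition essential_ideal :: "'a set \<Rightarrow> ('a, 'm) ring_scheme \<Rightarrow> bool" where
  "essential_ideal I A \<longleftrightarrow>
     ideal I A \<and> (\<forall>J. ideal J A \<and> J \<noteq> {\<zero>\<^bsub>A\<^esub>} \<longrightarrow> I \<inter> J \<noteq> {\<zero>\<^bsub>A\<^esub>})"


section \<open>Simple graphs\<close>

text \<open>A simple undirected graph is a pair of its vertex set and its edge set, the edges
  being two-element sets of vertices.\<close>

type_synonym 'v sgraph = "'v set \<times> 'v set set"

definition essential_graph :: "('a, 'm) ring_scheme \<Rightarrow> 'a sgraph" where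
  "essential_graph A =
     (let V = zero_divisors A - {\<zero>\<^bsub>A\<^esub>}
      in (V, {{u, v} | u v. u \<in> V \<and> v \<in> V \<and> u \<noteq> v \<and>
                essential_ideal (annihilator A (u \<otimes>\<^bsub>A\<^esub> v)) A}))"

definition line_graph :: "'v sgraph \<Rightarrow> 'v set sgraph" where
  "line_graph G =
     (snd G, {{e, f} | e f. e \<in> snd G \<and> f \<in> snd G \<and> e \<noteq> f \<and> e \<inter> f \<noteq> {}})"


section \<open>Outerplanarity\<close>

text \<open>A drawing without crossings in the plane (identified with the complex numbers) puts the
  vertices at the distinct points \<open>p v\<close> and draws every edge \<open>e\<close> as an arc \<open>g e\<close> joining its
  endpoints. An arc meets no vertices other than its endpoints, and two arcs meet only at
  common endpoints of the two edges.\<close>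

definition plane_drawing ::
    "'v sgraph \<Rightarrow> ('v \<Rightarrow> complex) \<Rightarrow> ('v set \<Rightarrow> real \<Rightarrow> complex) \<Rightarrow> bool" where
  "plane_drawing G p g \<longleftrightarrow>
     inj_on p (fst G) \<and>
     (\<forall>e \<in> snd G. arc (g e) \<and> {pathstart (g e), pathfinish (g e)} = p ` e \<and>
                  path_image (g e) \<inter> p ` fst G = p ` e) \<and>
     (\<forall>e \<in> snd G. \<forall>f \<in> snd G. e \<noteq> f \<longrightarrow>
                  path_image (g e) \<inter> path_image (g f) = p ` (e \<inter> f))"

definition drawing_points ::
    "'v sgraph \<Rightarrow> ('v \<Rightarrow> complex) \<Rightarrow> ('v set \<Rightarrow> real \<Rightarrow> complex) \<Rightarrow> complex set" where
  "drawing_points G p g = p ` fst G \<union> (\<Union>e \<in> snd G. path_image (g e))"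

text \<open>For a finite graph the drawing is compact, so \<^const>\<open>outside\<close> yields the unique
  unbounded component of its complement.\<close>

definition outerplanar :: "'v sgraph \<Rightarrow> bool" where
  "outerplanar G \<longleftrightarrow>
     (\<exists>p g. plane_drawing G p g \<and> p ` fst G \<subseteq> frontier (outside (drawing_points G p g)))"


section \<open>The eleven rings\<close>

definition UP_X :: "('a, 'm) ring_scheme \<Rightarrow> nat \<Rightarrow> 'a" where
  "UP_X R = up_ring.monom (UP R) \<one>\<^bsub>R\<^esub> 1"

definition UP_const :: "('a, 'm) ring_scheme \<Rightarrow> 'a \<Rightarrow> nat \<Rightarrow> 'a" where
  "UP_const R a = up_ring.monom (UP R) a 0"

definition UP_quot :: "('a, 'm) ring_scheme \<Rightarrow> (nat \<Rightarrow> 'a) set \<Rightarrow> (nat \<Rightarrow> 'a) set ring" where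
  "UP_quot R S = UP R Quot (Idl\<^bsub>UP R\<^esub> S)"

definition Z2x_x2 :: "(nat \<Rightarrow> int) set ring" where
  "Z2x_x2 = (let R = residue_ring 2; P = UP R; x = UP_X R in
     UP_quot R {x [^]\<^bsub>P\<^esub> (2::nat)})"

definition Z3x_x2 :: "(nat \<Rightarrow> int) set ring" where
  "Z3x_x2 = (let R = residue_ring 3; P = UP R; x = UP_X R in
     UP_quot R {x [^]\<^bsub>P\<^esub> (2::nat)})"

definition Z2x_x3 :: "(nat \<Rightarrow> int) set ring" where
  "Z2x_x3 = (let R = residue_ring 2; P = UP R; x = UP_X R in
     UP_quot R {x [^]\<^bsub>P\<^esub> (3::nat)})"

definition Z4x_x3_x2m2 :: "(nat \<Rightarrow> int) set ring" where
  "Z4x_x3_x2m2 = (let R = residue_ring 4; P = UP R; x = UP_X R in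
     UP_quot R {x [^]\<^bsub>P\<^esub> (3::nat), x [^]\<^bsub>P\<^esub> (2::nat) \<ominus>\<^bsub>P\<^esub> UP_const R 2})"

text \<open>The polynomial \<open>t\<^sup>2 + t + 1\<close> is irreducible over \<open>F\<^sub>2\<close>, so this is the field with four elements.\<close>

definition GF4 :: "(nat \<Rightarrow> int) set ring" where
  "GF4 = (let R = residue_ring 2; P = UP R; t = UP_X R in
     UP_quot R {t [^]\<^bsub>P\<^esub> (2::nat) \<oplus>\<^bsub>P\<^esub> t \<oplus>\<^bsub>P\<^esub> \<one>\<^bsub>P\<^esub>})"

definition F4x_x2 :: "(nat \<Rightarrow> (nat \<Rightarrow> int) set) set ring" where
  "F4x_x2 = (let R = GF4; P = UP R; x = UP_X R in
     UP_quot R {x [^]\<^bsub>P\<^esub> (2::nat)})"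

definition Z4x_2x_x2 :: "(nat \<Rightarrow> int) set ring" where
  "Z4x_2x_x2 = (let R = residue_ring 4; P = UP R; x = UP_X R in
     UP_quot R {UP_const R 2 \<otimes>\<^bsub>P\<^esub> x, x [^]\<^bsub>P\<^esub> (2::nat)})"

text \<open>Polynomials in \<open>x\<close> and \<open>y\<close> are polynomials in \<open>y\<close> over the polynomials in \<open>x\<close>.\<close>

definition Z2xy_x2_xy_y2 :: "(nat \<Rightarrow> nat \<Rightarrow> int) set ring" where
  "Z2xy_x2_xy_y2 =
    (let R = UP (residue_ring 2); P = UP R; x = UP_const R (UP_X (residue_ring 2)); y = UP_X R in
     UP_quot R {x [^]\<^bsub>P\<^esub> (2::nat), x \<otimes>\<^bsub>P\<^esub> y, y [^]\<^bsub>P\<^esub> (2::nat)})"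

definition Z4x_x2px1 :: "(nat \<Rightarrow> int) set ring" where
  "Z4x_x2px1 = (let R = residue_ring 4; P = UP R; x = UP_X R in
     UP_quot R {x [^]\<^bsub>P\<^esub> (2::nat) \<oplus>\<^bsub>P\<^esub> x \<oplus>\<^bsub>P\<^esub> \<one>\<^bsub>P\<^esub>})"

end

theory Submission
  imports Defs
begin

text \<open>Let \<open>\<mm>\<close> be the maximal ideal of the finite local ring \<open>A\<close>. It is the set of nonunits and also the
set of zero-divisors, and all its elements are nilpotent. The annihilator of a nilpotent element
\<open>s\<close> is essential: given \<open>j \<noteq> 0\<close> in an ideal \<open>J\<close>, the last nonzero element among
\<open>j, s j, s\<^sup>2 j, \<dots>\<close> lies in \<open>J\<close> and is killed by \<open>s\<close>. Products of elements of \<open>\<mm>\<close> are in \<open>\<mm>\<close>,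
so the essential graph is simply the complete graph on \<open>\<mm> - {0}\<close>
(\<open>essential_graph_complete\<close>).

The line graph of a complete graph on at most three vertices has at most three vertices, and such a
graph is drawn with straight segments between points of the unit circle. The line graph of a
complete graph on four or more vertices contains \<open>K\<^sub>2\<^sub>,\<^sub>3\<close>, which cannot be
drawn with all vertices on the outer boundary (\<open>K23_not_outerplanar\<close>): the three paths joining the
two poles form a theta curve, and in a theta curve one of the three arcs always runs inside the
Jordan curve formed by the other two (\<open>theta_arc_meets_inside\<close>), so its middle vertex is cut off
from the outside. Hence the line graph is outerplanar iff \<open>\<mm>\<close> has at most 4 elements
(\<open>outerplanar_line_graph_iff\<close>).

It remains to find the rings that are not fields and have \<open>|\<mm>| \<le> 4\<close>. Let \<open>q = |A/\<mm>|\<close>, so that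
\<open>|A| = q |\<mm>|\<close>. For \<open>z \<noteq> 0\<close> in \<open>\<mm>\<close> the map \<open>a \<mapsto> a z\<close> sends \<open>A\<close> into \<open>\<mm>\<close> with kernel inside
\<open>\<mm>\<close>, whence \<open>q \<le> |\<mm>|\<close>; and \<open>q\<close> and \<open>|\<mm>|\<close> are not consecutive because both, as multiples of 1,
belong to \<open>\<mm>\<close>. This leaves \<open>(q, |\<mm>|) = (2,2), (3,3), (2,4), (4,4)\<close> (\<open>index_cases\<close>). If
\<open>q = |\<mm>|\<close> then \<open>\<mm>\<^sup>2 = 0\<close>, and the ring is decided by whether the characteristic is prime; for
\<open>q = 4\<close> a root of \<open>t\<^sup>2 + t + 1\<close> is obtained by lifting one from the residue field. If
\<open>(q, |\<mm>|) = (2,4)\<close>, the ring is decided by the order of 1 and by the products of elements of \<open>\<mm>\<close>,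
where most candidates are excluded since \<open>x m = x\<close> with \<open>m \<in> \<mm>\<close> forces \<open>x = 0\<close>.

To identify \<open>A\<close> with a quotient \<open>Q\<close> of a polynomial ring it is enough to find elements of \<open>A\<close> that
satisfy the relations of \<open>Q\<close> and generate \<open>A\<close>, and to know \<open>|Q| \<le> |A|\<close>: the induced map from \<open>Q\<close>
to \<open>A\<close> is then onto, hence bijective. The upper bounds on \<open>|Q|\<close> come from normal forms. The
same bounds serve the converse: the quotients have at
most 9 elements, which forces \<open>|\<mm>| \<le> 4\<close>, or at most 16 elements and a root of \<open>t\<^sup>2 + t + 1\<close>, in
which case \<open>q \<ge> 4\<close>.\<close>

section \<open>Theta curves in the plane\<close>

lemma Jordan_two_arcs:
  fixes c d :: "real \<Rightarrow> complex"
  assumes "arc c" "arc d" "pathstart c = a" "pathfinish c = b" "pathstart d = a" "pathfinish d = b"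
    and "path_image c \<inter> path_image d = {a, b}"
  defines "C \<equiv> path_image c \<union> path_image d"
  shows "inside C \<noteq> {}" "open (inside C)" "connected (inside C)" "connected (outside C)"
    "\<not> bounded (outside C)" "frontier (inside C) = C" "compact C"
    "inside C \<inter> outside C = {}" "inside C \<union> outside C = - C" "bounded (inside C)"
proof -
  have sp: "simple_path (c +++ reversepath d)"
    using assms by (intro simple_path_join_loop) (auto simp: arc_reversepath)
  have pi: "path_image (c +++ reversepath d) = C"
    using assms by (simp add: path_image_join)
  have "pathfinish (c +++ reversepath d) = pathstart (c +++ reversepath d)"
    using assms by simp
  from Jordan_inside_outside[OF sp this]
  show "inside C \<noteq> {}" "open (inside C)" "connected (inside C)" "connected (outside C)"
    "\<not> bounded (outside C)" "frontier (inside C) = C"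
    "inside C \<inter> outside C = {}" "inside C \<union> outside C = - C" "bounded (inside C)"
    unfolding pi by auto
  show "compact C"
    using assms unfolding C_def by (simp add: compact_Un compact_arc_image)
qed

text \<open>If the two bounded regions met, each would be a connected set that avoids the boundary of the
other, so they would coincide; but then so would their boundaries.\<close>

lemma insides_of_theta_disjoint:
  fixes c d e :: "real \<Rightarrow> complex"
  assumes arcs: "arc c" "arc d" "arc e"
    and ends: "pathstart c = a" "pathfinish c = b" "pathstart d = a" "pathfinish d = b"
      "pathstart e = a" "pathfinish e = b"
    and meet: "path_image c \<inter> path_image d = {a, b}" "path_image c \<inter> path_image e = {a, b}"
      "path_image d \<inter> path_image e = {a, b}"
    and e_out: "path_image e \<inter> inside (path_image c \<union> path_image d) = {}"
    and d_out: "path_image d \<inter> inside (path_image c \<union> path_image e) = {}"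
  shows "inside (path_image c \<union> path_image d) \<inter> inside (path_image c \<union> path_image e) = {}"
proof (rule ccontr)
  let ?C = "path_image c \<union> path_image d" and ?D = "path_image c \<union> path_image e"
  note C = Jordan_two_arcs[OF arcs(1,2) ends(1-4) meet(1)]
  note D = Jordan_two_arcs[OF arcs(1,3) ends(1,2,5,6) meet(2)]
  assume meets: "inside ?C \<inter> inside ?D \<noteq> {}"
  \<comment> \<open>A connected set that avoids a Jordan curve and meets its inside lies inside.\<close>
  have sub: "S \<subseteq> inside T" if "connected S" "S \<inter> T = {}" "S \<inter> inside T \<noteq> {}"
    for S T :: "complex set"
  proof -
    from that(3) obtain x where x: "x \<in> S" "x \<in> inside T" by blast
    have "y \<in> inside T" if "y \<in> S" for y
    proof -
      have "connected_component (- T) x y"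
        unfolding connected_component_def using \<open>connected S\<close> \<open>S \<inter> T = {}\<close> x that by blast
      then show ?thesis
        using x(2) inside_same_component by blast
    qed
    then show ?thesis by blast
  qed
  have "inside ?C \<inter> ?C = {}" "inside ?D \<inter> ?D = {}"
    using inside_no_overlap by auto
  then have "inside ?C \<inter> ?D = {}" "inside ?D \<inter> ?C = {}"
    using e_out d_out by blast+
  then have "inside ?C \<subseteq> inside ?D" "inside ?D \<subseteq> inside ?C"
    using meets sub[OF C(3), of ?D] sub[OF D(3), of ?C] by blast+
  then have "inside ?C = inside ?D" by (rule subset_antisym)
  then have "frontier (inside ?C) = frontier (inside ?D)" by (rule arg_cong)
  then have "?C = ?D" unfolding C(6) D(6) .
  then have "path_image d \<subseteq> {a, b}" using meet by blast
  moreover have "infinite (path_image d)"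
    using arc_image_uncountable[OF arcs(2)] uncountable_infinite by blast
  ultimately show False using finite_subset by blast
qed

text \<open>Suppose that none of the arcs enters the inside of the Jordan curve formed by the other two, so
that the three insides are pairwise disjoint. The closed discs bounded by \<open>c1 \<union> c2\<close> and by
\<open>c1 \<union> c3\<close> meet exactly in \<open>c1\<close>, which is connected; by Janiszewski's theorem the complement of
their union is connected. It avoids \<open>c2 \<union> c3\<close> and contains the inside of that curve, although it
is unbounded.\<close>

lemma theta_arc_meets_inside:
  fixes c1 c2 c3 :: "real \<Rightarrow> complex"
  assumes arcs: "arc c1" "arc c2" "arc c3"
    and ends: "pathstart c1 = a" "pathfinish c1 = b" "pathstart c2 = a" "pathfinish c2 = b"
      "pathstart c3 = a" "pathfinish c3 = b"
    and meet: "path_image c1 \<inter> path_image c2 = {a, b}" "path_image c1 \<inter> path_image c3 = {a, b}"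
      "path_image c2 \<inter> path_image c3 = {a, b}"
  shows "path_image c1 \<inter> inside (path_image c2 \<union> path_image c3) \<noteq> {} \<or>
    path_image c2 \<inter> inside (path_image c1 \<union> path_image c3) \<noteq> {} \<or>
    path_image c3 \<inter> inside (path_image c1 \<union> path_image c2) \<noteq> {}"
proof (rule ccontr)
  assume "\<not> ?thesis"
  then have out: "path_image c1 \<inter> inside (path_image c2 \<union> path_image c3) = {}"
    "path_image c2 \<inter> inside (path_image c1 \<union> path_image c3) = {}"
    "path_image c3 \<inter> inside (path_image c1 \<union> path_image c2) = {}"
    by auto
  have meet': "path_image c2 \<inter> path_image c1 = {a, b}" "path_image c3 \<inter> path_image c1 = {a, b}"
    "path_image c3 \<inter> path_image c2 = {a, b}"
    using meet by blast+
  let ?C12 = "path_image c1 \<union> path_image c2" and ?C13 = "path_image c1 \<union> path_image c3"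
    and ?C23 = "path_image c2 \<union> path_image c3"
  note J12 = Jordan_two_arcs[OF arcs(1,2) ends(1-4) meet(1)]
  note J13 = Jordan_two_arcs[OF arcs(1,3) ends(1,2,5,6) meet(2)]
  note J23 = Jordan_two_arcs[OF arcs(2,3) ends(3-6) meet(3)]
  have dis1: "inside ?C12 \<inter> inside ?C13 = {}"
    using insides_of_theta_disjoint[OF arcs ends meet out(3,2)] .
  have dis2: "inside ?C12 \<inter> inside ?C23 = {}"
    using insides_of_theta_disjoint[OF arcs(2,1,3) ends(3,4,1,2,5,6) meet'(1) meet(3,2)] out
    by (simp add: Un_commute)
  have dis3: "inside ?C13 \<inter> inside ?C23 = {}"
    using insides_of_theta_disjoint[OF arcs(3,1,2) ends(5,6,1,2,3,4) meet'(2,3) meet(1)] out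
    by (simp add: Un_commute)
  define K where "K = ?C12 \<union> inside ?C12"
  define L where "L = ?C13 \<union> inside ?C13"
  have cK: "- K = outside ?C12" "- L = outside ?C13"
    using J12(8,9) J13(8,9) outside_no_overlap[of ?C12] outside_no_overlap[of ?C13]
    unfolding K_def L_def by blast+
  have closure: "K = closure (inside ?C12)" "L = closure (inside ?C13)"
    using J12(6) J13(6) closure_Un_frontier unfolding K_def L_def by blast+
  then have compact: "compact K" "compact L"
    using J12(10) J13(10) by (simp_all add: compact_closure)
  have int: "K \<inter> L = path_image c1"
  proof -
    have "a \<in> path_image c1" "b \<in> path_image c1"
      using ends pathstart_in_path_image pathfinish_in_path_image by metis+
    then have "?C12 \<inter> ?C13 = path_image c1"
      using meet by blast
    moreover have "?C12 \<inter> inside ?C13 = {}"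
      using out(2) inside_no_overlap[of ?C13] by blast
    moreover have "inside ?C12 \<inter> ?C13 = {}"
      using out(3) inside_no_overlap[of ?C12] by blast
    ultimately show ?thesis
      unfolding K_def L_def Int_Un_distrib Int_Un_distrib2 dis1 by auto
  qed
  have "connected (- (K \<union> L))"
  proof (rule Janiszewski_connected)
    show "connected (K \<inter> L)"
      unfolding int using arcs(1) by (simp add: connected_arc_image)
  qed (use compact cK J12(4) J13(4) in \<open>auto simp: compact_imp_closed\<close>)
  moreover have "- (K \<union> L) \<subseteq> - ?C23"
    unfolding K_def L_def by blast
  moreover obtain x where x: "x \<in> inside ?C23"
    using J23(1) by blast
  moreover have "x \<notin> K \<union> L"
    using x dis2 dis3 out(1) inside_no_overlap[of ?C23] unfolding K_def L_def by blast
  ultimately have "- (K \<union> L) \<subseteq> connected_component_set (- ?C23) x"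
    by (intro connected_component_maximal) auto
  then have "bounded (- (K \<union> L))"
    using x bounded_subset by (auto simp: inside_def)
  moreover have "bounded (K \<union> L)"
    using compact by (simp add: compact_imp_bounded)
  ultimately show False
    using cobounded_imp_unbounded by blast
qed

lemma inside_not_on_outer_boundary:
  fixes C D :: "complex set"
  assumes "closed C" "C \<subseteq> D" "x \<in> inside C"
  shows "x \<notin> frontier (outside D)"
proof -
  have "open (inside C)"
    using assms(1) by (rule open_inside)
  moreover have "inside C \<inter> outside D = {}"
    using outside_mono[OF assms(2)] by (meson disjoint_iff inside_Int_outside subsetD)
  ultimately have "inside C \<inter> closure (outside D) = {}"
    by (simp add: open_Int_closure_eq_empty)
  then show ?thesis
    using assms(3) by (auto simp: frontier_def)
qed

text \<open>An arc without its end points is connected, so as soon as it enters the inside of the other two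
arcs it stays there.\<close>

lemma theta_interior_point_not_outer:
  fixes c1 c2 c3 :: "real \<Rightarrow> complex"
  assumes arcs: "arc c1" "arc c2" "arc c3"
    and ends: "pathstart c1 = a" "pathfinish c1 = b" "pathstart c2 = a" "pathfinish c2 = b"
      "pathstart c3 = a" "pathfinish c3 = b"
    and meet: "path_image c1 \<inter> path_image c2 = {a, b}" "path_image c1 \<inter> path_image c3 = {a, b}"
      "path_image c2 \<inter> path_image c3 = {a, b}"
    and sub: "path_image c2 \<union> path_image c3 \<subseteq> D"
    and inner: "path_image c1 \<inter> inside (path_image c2 \<union> path_image c3) \<noteq> {}"
    and x: "x \<in> path_image c1 - {a, b}"
  shows "x \<notin> frontier (outside D)"
proof (rule inside_not_on_outer_boundary)
  let ?C = "path_image c2 \<union> path_image c3"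
  show "closed ?C"
    using arcs by (simp add: closed_Un closed_arc_image)
  obtain y where y: "y \<in> path_image c1" "y \<in> inside ?C"
    using inner by blast
  have "connected (path_image c1 - {a, b})"
    using connected_simple_path_endless[OF arc_imp_simple_path[OF arcs(1)]] ends by simp
  moreover have "path_image c1 - {a, b} \<subseteq> - ?C"
    using meet by blast
  moreover have "y \<in> path_image c1 - {a, b}"
    using y meet inside_no_overlap[of ?C] by blast
  ultimately have "connected_component (- ?C) y x"
    unfolding connected_component_def using x by blast
  then show "x \<in> inside ?C"
    using y(2) inside_same_component by blast
qed (use sub in blast)

section \<open>Outerplanarity of line graphs of complete graphs\<close>

text \<open>The drawing fixes no orientation of an edge; here it is chosen.\<close>

lemma plane_drawing_edge_arc:
  assumes "plane_drawing G p g" "{u, v} \<in> snd G" "u \<in> fst G" "v \<in> fst G" "u \<noteq> v"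
  obtains c where "arc c" "pathstart c = p u" "pathfinish c = p v"
    "path_image c = path_image (g {u, v})"
proof -
  have "p u \<noteq> p v"
    using assms by (auto simp: plane_drawing_def inj_on_def)
  moreover have a: "arc (g {u, v})" "{pathstart (g {u, v}), pathfinish (g {u, v})} = {p u, p v}"
    using assms by (auto simp: plane_drawing_def)
  ultimately consider "pathstart (g {u, v}) = p u" "pathfinish (g {u, v}) = p v"
    | "pathstart (g {u, v}) = p v" "pathfinish (g {u, v}) = p u"
    by (auto simp: doubleton_eq_iff)
  then show ?thesis
  proof cases
    case 1
    with a show ?thesis using that by blast
  next
    case 2
    with a show ?thesis using that[of "reversepath (g {u, v})"] by (simp add: arc_reversepath)
  qed
qed

text \<open>The vertices \<open>a\<close> and \<open>b\<close> are the poles of a theta curve whose three arcs pass through \<open>c1\<close>, \<open>c2\<close>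
and \<open>c3\<close>.\<close>

lemma K23_not_outerplanar:
  assumes "outerplanar G"
    and verts: "{a, b, c1, c2, c3} \<subseteq> fst G" "card {a, b, c1, c2, c3} = 5"
    and edges: "\<And>c. c \<in> {c1, c2, c3} \<Longrightarrow> {a, c} \<in> snd G \<and> {c, b} \<in> snd G"
  shows False
proof -
  obtain p g where draw: "plane_drawing G p g"
    and outer: "p ` fst G \<subseteq> frontier (outside (drawing_points G p g))"
    using assms(1) unfolding outerplanar_def by blast
  have inj: "inj_on p (fst G)"
    using draw unfolding plane_drawing_def by blast
  have cross: "path_image (g e) \<inter> path_image (g f) = p ` (e \<inter> f)"
    if "e \<in> snd G" "f \<in> snd G" "e \<noteq> f" for e f
    using draw that unfolding plane_drawing_def by blast
  have dist: "distinct [a, b, c1, c2, c3]"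
    using verts(2) by (intro card_distinct) simp
  define route where "route c = path_image (g {a, c}) \<union> path_image (g {c, b})" for c
  have route: "\<exists>h. arc h \<and> pathstart h = p a \<and> pathfinish h = p b \<and> path_image h = route c"
    if c: "c \<in> {c1, c2, c3}" for c
  proof -
    have ne: "c \<noteq> a" "c \<noteq> b" "a \<noteq> b" and v: "a \<in> fst G" "b \<in> fst G" "c \<in> fst G"
      using dist c verts by auto
    obtain h where h: "arc h" "pathstart h = p a" "pathfinish h = p c"
        "path_image h = path_image (g {a, c})"
      using plane_drawing_edge_arc[OF draw, of a c] edges[OF c] v ne by metis
    obtain k where k: "arc k" "pathstart k = p c" "pathfinish k = p b"
        "path_image k = path_image (g {c, b})"
      using plane_drawing_edge_arc[OF draw, of c b] edges[OF c] v ne by metis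
    have "{a, c} \<noteq> {c, b}" "{a, c} \<inter> {c, b} = {c}"
      using ne by (auto simp: doubleton_eq_iff)
    then have "path_image h \<inter> path_image k = {p c}"
      using cross[of "{a, c}" "{c, b}"] edges[OF c] h(4) k(4) by (metis image_empty image_insert)
    then have "arc (h +++ k)"
      using h k by (intro arc_join) auto
    then show ?thesis
      using h k by (intro exI[of _ "h +++ k"]) (simp add: path_image_join route_def)
  qed
  have meet: "route c \<inter> route d = {p a, p b}"
    if c: "c \<in> {c1, c2, c3}" and d: "d \<in> {c1, c2, c3}" and "c \<noteq> d" for c d
  proof -
    have ne: "c \<noteq> a" "c \<noteq> b" "a \<noteq> b" "d \<noteq> a" "d \<noteq> b"
      using dist c d by auto
    have "path_image (g {a, c}) \<inter> path_image (g {a, d}) = p ` ({a, c} \<inter> {a, d})"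
      "path_image (g {a, c}) \<inter> path_image (g {d, b}) = p ` ({a, c} \<inter> {d, b})"
      "path_image (g {c, b}) \<inter> path_image (g {a, d}) = p ` ({c, b} \<inter> {a, d})"
      "path_image (g {c, b}) \<inter> path_image (g {d, b}) = p ` ({c, b} \<inter> {d, b})"
      by (rule cross; use edges[OF c] edges[OF d] ne \<open>c \<noteq> d\<close> in \<open>simp add: doubleton_eq_iff\<close>)+
    moreover have "{a, c} \<inter> {a, d} = {a}" "{a, c} \<inter> {d, b} = {}" "{c, b} \<inter> {a, d} = {}"
      "{c, b} \<inter> {d, b} = {b}"
      using ne \<open>c \<noteq> d\<close> by auto
    ultimately show ?thesis
      unfolding route_def by auto
  qed
  obtain h1 h2 h3 where arcs: "arc h1" "arc h2" "arc h3"
    and ends: "pathstart h1 = p a" "pathfinish h1 = p b" "pathstart h2 = p a" "pathfinish h2 = p b"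
      "pathstart h3 = p a" "pathfinish h3 = p b"
    and img: "path_image h1 = route c1" "path_image h2 = route c2" "path_image h3 = route c3"
    using route[of c1] route[of c2] route[of c3] by auto
  have meets: "path_image h1 \<inter> path_image h2 = {p a, p b}"
    "path_image h1 \<inter> path_image h3 = {p a, p b}" "path_image h2 \<inter> path_image h3 = {p a, p b}"
    unfolding img using dist by (simp_all add: meet)
  then have meets': "path_image h2 \<inter> path_image h1 = {p a, p b}"
    "path_image h3 \<inter> path_image h1 = {p a, p b}" "path_image h3 \<inter> path_image h2 = {p a, p b}"
    by (simp_all add: Int_commute)
  have mid: "p c \<in> route c - {p a, p b}" "p c \<in> frontier (outside (drawing_points G p g))"
    if c: "c \<in> {c1, c2, c3}" for c
  proof -
    have "p c \<notin> {p a, p b}"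
      using inj verts c dist by (auto simp: inj_on_def)
    moreover have "p c \<in> route c"
      using draw edges[OF c] unfolding plane_drawing_def route_def by blast
    moreover have "c \<in> fst G"
      using verts c by auto
    ultimately show "p c \<in> route c - {p a, p b}"
      "p c \<in> frontier (outside (drawing_points G p g))"
      using outer by auto
  qed
  have sub: "route c \<subseteq> drawing_points G p g" if "c \<in> {c1, c2, c3}" for c
    using edges[OF that] unfolding route_def drawing_points_def by blast
  show False
    using theta_arc_meets_inside[OF arcs ends meets]
  proof (elim disjE)
    assume "path_image h1 \<inter> inside (path_image h2 \<union> path_image h3) \<noteq> {}"
    from theta_interior_point_not_outer[OF arcs ends meets _ this, of _ "p c1"]
    show False using mid[of c1] sub img by (metis Un_least insertCI)
  next
    assume "path_image h2 \<inter> inside (path_image h1 \<union> path_image h3) \<noteq> {}"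
    from theta_interior_point_not_outer[OF arcs(2,1,3) ends(3,4,1,2,5,6) meets'(1) meets(3,2) _ this,
        of _ "p c2"]
    show False using mid[of c2] sub img by (metis Un_least insertCI)
  next
    assume "path_image h3 \<inter> inside (path_image h1 \<union> path_image h2) \<noteq> {}"
    from theta_interior_point_not_outer[OF arcs(3,1,2) ends(5,6,1-4) meets'(2,3) meets(1) _ this,
        of _ "p c3"]
    show False using mid[of c3] sub img by (metis Un_least insertCI)
  qed
qed

text \<open>By strict convexity of the disc a chord meets the circle only in its end points, so no three points
of the circle are collinear.\<close>

lemma unit_circle_segments_Int:
  fixes a b c :: complex
  assumes "norm a = 1" "norm b = 1" "norm c = 1" "a \<noteq> b" "a \<noteq> c" "b \<noteq> c"
  shows "closed_segment a b \<inter> closed_segment a c = {a}" "c \<notin> closed_segment a b"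
proof -
  have *: "z \<notin> closed_segment x y" if "norm x = 1" "norm y = 1" "norm z = 1" "z \<noteq> x" "z \<noteq> y"
    for x y z :: complex
    using that dist_decreases_open_segment[of z x y 0] by (auto simp: open_segment_def)
  then show "c \<notin> closed_segment a b" using assms by blast
  have "\<not> collinear {b, a, c}"
    using assms * by (auto simp: collinear_between_cases between_mem_segment)
  then show "closed_segment a b \<inter> closed_segment a c = {a}"
    using Int_closed_segment[of a b c] by (simp add: closed_segment_commute)
qed

text \<open>The vertices are put on the unit circle and the edges are chords. The drawing then lies in the
closed unit disc, whose exterior belongs to the outside of the drawing and has every point of the
circle in its closure.\<close>

lemma outerplanar_at_most_three_vertices:
  assumes fin: "finite (fst G)" and card: "card (fst G) \<le> 3"
    and edges: "\<And>e. e \<in> snd G \<Longrightarrow> e \<subseteq> fst G \<and> card e = 2"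
  shows "outerplanar G"
proof -
  have "card {1, \<i>, -1 :: complex} = 3"
    by (simp add: complex_eq_iff)
  then obtain p where p: "p ` fst G \<subseteq> {1, \<i>, -1 :: complex}" and inj: "inj_on p (fst G)"
    using card_le_inj[OF fin, of "{1, \<i>, -1 :: complex}"] card by auto
  have circle: "norm (p v) = 1" if "v \<in> fst G" for v
    using p that by auto
  have "\<exists>u v. e = {u, v} \<and> u \<noteq> v" if "e \<in> snd G" for e
    using edges[OF that] by (auto simp: card_2_iff)
  then obtain s t where st: "\<And>e. e \<in> snd G \<Longrightarrow> e = {s e, t e} \<and> s e \<noteq> t e"
    by metis
  define g where "g e = linepath (p (s e)) (p (t e))" for e
  have img: "path_image (g {u, v}) = closed_segment (p u) (p v)" if "{u, v} \<in> snd G" for u v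
  proof -
    have "{u, v} = {s {u, v}, t {u, v}}" using st[OF that] by simp
    then show ?thesis
      unfolding g_def by (auto simp: doubleton_eq_iff closed_segment_commute)
  qed
  have "plane_drawing G p g"
    unfolding plane_drawing_def
  proof (intro conjI ballI impI inj)
    fix e assume e: "e \<in> snd G"
    then have v: "s e \<in> fst G" "t e \<in> fst G" and ne: "s e \<noteq> t e" and e_eq: "e = {s e, t e}"
      using st edges by blast+
    have pne: "p (s e) \<noteq> p (t e)"
      using inj v ne by (auto simp: inj_on_def)
    then show "arc (g e)"
      unfolding g_def by simp
    show "{pathstart (g e), pathfinish (g e)} = p ` e"
      using arg_cong[OF e_eq, of "\<lambda>x. p ` x"] unfolding g_def by simp
    have "path_image (g e) \<inter> p ` fst G = p ` {s e, t e}"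
    proof -
      have "p w \<notin> path_image (g e)" if "w \<in> fst G" "w \<noteq> s e" "w \<noteq> t e" for w
        unfolding g_def path_image_linepath
        using unit_circle_segments_Int(2)[of "p (s e)" "p (t e)" "p w"] circle v that pne inj
        by (metis inj_on_def)
      then show ?thesis
        using v unfolding g_def by auto
    qed
    then show "path_image (g e) \<inter> p ` fst G = p ` e"
      using e_eq by simp
  next
    fix e f assume e: "e \<in> snd G" and f: "f \<in> snd G" and "e \<noteq> f"
    have fin': "finite e" "finite f"
      using edges[OF e] edges[OF f] fin finite_subset by blast+
    \<comment> \<open>Among three vertices two edges must share one.\<close>
    have "card (e \<union> f) \<le> 3"
      using edges[OF e] edges[OF f] fin card by (meson card_mono le_sup_iff order_trans)
    then have "e \<inter> f \<noteq> {}"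
      using edges[OF e] edges[OF f] card_Un_disjoint[OF fin'] by auto
    then obtain u where "u \<in> e" "u \<in> f" by blast
    have other: "\<exists>v. h = {u, v} \<and> u \<noteq> v" if "card h = 2" "u \<in> h" for h
      using that by (auto simp: card_2_iff)
    obtain v w where evw: "e = {u, v}" "f = {u, w}" "u \<noteq> v" "u \<noteq> w"
      using other[of e] other[of f] edges[OF e] edges[OF f] \<open>u \<in> e\<close> \<open>u \<in> f\<close> by auto
    then have "v \<noteq> w" using \<open>e \<noteq> f\<close> by blast
    have vs: "u \<in> fst G" "v \<in> fst G" "w \<in> fst G"
      using edges[OF e] edges[OF f] evw by auto
    have "closed_segment (p u) (p v) \<inter> closed_segment (p u) (p w) = {p u}"
      using evw(3,4) \<open>v \<noteq> w\<close> vs circle inj_onD[OF inj]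
      by (intro unit_circle_segments_Int(1)) blast+
    then have "path_image (g e) \<inter> path_image (g f) = {p u}"
      using img e f unfolding evw by simp
    moreover have "e \<inter> f = {u}"
      using evw \<open>v \<noteq> w\<close> by auto
    ultimately show "path_image (g e) \<inter> path_image (g f) = p ` (e \<inter> f)"
      by simp
  qed
  moreover have "p ` fst G \<subseteq> frontier (outside (drawing_points G p g))"
  proof -
    have inball: "drawing_points G p g \<subseteq> cball 0 1"
    proof -
      have "path_image (g e) \<subseteq> cball 0 1" if "e \<in> snd G" for e
      proof -
        have "s e \<in> fst G" "t e \<in> fst G"
          using edges[OF that] st[OF that] by blast+
        then show ?thesis
          unfolding g_def path_image_linepath by (intro closed_segment_subset) (simp_all add: circle)
      qed
      moreover have "p ` fst G \<subseteq> cball 0 1"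
        using circle by auto
      ultimately show ?thesis
        unfolding drawing_points_def by (meson UN_least Un_least)
    qed
    have "- cball 0 1 \<subseteq> outside (drawing_points G p g)"
      using outside_mono[OF inball] outside_convex[of "cball (0::complex) 1"] by simp
    then have "closure (- cball 0 1) \<subseteq> closure (outside (drawing_points G p g))"
      by (rule closure_mono)
    moreover have "p ` fst G \<subseteq> closure (- cball 0 1)"
      using circle by (auto simp: closure_complement interior_cball)
    moreover have "p ` fst G \<inter> outside (drawing_points G p g) = {}"
      using outside_no_overlap[of "drawing_points G p g"] unfolding drawing_points_def by blast
    ultimately show ?thesis
      using interior_subset unfolding frontier_def by blast
  qed
  ultimately show ?thesis
    unfolding outerplanar_def by blast
qed

definition complete_graph :: "'v set \<Rightarrow> 'v sgraph" where
  "complete_graph V = (V, {{u, v} | u v. u \<in> V \<and> v \<in> V \<and> u \<noteq> v})"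

text \<open>On vertices \<open>w, x, y, z\<close> the edges \<open>wx\<close> and \<open>yz\<close> are the poles of a \<open>K\<^sub>2\<^sub>,\<^sub>3\<close> in the
line graph: each of \<open>wy, wz, xy\<close> shares a vertex with both. For \<open>|V| \<le> 3\<close> there are
at most \<open>3 choose 2 = 3\<close> edges.\<close>

lemma outerplanar_line_graph_complete:
  assumes "finite V"
  shows "outerplanar (line_graph (complete_graph V)) \<longleftrightarrow> card V \<le> 3"
proof
  assume "card V \<le> 3"
  let ?E = "{{u, v} | u v. u \<in> V \<and> v \<in> V \<and> u \<noteq> v}"
  have E: "?E = {B. B \<subseteq> V \<and> card B = 2}"
    by (auto simp: card_2_iff)
  have "finite ?E"
    using assms unfolding E by simp
  moreover have "card ?E \<le> 3"
  proof -
    have "card ?E = card V choose 2"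
      unfolding E by (rule n_subsets[OF assms])
    also have "\<dots> \<le> 3 choose 2"
      using \<open>card V \<le> 3\<close> by (rule binomial_right_mono)
    finally show ?thesis by (simp add: choose_two)
  qed
  ultimately show "outerplanar (line_graph (complete_graph V))"
  proof (intro outerplanar_at_most_three_vertices)
    fix h assume "h \<in> snd (line_graph (complete_graph V))"
    then obtain e f where "h = {e, f}" "e \<noteq> f" "{e, f} \<subseteq> ?E"
      unfolding line_graph_def complete_graph_def by auto
    then show "h \<subseteq> fst (line_graph (complete_graph V)) \<and> card h = 2"
      unfolding line_graph_def complete_graph_def by simp
  qed (simp_all add: line_graph_def complete_graph_def)
next
  assume op: "outerplanar (line_graph (complete_graph V))"
  show "card V \<le> 3"
  proof (rule ccontr)
    assume "\<not> card V \<le> 3"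
    then have "4 \<le> card V" by simp
    then obtain T where "T \<subseteq> V" "card T = 4"
      by (meson obtain_subset_with_card_n)
    moreover obtain xs where "distinct xs" "set xs = T"
      using assms \<open>T \<subseteq> V\<close> finite_distinct_list finite_subset by metis
    ultimately have "length xs = 4" using distinct_card by metis
    then obtain w x y z where "xs = [w, x, y, z]"
      by (auto simp: numeral_eq_Suc length_Suc_conv)
    with \<open>distinct xs\<close> \<open>set xs = T\<close> \<open>T \<subseteq> V\<close>
    have V: "w \<in> V" "x \<in> V" "y \<in> V" "z \<in> V" and ne: "distinct [w, x, y, z]" by auto
    have E: "{u, v} \<in> snd (complete_graph V)" if "u \<in> V" "v \<in> V" "u \<noteq> v" for u v
      using that unfolding complete_graph_def by auto
    have L: "{e, f} \<in> snd (line_graph (complete_graph V))"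
      if "e \<in> snd (complete_graph V)" "f \<in> snd (complete_graph V)" "e \<noteq> f" "e \<inter> f \<noteq> {}" for e f
      using that unfolding line_graph_def by auto
    show False
    proof (rule K23_not_outerplanar[OF op, of "{w, x}" "{y, z}" "{w, y}" "{w, z}" "{x, y}"])
      show "{{w, x}, {y, z}, {w, y}, {w, z}, {x, y}} \<subseteq> fst (line_graph (complete_graph V))"
        using V ne E by (simp add: line_graph_def)
      show "card {{w, x}, {y, z}, {w, y}, {w, z}, {x, y}} = 5"
        using ne by (auto simp: doubleton_eq_iff card_insert_if)
    qed (use V ne in \<open>auto intro!: L E simp: doubleton_eq_iff\<close>)
  qed
qed

section \<open>Finite local rings\<close>

locale finite_local_ring = cring R for R (structure) +
  assumes finite_carrier: "finite (carrier R)"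
    and one_neq_zero: "\<one> \<noteq> \<zero>"
    and unique_maximal: "local_ring R"
begin

abbreviation nonunits :: "'a set" ("\<mm>") where
  "\<mm> \<equiv> carrier R - Units R"

text \<open>Every nonunit generates a proper ideal, which by finiteness lies in a maximal one.\<close>

lemma maximalideal_nonunits: "maximalideal \<mm> R"
proof -
  obtain M where M: "maximalideal M R" and uniq: "\<And>N. maximalideal N R \<Longrightarrow> N = M"
    using unique_maximal unfolding local_ring_def by blast
  interpret M: maximalideal M R by (rule M)
  have "a \<in> M" if a: "a \<in> carrier R" "a \<notin> Units R" for a
  proof -
    let ?S = "{I. ideal I R \<and> a \<in> I \<and> I \<noteq> carrier R}"
    have "?S \<subseteq> Pow (carrier R)"
      using ideal.Icarr by fastforce
    then have "finite ?S"
      using finite_carrier finite_subset by blast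
    moreover have "PIdl a \<in> ?S"
    proof -
      have "\<one> \<notin> PIdl a"
        using a m_comm unfolding cgenideal_def Units_def by fastforce
      then show ?thesis
        using cgenideal_ideal cgenideal_self a(1) by auto
    qed
    ultimately obtain N where N: "N \<in> ?S" "\<And>J. J \<in> ?S \<Longrightarrow> N \<subseteq> J \<Longrightarrow> J = N"
      using finite_has_maximal[of ?S] by (metis (no_types, lifting) empty_iff)
    have "maximalideal N R"
      using N by (intro maximalidealI) auto
    then show "a \<in> M"
      using uniq N(1) by blast
  qed
  moreover have "a \<notin> M" if "a \<in> Units R" for a
    using that M.I_notcarr M.I_r_closed M.one_imp_carrier Units_r_inv Units_inv_closed by metis
  ultimately have "\<mm> = M"
    using M.Icarr by blast
  then show ?thesis using M by simp
qed

sublocale mm: maximalideal \<mm> R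
  by (rule maximalideal_nonunits)

lemma nonunits_closed:
  "a \<in> \<mm> \<Longrightarrow> b \<in> \<mm> \<Longrightarrow> a \<oplus> b \<in> \<mm>"
  "a \<in> \<mm> \<Longrightarrow> \<ominus> a \<in> \<mm>"
  "a \<in> \<mm> \<Longrightarrow> b \<in> \<mm> \<Longrightarrow> a \<ominus> b \<in> \<mm>"
  "a \<in> \<mm> \<Longrightarrow> c \<in> carrier R \<Longrightarrow> a \<otimes> c \<in> \<mm>"
  "a \<in> \<mm> \<Longrightarrow> c \<in> carrier R \<Longrightarrow> c \<otimes> a \<in> \<mm>"
  "\<zero> \<in> \<mm>"
  using mm.a_closed mm.a_inv_closed mm.I_r_closed mm.I_l_closed mm.zero_closed
  by (simp_all only: a_minus_def)

lemma one_notin_nonunits: "\<one> \<notin> \<mm>"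
  by simp

text \<open>Regularity of units, phrased with \<open>u \<notin> \<mm>\<close> since that is how units arise below.\<close>

lemma unit_cancel:
  assumes "x \<in> carrier R" "u \<in> carrier R" "u \<notin> \<mm>" "x \<otimes> u = \<zero>"
  shows "x = \<zero>"
proof -
  have u: "u \<in> Units R" using assms by blast
  have "x = x \<otimes> u \<otimes> inv u"
    using assms(1) u m_assoc[OF assms(1) Units_closed[OF u] Units_inv_closed[OF u]] by simp
  also have "\<dots> = \<zero>"
    unfolding assms(4) using u by simp
  finally show ?thesis .
qed

lemma one_minus_nonunit:
  assumes "x \<in> \<mm>" shows "\<one> \<ominus> x \<notin> \<mm>"
proof
  assume "\<one> \<ominus> x \<in> \<mm>"
  then have "(\<one> \<ominus> x) \<oplus> x \<in> \<mm>"
    using assms nonunits_closed(1) by blast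
  moreover have "(\<one> \<ominus> x) \<oplus> x = \<one>"
    using assms by (simp add: a_minus_def a_assoc l_neg)
  ultimately show False by simp
qed

text \<open>The elementary form of Nakayama's lemma: \<open>1 - m\<close> is a unit and kills \<open>x\<close>.\<close>

lemma fixed_by_nonunit:
  assumes "x \<in> carrier R" "m \<in> \<mm>" "x \<otimes> m = x"
  shows "x = \<zero>"
proof -
  have "x \<otimes> (\<one> \<ominus> m) = \<zero>"
    using assms by (simp add: a_minus_def r_distr r_minus r_neg)
  then show ?thesis
    using unit_cancel[OF assms(1) _ one_minus_nonunit[OF assms(2)]] assms(2) by simp
qed

text \<open>Two powers of \<open>a\<close> coincide by finiteness, so some power of \<open>a\<close> is fixed by a nonunit.\<close>

lemma nonunit_nilpotent:
  assumes "a \<in> \<mm>"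
  shows "\<exists>n::nat. a [^] n = \<zero>"
proof -
  have "\<not> inj (\<lambda>n::nat. a [^] n)"
  proof
    assume inj: "inj (\<lambda>n::nat. a [^] n)"
    have "range (\<lambda>n::nat. a [^] n) \<subseteq> carrier R"
      using assms by auto
    then show False
      using finite_imageD[OF _ inj] finite_carrier finite_subset infinite_UNIV_nat by blast
  qed
  then obtain i j :: nat where "a [^] i = a [^] j" "i < j"
    by (metis injI linorder_neqE_nat)
  moreover define d where "d = j - i - 1"
  ultimately have "a [^] i \<otimes> a [^] Suc d = a [^] i"
    using assms by (metis DiffD1 Suc_diff_Suc diff_Suc_eq_diff_pred diff_commute le_add_diff_inverse nat_less_le nat_pow_mult)
  moreover have "a [^] Suc d \<in> \<mm>"
    using assms by (simp only: nat_pow_Suc) (intro nonunits_closed(5), auto)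
  ultimately show ?thesis
    using fixed_by_nonunit[of "a [^] i" "a [^] Suc d"] assms by blast
qed

lemma last_nonzero_power:
  assumes "a \<in> \<mm>" "j \<in> carrier R" "j \<noteq> \<zero>"
  obtains n :: nat where "a [^] n \<otimes> j \<noteq> \<zero>" "a \<otimes> (a [^] n \<otimes> j) = \<zero>"
proof -
  have "\<exists>n::nat. a [^] n \<otimes> j = \<zero>"
    using nonunit_nilpotent[OF assms(1)] assms(2) by (metis l_null)
  then obtain n :: nat where n: "a [^] n \<otimes> j = \<zero>" "\<And>k. k < n \<Longrightarrow> a [^] k \<otimes> j \<noteq> \<zero>"
    using exists_least_iff[of "\<lambda>n. a [^] n \<otimes> j = \<zero>"] by blast
  have "n \<noteq> 0" using n(1) assms by (metis l_one nat_pow_0)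
  then obtain k where "n = Suc k" using not0_implies_Suc by blast
  moreover have "a [^] Suc k \<otimes> j = a \<otimes> (a [^] k \<otimes> j)"
    using assms by (simp add: m_ac)
  ultimately show ?thesis
    using n that[of k] by simp
qed

lemma zero_divisors_eq: "zero_divisors R = \<mm>"
proof
  show "zero_divisors R \<subseteq> \<mm>"
  proof
    fix a assume "a \<in> zero_divisors R"
    then obtain b where "a \<in> carrier R" "b \<in> carrier R" "b \<noteq> \<zero>" "a \<otimes> b = \<zero>"
      unfolding zero_divisors_def by blast
    then show "a \<in> \<mm>"
      using unit_cancel[of b a] m_comm[of a b] by metis
  qed
  show "\<mm> \<subseteq> zero_divisors R"
  proof
    fix a assume a: "a \<in> \<mm>"
    obtain n :: nat where "a [^] n \<otimes> \<one> \<noteq> \<zero>" "a \<otimes> (a [^] n \<otimes> \<one>) = \<zero>"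
      using last_nonzero_power[OF a one_closed one_neq_zero] by blast
    then show "a \<in> zero_divisors R"
      using a unfolding zero_divisors_def by auto
  qed
qed

lemma ideal_annihilator:
  assumes "a \<in> carrier R" shows "ideal (annihilator R a) R"
proof (rule idealI[OF ring_axioms])
  show "subgroup (annihilator R a) (add_monoid R)"
    using assms by (intro subgroup.intro)
      (auto simp: annihilator_def r_distr r_minus a_inv_def[symmetric])
next
  fix r x assume r: "r \<in> annihilator R a" and x: "x \<in> carrier R"
  then have "a \<otimes> (x \<otimes> r) = x \<otimes> (a \<otimes> r)"
    using assms by (intro m_lcomm) (auto simp: annihilator_def)
  then show "x \<otimes> r \<in> annihilator R a" "r \<otimes> x \<in> annihilator R a"
    using r x by (auto simp: annihilator_def m_comm)
qed

text \<open>Multiplying an element of \<open>J\<close> by \<open>a\<close> as long as the product does not vanish ends in the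
annihilator.\<close>

lemma annihilator_nonunit_essential:
  assumes "a \<in> \<mm>"
  shows "essential_ideal (annihilator R a) R"
  unfolding essential_ideal_def
proof (intro conjI allI impI)
  show "ideal (annihilator R a) R"
    using assms by (intro ideal_annihilator) simp
  fix J assume J: "ideal J R \<and> J \<noteq> {\<zero>}"
  then interpret J: ideal J R by simp
  obtain j where j: "j \<in> J" "j \<noteq> \<zero>"
    using J J.zero_closed by blast
  obtain n :: nat where n: "a [^] n \<otimes> j \<noteq> \<zero>" "a \<otimes> (a [^] n \<otimes> j) = \<zero>"
    using last_nonzero_power[OF assms] j J.Icarr by blast
  have "a [^] n \<otimes> j \<in> J"
    using assms j by (intro J.I_l_closed) auto
  then have "a [^] n \<otimes> j \<in> annihilator R a \<inter> J"
    using n(2) J.Icarr unfolding annihilator_def by blast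
  then show "annihilator R a \<inter> J \<noteq> {\<zero>}"
    using n(1) by blast
qed

lemma essential_graph_complete: "essential_graph R = complete_graph (\<mm> - {\<zero>})"
proof -
  have "essential_ideal (annihilator R (u \<otimes> v)) R" if "u \<in> \<mm> - {\<zero>}" "v \<in> \<mm> - {\<zero>}" for u v
    using that annihilator_nonunit_essential nonunits_closed(4) by blast
  then show ?thesis
    unfolding essential_graph_def complete_graph_def zero_divisors_eq Let_def by blast
qed

lemma finite_nonunits: "finite \<mm>"
  using finite_carrier by simp

theorem outerplanar_line_graph_iff:
  "outerplanar (line_graph (essential_graph R)) \<longleftrightarrow> card \<mm> \<le> 4"
proof -
  have "card \<mm> = Suc (card (\<mm> - {\<zero>}))"
    using finite_nonunits nonunits_closed(6) by (metis card.remove)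
  then show ?thesis
    unfolding essential_graph_complete
    by (subst outerplanar_line_graph_complete) (use finite_nonunits in auto)
qed

text \<open>The translates of \<open>\<mm>\<close> by the elements of \<open>T\<close> are disjoint.\<close>

lemma card_mult_nonunits_le:
  assumes T: "T \<subseteq> carrier R"
    and incong: "\<And>s t. s \<in> T \<Longrightarrow> t \<in> T \<Longrightarrow> s \<noteq> t \<Longrightarrow> s \<ominus> t \<notin> \<mm>"
  shows "card T * card \<mm> \<le> card (carrier R)"
proof -
  have "inj_on (\<lambda>(t, m). t \<oplus> m) (T \<times> \<mm>)"
  proof (rule inj_onI)
    fix p q assume p: "p \<in> T \<times> \<mm>" and q: "q \<in> T \<times> \<mm>"
      and pq_eq: "(case p of (t, m) \<Rightarrow> t \<oplus> m) = (case q of (t, m) \<Rightarrow> t \<oplus> m)"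
    obtain s m t n where pq: "p = (s, m)" "q = (t, n)" and s: "s \<in> T" and t: "t \<in> T"
      and m: "m \<in> \<mm>" and n: "n \<in> \<mm>"
      using p q by (elim SigmaE)
    have eq: "s \<oplus> m = t \<oplus> n"
      using pq_eq unfolding pq by simp
    have c: "s \<in> carrier R" "t \<in> carrier R" "m \<in> carrier R" "n \<in> carrier R"
      using T s t m n by auto
    have "s \<ominus> t = n \<ominus> m"
    proof -
      have "s \<ominus> t = (s \<oplus> m) \<ominus> m \<ominus> t"
        using c by algebra
      also have "\<dots> = n \<ominus> m"
        unfolding eq using c by algebra
      finally show ?thesis .
    qed
    then have "s = t"
      using incong[OF s t] nonunits_closed(3)[OF n m] by auto
    then show "p = q"
      using eq c pq by simp
  qed
  moreover have "(\<lambda>(t, m). t \<oplus> m) ` (T \<times> \<mm>) \<subseteq> carrier R"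
    using T by auto
  ultimately have "card (T \<times> \<mm>) \<le> card (carrier R)"
    using card_inj_on_le finite_carrier by blast
  then show ?thesis by (simp only: card_cartesian_product)
qed

text \<open>The nonempty fibres of \<open>a \<mapsto> a z\<close> are translates of the annihilator of \<open>z\<close>, and there are at most
\<open>|\<mm>|\<close> of them.\<close>

lemma card_le_nonunits_mult_annihilator:
  assumes "z \<in> \<mm>"
  shows "card (carrier R) \<le> card \<mm> * card (annihilator R z)"
proof -
  have fib: "card {a \<in> carrier R. a \<otimes> z = y} \<le> card (annihilator R z)" for y
  proof (cases "\<exists>a0\<in>carrier R. a0 \<otimes> z = y")
    case True
    then obtain a0 where a0: "a0 \<in> carrier R" "a0 \<otimes> z = y" by blast
    have "inj_on (\<lambda>a. a \<ominus> a0) {a \<in> carrier R. a \<otimes> z = y}"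
    proof (rule inj_onI)
      fix a b assume "a \<in> {a \<in> carrier R. a \<otimes> z = y}" "b \<in> {a \<in> carrier R. a \<otimes> z = y}"
        and "a \<ominus> a0 = b \<ominus> a0"
      then show "a = b"
        using a0(1) add.right_cancel[of "\<ominus> a0" a b] by (simp add: a_minus_def)
    qed
    moreover have "(\<lambda>a. a \<ominus> a0) ` {a \<in> carrier R. a \<otimes> z = y} \<subseteq> annihilator R z"
    proof clarify
      fix a assume a: "a \<in> carrier R" "y = a \<otimes> z"
      have "z \<otimes> (a \<ominus> a0) = a \<otimes> z \<ominus> a0 \<otimes> z"
        using a(1) a0(1) assms by (simp add: a_minus_def r_distr r_minus m_comm)
      then show "a \<ominus> a0 \<in> annihilator R z"
        using a a0 assms unfolding annihilator_def by simp
    qed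
    moreover have "finite (annihilator R z)"
      using finite_carrier unfolding annihilator_def by simp
    ultimately show ?thesis using card_inj_on_le by blast
  next
    case False
    then have "{a \<in> carrier R. a \<otimes> z = y} = {}" by blast
    then show ?thesis by (simp only: card.empty)
  qed
  have "carrier R \<subseteq> (\<Union>y\<in>\<mm>. {a \<in> carrier R. a \<otimes> z = y})"
    using nonunits_closed(5)[OF assms] by blast
  then have "card (carrier R) \<le> card (\<Union>y\<in>\<mm>. {a \<in> carrier R. a \<otimes> z = y})"
    using finite_nonunits finite_carrier by (intro card_mono finite_UN_I) auto
  also have "\<dots> \<le> (\<Sum>y\<in>\<mm>. card {a \<in> carrier R. a \<otimes> z = y})"
    by (rule card_UN_le[OF finite_nonunits])
  also have "\<dots> \<le> (\<Sum>y\<in>\<mm>. card (annihilator R z))"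
    using fib by (intro sum_mono)
  finally show ?thesis by simp
qed

lemma annihilator_subset_nonunits:
  assumes "z \<in> carrier R" "z \<noteq> \<zero>"
  shows "annihilator R z \<subseteq> \<mm>"
  using unit_cancel[OF assms(1)] assms(2) unfolding annihilator_def by blast

end

section \<open>Quotients of polynomial rings\<close>

text \<open>Horner's scheme as an induction principle.\<close>

lemma (in UP_cring) UP_induct [consumes 1, case_names const add mult_X]:
  assumes "f \<in> carrier P"
    and const: "\<And>a. a \<in> carrier R \<Longrightarrow> Q (monom P a 0)"
    and add: "\<And>f g. f \<in> carrier P \<Longrightarrow> g \<in> carrier P \<Longrightarrow> Q f \<Longrightarrow> Q g \<Longrightarrow> Q (f \<oplus>\<^bsub>P\<^esub> g)"
    and mult_X: "\<And>f. f \<in> carrier P \<Longrightarrow> Q f \<Longrightarrow> Q (f \<otimes>\<^bsub>P\<^esub> monom P \<one> 1)"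
  shows "Q f"
proof -
  have monom: "Q (monom P a n)" if "a \<in> carrier R" for a n
  proof (induction n)
    case 0
    then show ?case using const that by simp
  next
    case (Suc n)
    have "monom P a n \<otimes>\<^bsub>P\<^esub> monom P \<one> 1 = monom P a (Suc n)"
      using monom_mult[OF that R.one_closed, of n 1] that by simp
    then show ?case
      using mult_X[OF monom_closed[OF that] Suc] by simp
  qed
  have "Q (\<Oplus>\<^bsub>P\<^esub>i\<in>{..n}. monom P (coeff P f i) i)" for n
  proof (induction n)
    case 0
    then show ?case using assms(1) monom by simp
  next
    case (Suc n)
    have "(\<Oplus>\<^bsub>P\<^esub>i\<in>{..Suc n}. monom P (coeff P f i) i) =
      monom P (coeff P f (Suc n)) (Suc n) \<oplus>\<^bsub>P\<^esub> (\<Oplus>\<^bsub>P\<^esub>i\<in>{..n}. monom P (coeff P f i) i)"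
      using assms(1) by (intro P.finsum_Suc) auto
    then show ?case
      using Suc assms(1) monom by (auto intro!: add)
  qed
  then show ?thesis
    using up_repr[OF assms(1)] by metis
qed

text \<open>The quotient \<open>Q\<close> of a polynomial ring over \<open>R\<close> by the ideal generated by a set \<open>S\<close> of relations. The
abbreviations \<open>const a\<close> and \<open>X\<close> denote the classes of a constant and of the indeterminate.\<close>

locale polynomial_quotient = R?: cring R for R (structure) +
  fixes S
  assumes relations_closed: "S \<subseteq> carrier (UP R)"
begin

abbreviation "P \<equiv> UP R"
abbreviation "Q \<equiv> UP_quot R S"
abbreviation "proj \<equiv> (+>\<^bsub>P\<^esub>) (Idl\<^bsub>P\<^esub> S)"
abbreviation "const a \<equiv> proj (UP_const R a)"
abbreviation "X \<equiv> proj (UP_X R)"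

sublocale UP: UP_cring R P
  by unfold_locales simp

sublocale I: ideal "Idl\<^bsub>P\<^esub> S" P
  using UP.P.genideal_ideal[OF relations_closed] .

sublocale proj: ring_hom_cring P Q proj
  unfolding UP_quot_def by (rule I.rcos_ring_hom_cring[OF UP.P.is_cring])

lemma carrier_Q: "carrier Q = proj ` carrier P"
  unfolding UP_quot_def FactRing_def A_RCOSETS_defs by (auto simp: a_r_coset_def r_coset_def)

lemma proj_relation:
  assumes "s \<in> S" shows "proj s = \<zero>\<^bsub>Q\<^esub>"
proof -
  have "s \<in> Idl\<^bsub>P\<^esub> S"
    using UP.P.genideal_self[OF relations_closed] assms by blast
  then have "proj s = Idl\<^bsub>P\<^esub> S"
    using UP.P.a_coset_join2[OF I.Icarr] I.a_subgroup by metis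
  then show ?thesis
    unfolding UP_quot_def FactRing_def by simp
qed

lemma UP_X_closed [simp]: "UP_X R \<in> carrier P"
  unfolding UP_X_def by simp

lemma UP_const_closed [simp]: "a \<in> carrier R \<Longrightarrow> UP_const R a \<in> carrier P"
  unfolding UP_const_def by simp

lemma UP_const_hom: "ring_hom_cring R P (UP_const R)"
proof -
  have "UP_const R = (\<lambda>a. monom P a 0)" unfolding UP_const_def by auto
  then show ?thesis
    using UP.const_ring_hom UP.P.is_cring by (intro ring_hom_cringI is_cring) auto
qed

lemma const_hom: "ring_hom_cring R Q const"
proof -
  have "const \<in> ring_hom R Q"
    using ring_hom_trans[OF ring_hom_cring.homh[OF UP_const_hom] proj.homh] by (simp add: comp_def)
  then show ?thesis
    by (intro ring_hom_cringI is_cring proj.S.is_cring)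
qed

lemma X_closed [simp]: "X \<in> carrier Q"
  by simp

text \<open>For normal forms: a set that contains the constants and is closed under addition and under
multiplication by \<open>X\<close> exhausts the quotient.\<close>

lemma quotient_induct [consumes 1, case_names const add mult_X]:
  assumes "q \<in> carrier Q"
    and "\<And>a. a \<in> carrier R \<Longrightarrow> E (const a)"
    and "\<And>p q. p \<in> carrier Q \<Longrightarrow> q \<in> carrier Q \<Longrightarrow> E p \<Longrightarrow> E q \<Longrightarrow> E (p \<oplus>\<^bsub>Q\<^esub> q)"
    and "\<And>q. q \<in> carrier Q \<Longrightarrow> E q \<Longrightarrow> E (q \<otimes>\<^bsub>Q\<^esub> X)"
  shows "E q"
proof -
  obtain f where f: "f \<in> carrier P" "q = proj f"
    using assms(1) carrier_Q by auto
  have "E (proj f)"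
    using f(1)
  proof (induction rule: UP.UP_induct)
    case (const a)
    then show ?case using assms(2)[OF const] by (simp add: UP_const_def)
  next
    case (add f g)
    then show ?case using assms(3)[of "proj f" "proj g"] by simp
  next
    case (mult_X f)
    then show ?case using assms(4)[of "proj f"] by (simp add: UP_X_def)
  qed
  then show ?thesis using f by simp
qed

text \<open>The universal property of \<open>Q\<close>: a homomorphism that kills the relations kills the ideal that they
generate and hence is constant on its cosets.\<close>

lemma lift:
  assumes "ring_hom_cring P A \<phi>" and "\<And>s. s \<in> S \<Longrightarrow> \<phi> s = \<zero>\<^bsub>A\<^esub>"
  obtains \<psi> where "ring_hom_cring Q A \<psi>" "\<And>f. f \<in> carrier P \<Longrightarrow> \<psi> (proj f) = \<phi> f"
proof -
  interpret \<phi>: ring_hom_cring P A \<phi> by fact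
  have "S \<subseteq> a_kernel P A \<phi>"
    using assms(2) relations_closed unfolding a_kernel_def' by blast
  then have "Idl\<^bsub>P\<^esub> S \<subseteq> a_kernel P A \<phi>"
    by (rule UP.P.genideal_minimal[OF \<phi>.ring.kernel_is_ideal])
  then have zero: "\<phi> i = \<zero>\<^bsub>A\<^esub>" if "i \<in> Idl\<^bsub>P\<^esub> S" for i
    using that unfolding a_kernel_def' by blast
  define \<psi> where "\<psi> = (\<lambda>C. the_elem (\<phi> ` C))"
  have \<psi>: "\<psi> (proj f) = \<phi> f" if f: "f \<in> carrier P" for f
  proof -
    have "\<phi> g = \<phi> f" if "g \<in> proj f" for g
      using that f zero I.Icarr by (auto simp: a_r_coset_def')
    moreover have "f \<in> proj f"
      using I.a_rcos_self[OF f] .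
    ultimately have "\<phi> ` proj f = {\<phi> f}" by blast
    then show ?thesis unfolding \<psi>_def by simp
  qed
  have "\<psi> \<in> ring_hom Q A"
  proof (rule ring_hom_memI)
    show "\<psi> \<one>\<^bsub>Q\<^esub> = \<one>\<^bsub>A\<^esub>"
      using \<psi>[of "\<one>\<^bsub>P\<^esub>"] by simp
  next
    fix p assume "p \<in> carrier Q"
    then show "\<psi> p \<in> carrier A"
      using \<psi> carrier_Q by auto
  next
    fix p q assume "p \<in> carrier Q" "q \<in> carrier Q"
    then obtain f g where f: "f \<in> carrier P" "p = proj f" and g: "g \<in> carrier P" "q = proj g"
      using carrier_Q by auto
    show "\<psi> (p \<otimes>\<^bsub>Q\<^esub> q) = \<psi> p \<otimes>\<^bsub>A\<^esub> \<psi> q"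
      using \<psi>[of "f \<otimes>\<^bsub>P\<^esub> g"] \<psi>[of f] \<psi>[of g] f g by simp
    show "\<psi> (p \<oplus>\<^bsub>Q\<^esub> q) = \<psi> p \<oplus>\<^bsub>A\<^esub> \<psi> q"
      using \<psi>[of "f \<oplus>\<^bsub>P\<^esub> g"] \<psi>[of f] \<psi>[of g] f g by simp
  qed
  then have "ring_hom_cring Q A \<psi>"
    by (intro ring_hom_cringI proj.S.is_cring \<phi>.S.is_cring)
  then show ?thesis using that \<psi> by blast
qed

lemma eval_hom:
  assumes "ring_hom_cring R A h" "x \<in> carrier A"
  shows "ring_hom_cring P A (eval R A h x)"
    and "eval R A h x (UP_X R) = x"
    and "a \<in> carrier R \<Longrightarrow> eval R A h x (UP_const R a) = h a"
proof -
  interpret h: ring_hom_cring R A h by fact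
  interpret UP_pre_univ_prop R A h P by unfold_locales simp
  show "ring_hom_cring P A (eval R A h x)"
    by (intro ring_hom_cringI UP.P.is_cring h.S.is_cring eval_ring_hom assms)
  show "eval R A h x (UP_X R) = x" "a \<in> carrier R \<Longrightarrow> eval R A h x (UP_const R a) = h a"
    unfolding UP_X_def UP_const_def using eval_monom1[OF assms(2)] eval_const[OF assms(2)]
    by blast+
qed

text \<open>The homomorphism from \<open>Q\<close> to \<open>A\<close> given by the universal property is onto because its image is
closed under the operations and contains generators; comparing cardinalities makes it injective. The
comparison takes the place of a computation of the kernel of the evaluation map.\<close>

lemma ring_iso_if_generated:
  assumes hom: "ring_hom_cring R A h" and x: "x \<in> carrier A"
    and rel: "\<And>s. s \<in> S \<Longrightarrow> eval R A h x s = \<zero>\<^bsub>A\<^esub>"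
    and gen: "\<And>B. h ` carrier R \<subseteq> B \<Longrightarrow> x \<in> B \<Longrightarrow>
        (\<And>u v. u \<in> B \<Longrightarrow> v \<in> B \<Longrightarrow> u \<oplus>\<^bsub>A\<^esub> v \<in> B \<and> u \<otimes>\<^bsub>A\<^esub> v \<in> B) \<Longrightarrow> carrier A \<subseteq> B"
    and fin: "finite (carrier A)" "finite (carrier Q)" and card: "card (carrier Q) \<le> card (carrier A)"
  shows "A \<simeq> Q"
proof -
  note ev = eval_hom[OF hom x]
  obtain \<psi> where \<psi>: "ring_hom_cring Q A \<psi>"
    "\<And>f. f \<in> carrier P \<Longrightarrow> \<psi> (proj f) = eval R A h x f"
    using lift[OF ev(1) rel] by blast
  interpret \<psi>: ring_hom_cring Q A \<psi> by fact
  have "carrier A \<subseteq> \<psi> ` carrier Q"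
  proof (rule gen)
    show "h ` carrier R \<subseteq> \<psi> ` carrier Q"
    proof clarify
      fix a assume a: "a \<in> carrier R"
      then have "\<psi> (const a) = h a"
        using \<psi>(2) ev(3) by simp
      then show "h a \<in> \<psi> ` carrier Q"
        using a by (metis UP_const_closed image_eqI proj.hom_closed)
    qed
    have "\<psi> X = x" using \<psi>(2) ev(2) by simp
    then show "x \<in> \<psi> ` carrier Q"
      using X_closed by blast
  next
    fix u v assume "u \<in> \<psi> ` carrier Q" "v \<in> \<psi> ` carrier Q"
    then obtain p q where "p \<in> carrier Q" "q \<in> carrier Q" "u = \<psi> p" "v = \<psi> q"
      by blast
    then show "u \<oplus>\<^bsub>A\<^esub> v \<in> \<psi> ` carrier Q \<and> u \<otimes>\<^bsub>A\<^esub> v \<in> \<psi> ` carrier Q"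
      using imageI[of "p \<oplus>\<^bsub>Q\<^esub> q" "carrier Q" \<psi>] imageI[of "p \<otimes>\<^bsub>Q\<^esub> q" "carrier Q" \<psi>] by simp
  qed
  then have surj: "\<psi> ` carrier Q = carrier A" by auto
  then have "inj_on \<psi> (carrier Q)"
    using card card_image_le[OF fin(2), of \<psi>] fin by (intro eq_card_imp_inj_on) simp_all
  then have "\<psi> \<in> ring_iso Q A"
    using surj by (simp add: ring_iso_def bij_betw_def)
  then show ?thesis
    using ring_iso_set_sym[OF _ \<open>\<psi> \<in> ring_iso Q A\<close>] proj.S.ring_axioms is_ring_iso_def by blast
qed

text \<open>A relation that expresses the square of \<open>X\<close> through lower powers reduces every class to a linear
one.\<close>

lemma quadratic_normal_form:
  assumes c: "c \<in> carrier R" "d \<in> carrier R"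
    and sq: "X \<otimes>\<^bsub>Q\<^esub> X = const c \<oplus>\<^bsub>Q\<^esub> const d \<otimes>\<^bsub>Q\<^esub> X"
    and q: "q \<in> carrier Q"
  obtains a b where "a \<in> carrier R" "b \<in> carrier R" "q = const a \<oplus>\<^bsub>Q\<^esub> const b \<otimes>\<^bsub>Q\<^esub> X"
proof -
  interpret const: ring_hom_cring R Q const by (rule const_hom)
  have "\<exists>a\<in>carrier R. \<exists>b\<in>carrier R. q = const a \<oplus>\<^bsub>Q\<^esub> const b \<otimes>\<^bsub>Q\<^esub> X"
    using q
  proof (induction rule: quotient_induct)
    case (const a)
    then show ?case
      by (intro bexI[of _ a] bexI[of _ \<zero>]) simp_all
  next
    case (add p q)
    then obtain a b a' b' where *: "a \<in> carrier R" "b \<in> carrier R" "a' \<in> carrier R" "b' \<in> carrier R"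
      "p = const a \<oplus>\<^bsub>Q\<^esub> const b \<otimes>\<^bsub>Q\<^esub> X" "q = const a' \<oplus>\<^bsub>Q\<^esub> const b' \<otimes>\<^bsub>Q\<^esub> X"
      by blast
    then have "p \<oplus>\<^bsub>Q\<^esub> q = const (a \<oplus> a') \<oplus>\<^bsub>Q\<^esub> const (b \<oplus> b') \<otimes>\<^bsub>Q\<^esub> X"
      by (simp add: proj.S.l_distr proj.S.a_ac)
    moreover have "a \<oplus> a' \<in> carrier R" "b \<oplus> b' \<in> carrier R"
      using * by simp_all
    ultimately show ?case by blast
  next
    case (mult_X q)
    then obtain a b where *: "a \<in> carrier R" "b \<in> carrier R"
      "q = const a \<oplus>\<^bsub>Q\<^esub> const b \<otimes>\<^bsub>Q\<^esub> X"
      by blast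
    then have "q \<otimes>\<^bsub>Q\<^esub> X = const a \<otimes>\<^bsub>Q\<^esub> X \<oplus>\<^bsub>Q\<^esub> const b \<otimes>\<^bsub>Q\<^esub> (X \<otimes>\<^bsub>Q\<^esub> X)"
      by (simp add: proj.S.l_distr proj.S.m_assoc)
    also have "\<dots> = const (b \<otimes> c) \<oplus>\<^bsub>Q\<^esub> const (a \<oplus> b \<otimes> d) \<otimes>\<^bsub>Q\<^esub> X"
    proof -
      have "const b \<otimes>\<^bsub>Q\<^esub> (X \<otimes>\<^bsub>Q\<^esub> X) = const (b \<otimes> c) \<oplus>\<^bsub>Q\<^esub> const (b \<otimes> d) \<otimes>\<^bsub>Q\<^esub> X"
        unfolding sq using * c by (simp add: proj.S.r_distr proj.S.m_assoc)
      then show ?thesis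
        using * c by (simp add: proj.S.l_distr proj.S.a_ac)
    qed
    finally have "q \<otimes>\<^bsub>Q\<^esub> X = const (b \<otimes> c) \<oplus>\<^bsub>Q\<^esub> const (a \<oplus> b \<otimes> d) \<otimes>\<^bsub>Q\<^esub> X" .
    moreover have "b \<otimes> c \<in> carrier R" "a \<oplus> b \<otimes> d \<in> carrier R"
      using * c by simp_all
    ultimately show ?case by blast
  qed
  then show ?thesis using that by blast
qed

lemma card_quadratic_quotient:
  assumes "finite (carrier R)" "c \<in> carrier R" "d \<in> carrier R"
    and "X \<otimes>\<^bsub>Q\<^esub> X = const c \<oplus>\<^bsub>Q\<^esub> const d \<otimes>\<^bsub>Q\<^esub> X"
  shows "finite (carrier Q)" "card (carrier Q) \<le> card (carrier R) * card (carrier R)"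
proof -
  let ?f = "\<lambda>(a, b). const a \<oplus>\<^bsub>Q\<^esub> const b \<otimes>\<^bsub>Q\<^esub> X"
  have sub: "carrier Q \<subseteq> ?f ` (carrier R \<times> carrier R)"
  proof
    fix q assume "q \<in> carrier Q"
    then obtain a b where "a \<in> carrier R" "b \<in> carrier R" "q = const a \<oplus>\<^bsub>Q\<^esub> const b \<otimes>\<^bsub>Q\<^esub> X"
      using quadratic_normal_form[OF assms(2-4)] by blast
    then show "q \<in> ?f ` (carrier R \<times> carrier R)" by force
  qed
  have fin: "finite (carrier R \<times> carrier R)" using assms(1) by simp
  show "finite (carrier Q)"
    using sub fin finite_surj by blast
  show "card (carrier Q) \<le> card (carrier R) * card (carrier R)"
    using surj_card_le[OF fin sub] by (simp add: card_cartesian_product)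
qed

end

lemma (in monoid) nat_pow_2: "x \<in> carrier G \<Longrightarrow> x [^] (2::nat) = x \<otimes> x"
  by (simp add: numeral_2_eq_2)

lemma (in monoid) nat_pow_3: "x \<in> carrier G \<Longrightarrow> x [^] (3::nat) = x \<otimes> x \<otimes> x"
  by (simp add: numeral_3_eq_3)

lemma residue_ring_cring: "1 < n \<Longrightarrow> cring (residue_ring n)"
  using residues.cring[of n] by (simp add: residues_def)

lemma carrier_residue_ring: "carrier (residue_ring n) = {0..n - 1}"
  by (simp add: residue_ring_def)

lemma residue_ring_simps:
  "a \<oplus>\<^bsub>residue_ring n\<^esub> b = (a + b) mod n" "a \<otimes>\<^bsub>residue_ring n\<^esub> b = (a * b) mod n"
  "\<one>\<^bsub>residue_ring n\<^esub> = 1" "\<zero>\<^bsub>residue_ring n\<^esub> = 0"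
  by (simp_all add: residue_ring_def)

lemma (in cring) residue_ring_hom:
  assumes n: "1 < n" and char: "[n] \<cdot> \<one> = \<zero>"
  shows "ring_hom_cring (residue_ring n) R (\<lambda>k::int. [k] \<cdot> \<one>)"
proof (intro ring_hom_cringI residue_ring_cring is_cring ring_hom_memI)
  have mod: "[(k mod n)] \<cdot> \<one> = [k] \<cdot> \<one>" for k
  proof -
    have "[(n * (k div n))] \<cdot> \<one> = [(k div n)] \<cdot> ([n] \<cdot> \<one>)"
      by (simp add: add.int_pow_pow mult.commute)
    then have "[(n * (k div n))] \<cdot> \<one> = \<zero>"
      by (simp add: char)
    then have "[(n * (k div n) + k mod n)] \<cdot> \<one> = [(k mod n)] \<cdot> \<one>"
      by (subst add.int_pow_mult) simp_all
    then show ?thesis by simp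
  qed
  show "[(x \<oplus>\<^bsub>residue_ring n\<^esub> y)] \<cdot> \<one> = [x] \<cdot> \<one> \<oplus> [y] \<cdot> \<one>" for x y
    by (simp add: residue_ring_simps mod add.int_pow_mult)
  show "[(x \<otimes>\<^bsub>residue_ring n\<^esub> y)] \<cdot> \<one> = [x] \<cdot> \<one> \<otimes> [y] \<cdot> \<one>" for x y
  proof -
    have "[x] \<cdot> \<one> \<otimes> [y] \<cdot> \<one> = [x] \<cdot> ([y] \<cdot> \<one>)"
      by (simp add: add_pow_ldistr_int)
    then show ?thesis
      by (simp add: residue_ring_simps mod add.int_pow_pow mult.commute)
  qed
qed (use n in \<open>simp_all add: residue_ring_simps\<close>)

text \<open>The multiples of 1 exhaust \<open>R\<close> by the generation hypothesis, and there are \<open>n\<close> of them at most.\<close>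

lemma (in cring) iso_residue_ring_if_generated:
  assumes "1 < n" "[n] \<cdot> \<one> = \<zero>" "finite (carrier R)" "card (carrier R) = nat n"
    and gen: "\<And>B. \<zero> \<in> B \<Longrightarrow> \<one> \<in> B \<Longrightarrow> (\<And>u v. u \<in> B \<Longrightarrow> v \<in> B \<Longrightarrow> u \<oplus> v \<in> B) \<Longrightarrow> carrier R \<subseteq> B"
  shows "R \<simeq> residue_ring n"
proof -
  let ?h = "\<lambda>k::int. [k] \<cdot> \<one>"
  interpret h: ring_hom_cring "residue_ring n" R ?h
    by (rule residue_ring_hom[OF assms(1,2)])
  have "carrier R \<subseteq> ?h ` carrier (residue_ring n)"
  proof (rule gen)
    show "\<zero> \<in> ?h ` carrier (residue_ring n)" "\<one> \<in> ?h ` carrier (residue_ring n)"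
      by (metis h.hom_zero image_eqI h.R.zero_closed, metis h.hom_one image_eqI h.R.one_closed)
    fix u v assume "u \<in> ?h ` carrier (residue_ring n)" "v \<in> ?h ` carrier (residue_ring n)"
    then obtain i j where "i \<in> carrier (residue_ring n)" "j \<in> carrier (residue_ring n)"
      "u = ?h i" "v = ?h j" by blast
    then show "u \<oplus> v \<in> ?h ` carrier (residue_ring n)"
      using h.hom_add[of i j] h.R.a_closed[of i j] by (metis image_eqI)
  qed
  then have surj: "?h ` carrier (residue_ring n) = carrier R" by auto
  have "inj_on ?h (carrier (residue_ring n))"
    using surj assms(4) by (intro eq_card_imp_inj_on) (simp_all add: carrier_residue_ring)
  then have "?h \<in> ring_iso (residue_ring n) R"
    using surj h.homh by (simp add: ring_iso_def bij_betw_def)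
  then show ?thesis
    using ring_iso_set_sym[OF h.R.ring_axioms] is_ring_iso_def by blast
qed

context polynomial_quotient
begin

text \<open>If multiples of \<open>X\<close> by constants are \<open>0\<close> or \<open>X\<close>, the coefficient of \<open>X\<close> in the normal form takes
only two values.\<close>

lemma card_quadratic_killed:
  assumes "finite (carrier R)" "c \<in> carrier R" "d \<in> carrier R"
    and sq: "X \<otimes>\<^bsub>Q\<^esub> X = const c \<oplus>\<^bsub>Q\<^esub> const d \<otimes>\<^bsub>Q\<^esub> X"
    and kill: "\<And>b. b \<in> carrier R \<Longrightarrow> const b \<otimes>\<^bsub>Q\<^esub> X \<in> {\<zero>\<^bsub>Q\<^esub>, X}"
  shows "finite (carrier Q)" "card (carrier Q) \<le> card (carrier R) * 2"
proof -
  let ?f = "\<lambda>(a, t). const a \<oplus>\<^bsub>Q\<^esub> t" and ?D = "carrier R \<times> {\<zero>\<^bsub>Q\<^esub>, X}"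
  have sub: "carrier Q \<subseteq> ?f ` ?D"
  proof
    fix q assume "q \<in> carrier Q"
    then obtain a b where "a \<in> carrier R" "b \<in> carrier R" "q = const a \<oplus>\<^bsub>Q\<^esub> const b \<otimes>\<^bsub>Q\<^esub> X"
      using quadratic_normal_form[OF assms(2,3) sq] by blast
    then show "q \<in> ?f ` ?D"
      using kill[of b] by (intro image_eqI[of _ _ "(a, const b \<otimes>\<^bsub>Q\<^esub> X)"]) auto
  qed
  have fin: "finite ?D" using assms(1) by simp
  show "finite (carrier Q)"
    using sub fin finite_surj by blast
  have "card ?D \<le> card (carrier R) * 2"
    unfolding card_cartesian_product by (intro mult_le_mono2) (simp add: card_insert_if)
  then show "card (carrier Q) \<le> card (carrier R) * 2"
    using surj_card_le[OF fin sub] by linarith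
qed

end

text \<open>The span of \<open>1, x, y\<close> over the image of \<open>R\<close>. The hypotheses cover two situations at once: \<open>y = x\<^sup>2\<close>
with \<open>x\<^sup>3 = 0\<close>, and two elements \<open>x, y\<close> with all products zero.\<close>

lemma (in ring_hom_cring) three_term_closed:
  assumes "x \<in> carrier S" "y \<in> carrier S"
    and xx: "x \<otimes>\<^bsub>S\<^esub> x \<in> {\<zero>\<^bsub>S\<^esub>, y}" and xy: "x \<otimes>\<^bsub>S\<^esub> y = \<zero>\<^bsub>S\<^esub>"
  defines "E \<equiv> {h a \<oplus>\<^bsub>S\<^esub> h b \<otimes>\<^bsub>S\<^esub> x \<oplus>\<^bsub>S\<^esub> h c \<otimes>\<^bsub>S\<^esub> y | a b c. a \<in> carrier R \<and> b \<in> carrier R \<and> c \<in> carrier R}"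
  shows "a \<in> carrier R \<Longrightarrow> h a \<in> E"
    and "u \<in> E \<Longrightarrow> v \<in> E \<Longrightarrow> u \<oplus>\<^bsub>S\<^esub> v \<in> E"
    and "u \<in> E \<Longrightarrow> u \<otimes>\<^bsub>S\<^esub> x \<in> E"
    and "y \<otimes>\<^bsub>S\<^esub> y = \<zero>\<^bsub>S\<^esub> \<Longrightarrow> u \<in> E \<Longrightarrow> u \<otimes>\<^bsub>S\<^esub> y \<in> E"
proof -
  have E: "h a \<oplus>\<^bsub>S\<^esub> h b \<otimes>\<^bsub>S\<^esub> x \<oplus>\<^bsub>S\<^esub> h c \<otimes>\<^bsub>S\<^esub> y \<in> E"
    if "a \<in> carrier R" "b \<in> carrier R" "c \<in> carrier R" for a b c
    using that unfolding E_def by blast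
  have yx: "y \<otimes>\<^bsub>S\<^esub> x = \<zero>\<^bsub>S\<^esub>"
    using xy assms(1,2) S.m_comm by simp
  show "h a \<in> E" if "a \<in> carrier R"
    using E[OF that R.zero_closed R.zero_closed] that assms(1,2) by simp
  show "u \<oplus>\<^bsub>S\<^esub> v \<in> E" if uv: "u \<in> E" "v \<in> E"
  proof -
    obtain a b c where 1: "a \<in> carrier R" "b \<in> carrier R" "c \<in> carrier R"
      "u = h a \<oplus>\<^bsub>S\<^esub> h b \<otimes>\<^bsub>S\<^esub> x \<oplus>\<^bsub>S\<^esub> h c \<otimes>\<^bsub>S\<^esub> y"
      using uv(1) unfolding E_def by blast
    obtain a' b' c' where 2: "a' \<in> carrier R" "b' \<in> carrier R" "c' \<in> carrier R"
      "v = h a' \<oplus>\<^bsub>S\<^esub> h b' \<otimes>\<^bsub>S\<^esub> x \<oplus>\<^bsub>S\<^esub> h c' \<otimes>\<^bsub>S\<^esub> y"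
      using uv(2) unfolding E_def by blast
    have "u \<oplus>\<^bsub>S\<^esub> v = h (a \<oplus> a') \<oplus>\<^bsub>S\<^esub> h (b \<oplus> b') \<otimes>\<^bsub>S\<^esub> x \<oplus>\<^bsub>S\<^esub> h (c \<oplus> c') \<otimes>\<^bsub>S\<^esub> y"
      using 1 2 assms(1,2) by (simp add: S.l_distr S.a_ac)
    then show ?thesis
      using E[of "a \<oplus> a'" "b \<oplus> b'" "c \<oplus> c'"] 1(1-3) 2(1-3) by (simp only: R.a_closed)
  qed
  show "u \<otimes>\<^bsub>S\<^esub> x \<in> E" if u: "u \<in> E"
  proof -
    obtain a b c where 1: "a \<in> carrier R" "b \<in> carrier R" "c \<in> carrier R"
      "u = h a \<oplus>\<^bsub>S\<^esub> h b \<otimes>\<^bsub>S\<^esub> x \<oplus>\<^bsub>S\<^esub> h c \<otimes>\<^bsub>S\<^esub> y"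
      using u unfolding E_def by blast
    have ux: "u \<otimes>\<^bsub>S\<^esub> x = h a \<otimes>\<^bsub>S\<^esub> x \<oplus>\<^bsub>S\<^esub> h b \<otimes>\<^bsub>S\<^esub> (x \<otimes>\<^bsub>S\<^esub> x)"
      using 1 assms(1,2) by (simp add: S.l_distr S.m_assoc yx)
    from xx consider "x \<otimes>\<^bsub>S\<^esub> x = \<zero>\<^bsub>S\<^esub>" | "x \<otimes>\<^bsub>S\<^esub> x = y" by blast
    then show ?thesis
    proof cases
      case 1
      then show ?thesis
        using E[of "\<zero>" a "\<zero>"] \<open>a \<in> carrier R\<close> \<open>b \<in> carrier R\<close> assms(1,2) unfolding ux by simp
    next
      case 2
      then show ?thesis
        using E[of "\<zero>" a b] \<open>a \<in> carrier R\<close> \<open>b \<in> carrier R\<close> assms(1,2) unfolding ux by simp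
    qed
  qed
  show "u \<otimes>\<^bsub>S\<^esub> y \<in> E" if yy: "y \<otimes>\<^bsub>S\<^esub> y = \<zero>\<^bsub>S\<^esub>" and u: "u \<in> E"
  proof -
    obtain a b c where 1: "a \<in> carrier R" "b \<in> carrier R" "c \<in> carrier R"
      "u = h a \<oplus>\<^bsub>S\<^esub> h b \<otimes>\<^bsub>S\<^esub> x \<oplus>\<^bsub>S\<^esub> h c \<otimes>\<^bsub>S\<^esub> y"
      using u unfolding E_def by blast
    have "u \<otimes>\<^bsub>S\<^esub> y = h a \<otimes>\<^bsub>S\<^esub> y"
      using 1 assms(1,2) by (simp add: S.l_distr S.m_assoc yy xy)
    then show ?thesis
      using E[of "\<zero>" "\<zero>" a] 1 assms(1,2) by simp
  qed
qed

lemma (in ring_hom_cring) card_three_term: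
  fixes x y
  assumes "finite (carrier R)"
  defines "E \<equiv> {h a \<oplus>\<^bsub>S\<^esub> h b \<otimes>\<^bsub>S\<^esub> x \<oplus>\<^bsub>S\<^esub> h c \<otimes>\<^bsub>S\<^esub> y | a b c. a \<in> carrier R \<and> b \<in> carrier R \<and> c \<in> carrier R}"
  shows "finite E" "card E \<le> card (carrier R) ^ 3"
proof -
  let ?D = "carrier R \<times> carrier R \<times> carrier R"
    and ?f = "\<lambda>(a, b, c). h a \<oplus>\<^bsub>S\<^esub> h b \<otimes>\<^bsub>S\<^esub> x \<oplus>\<^bsub>S\<^esub> h c \<otimes>\<^bsub>S\<^esub> y"
  have "E \<subseteq> ?f ` ?D"
    unfolding E_def by force
  moreover have "finite ?D" using assms(1) by simp
  ultimately show "finite E" "card E \<le> card (carrier R) ^ 3"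
    using finite_surj surj_card_le[of ?D E ?f]
    by (blast, simp add: card_cartesian_product power3_eq_cube)
qed

context polynomial_quotient
begin

lemma card_cubic_quotient:
  assumes fin: "finite (carrier R)" and cube: "X \<otimes>\<^bsub>Q\<^esub> X \<otimes>\<^bsub>Q\<^esub> X = \<zero>\<^bsub>Q\<^esub>"
  shows "finite (carrier Q)" "card (carrier Q) \<le> card (carrier R) ^ 3"
proof -
  interpret const: ring_hom_cring R Q const by (rule const_hom)
  let ?E = "{const a \<oplus>\<^bsub>Q\<^esub> const b \<otimes>\<^bsub>Q\<^esub> X \<oplus>\<^bsub>Q\<^esub> const c \<otimes>\<^bsub>Q\<^esub> (X \<otimes>\<^bsub>Q\<^esub> X) |
    a b c. a \<in> carrier R \<and> b \<in> carrier R \<and> c \<in> carrier R}"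
  have prem: "X \<otimes>\<^bsub>Q\<^esub> X \<in> carrier Q" "X \<otimes>\<^bsub>Q\<^esub> X \<in> {\<zero>\<^bsub>Q\<^esub>, X \<otimes>\<^bsub>Q\<^esub> X}"
    "X \<otimes>\<^bsub>Q\<^esub> (X \<otimes>\<^bsub>Q\<^esub> X) = \<zero>\<^bsub>Q\<^esub>"
    using cube proj.S.m_assoc[OF X_closed X_closed X_closed] by simp_all
  note closed = const.three_term_closed[OF X_closed prem]
  have "q \<in> ?E" if "q \<in> carrier Q" for q
    using that by (induction rule: quotient_induct) (rule closed(1-3); assumption)+
  then have sub: "carrier Q \<subseteq> ?E" by blast
  note card = const.card_three_term[OF fin, of X "X \<otimes>\<^bsub>Q\<^esub> X"]
  show "finite (carrier Q)"
    using sub card(1) finite_subset by blast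
  show "card (carrier Q) \<le> card (carrier R) ^ 3"
    using card_mono[OF card(1) sub] card(2) by linarith
qed

end

section \<open>Presentations of the rings in the list\<close>

lemma (in ring) add_pow_small:
  assumes "x \<in> carrier R"
  shows "[(1::int)] \<cdot> x = x" "[(2::int)] \<cdot> x = x \<oplus> x" "[(3::int)] \<cdot> x = x \<oplus> x \<oplus> x"
proof -
  show 1: "[(1::int)] \<cdot> x = x" using assms by simp
  have "[(1 + 1::int)] \<cdot> x = x \<oplus> x"
    using assms 1 by (subst add.int_pow_mult) simp_all
  then show 2: "[(2::int)] \<cdot> x = x \<oplus> x" by simp
  have "[(2 + 1::int)] \<cdot> x = x \<oplus> x \<oplus> x"
    using assms 1 2 by (subst add.int_pow_mult) simp_all
  then show "[(3::int)] \<cdot> x = x \<oplus> x \<oplus> x" by simp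
qed

lemma (in cring) add_pow_mult_one:
  "[(m * n :: int)] \<cdot> \<one> = [m] \<cdot> \<one> \<otimes> [n] \<cdot> \<one>"
proof -
  have "[m] \<cdot> \<one> \<otimes> [n] \<cdot> \<one> = [m] \<cdot> ([n] \<cdot> \<one>)"
    by (simp add: add_pow_ldistr_int)
  then show ?thesis
    by (simp add: add.int_pow_pow mult.commute)
qed

lemma (in cring) add_pow_4_one: "[(4::int)] \<cdot> \<one> = (\<one> \<oplus> \<one>) \<otimes> (\<one> \<oplus> \<one>)"
  using add_pow_mult_one[of 2 2] add_pow_small(2)[OF one_closed] by simp

text \<open>In a finite ring closure under addition entails closure under negation, so for \<open>1 \<in> G\<close> the set \<open>B\<close>
stands for an arbitrary subring that contains \<open>G\<close>.\<close>

definition ring_generated_by :: "('a, 'm) ring_scheme \<Rightarrow> 'a set \<Rightarrow> bool" where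
  "ring_generated_by A G \<longleftrightarrow>
     (\<forall>B. G \<subseteq> B \<longrightarrow> (\<forall>u\<in>B. \<forall>v\<in>B. u \<oplus>\<^bsub>A\<^esub> v \<in> B \<and> u \<otimes>\<^bsub>A\<^esub> v \<in> B) \<longrightarrow> carrier A \<subseteq> B)"

text \<open>The evaluation map enters only through its being a homomorphism with prescribed values on the
constants and the indeterminate, so that the relations can be checked by simplification.\<close>

lemma (in polynomial_quotient) ring_isoI:
  assumes hom: "ring_hom_cring R A h" and x: "x \<in> carrier A"
    and rel: "\<And>\<phi>. ring_hom_cring P A \<phi> \<Longrightarrow> \<phi> (UP_X R) = x \<Longrightarrow>
      (\<And>a. a \<in> carrier R \<Longrightarrow> \<phi> (UP_const R a) = h a) \<Longrightarrow> \<forall>s\<in>S. \<phi> s = \<zero>\<^bsub>A\<^esub>"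
    and gen: "ring_generated_by A (h ` carrier R \<union> {x})"
    and fin: "finite (carrier A)" "finite (carrier Q)" and card: "card (carrier Q) \<le> card (carrier A)"
  shows "A \<simeq> Q"
proof -
  note ev = eval_hom[OF hom x]
  have "\<forall>s\<in>S. eval R A h x s = \<zero>\<^bsub>A\<^esub>"
  proof (rule rel)
    show "ring_hom_cring P A (eval R A h x)" by (fact ev(1))
    show "eval R A h x (UP_X R) = x" by (fact ev(2))
    show "eval R A h x (UP_const R a) = h a" if "a \<in> carrier R" for a
      using that by (fact ev(3))
  qed
  then have rel': "eval R A h x s = \<zero>\<^bsub>A\<^esub>" if "s \<in> S" for s
    using that by (rule bspec)
  have gen': "carrier A \<subseteq> B" if "h ` carrier R \<subseteq> B" "x \<in> B"
    "\<And>u v. u \<in> B \<Longrightarrow> v \<in> B \<Longrightarrow> u \<oplus>\<^bsub>A\<^esub> v \<in> B \<and> u \<otimes>\<^bsub>A\<^esub> v \<in> B" for B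
  proof -
    have "h ` carrier R \<union> {x} \<subseteq> B" using that(1,2) by blast
    then show ?thesis
      using gen that(3) unfolding ring_generated_by_def by blast
  qed
  show ?thesis
    by (rule ring_iso_if_generated[OF hom x rel' gen' fin card])
qed

lemma ring_generated_by_mono:
  assumes "ring_generated_by A G" "G \<subseteq> H"
  shows "ring_generated_by A H"
  unfolding ring_generated_by_def
proof (intro allI impI)
  fix B assume "H \<subseteq> B" "\<forall>u\<in>B. \<forall>v\<in>B. u \<oplus>\<^bsub>A\<^esub> v \<in> B \<and> u \<otimes>\<^bsub>A\<^esub> v \<in> B"
  then show "carrier A \<subseteq> B"
    using assms subset_trans[of G H B] unfolding ring_generated_by_def by simp
qed

lemma (in cring) iso_residue_quotient:
  assumes n: "1 < n" "[n] \<cdot> \<one> = \<zero>" and x: "x \<in> carrier R"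
    and S: "S \<subseteq> carrier (UP (residue_ring n))"
    and rel: "\<And>\<phi>. ring_hom_cring (UP (residue_ring n)) R \<phi> \<Longrightarrow> \<phi> (UP_X (residue_ring n)) = x \<Longrightarrow>
      (\<And>a. a \<in> carrier (residue_ring n) \<Longrightarrow> \<phi> (UP_const (residue_ring n) a) = [a] \<cdot> \<one>) \<Longrightarrow>
      \<forall>s\<in>S. \<phi> s = \<zero>"
    and gen: "ring_generated_by R {\<zero>, \<one>, x}"
    and fin: "finite (carrier R)" "finite (carrier (UP_quot (residue_ring n) S))"
    and card: "card (carrier (UP_quot (residue_ring n) S)) \<le> card (carrier R)"
  shows "R \<simeq> UP_quot (residue_ring n) S"
proof -
  interpret Z: cring "residue_ring n" using n(1) by (rule residue_ring_cring)
  interpret polynomial_quotient "residue_ring n" S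
    by unfold_locales (rule S)
  have hom: "ring_hom_cring (residue_ring n) R (\<lambda>k. [k] \<cdot> \<one>)"
    using n by (rule residue_ring_hom)
  interpret h: ring_hom_cring "residue_ring n" R "\<lambda>k. [k] \<cdot> \<one>" by (rule hom)
  have "\<zero> \<in> (\<lambda>k::int. [k] \<cdot> \<one>) ` carrier (residue_ring n)"
    "\<one> \<in> (\<lambda>k::int. [k] \<cdot> \<one>) ` carrier (residue_ring n)"
    using h.hom_zero h.hom_one Z.zero_closed Z.one_closed by (metis image_eqI)+
  then have "{\<zero>, \<one>, x} \<subseteq> (\<lambda>k::int. [k] \<cdot> \<one>) ` carrier (residue_ring n) \<union> {x}"
    by blast
  from ring_isoI[OF hom x rel ring_generated_by_mono[OF gen this] fin card]
  show ?thesis by blast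
qed

lemma residue_polynomial_quotient:
  assumes "1 < n" "S \<subseteq> carrier (UP (residue_ring n))"
  shows "polynomial_quotient (residue_ring n) S"
  using assms residue_ring_cring[of n]
  by (simp add: polynomial_quotient_def polynomial_quotient_axioms_def)

lemma (in cring) UP_closed_simps:
  "monoid (UP R)" "ring (UP R)" "UP_X R \<in> carrier (UP R)"
  "a \<in> carrier R \<Longrightarrow> UP_const R a \<in> carrier (UP R)"
proof -
  interpret UP: UP_cring R "UP R" by unfold_locales simp
  show "monoid (UP R)" "ring (UP R)" "UP_X R \<in> carrier (UP R)"
    "a \<in> carrier R \<Longrightarrow> UP_const R a \<in> carrier (UP R)"
    unfolding UP_X_def UP_const_def using UP.P.monoid_axioms UP.P.ring_axioms by simp_all
qed

context polynomial_quotient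
begin

lemma square_zero_relation:
  assumes "UP_X R [^]\<^bsub>P\<^esub> (2::nat) \<in> S"
  shows "X \<otimes>\<^bsub>Q\<^esub> X = const \<zero> \<oplus>\<^bsub>Q\<^esub> const \<zero> \<otimes>\<^bsub>Q\<^esub> X"
proof -
  interpret const: ring_hom_cring R Q const by (rule const_hom)
  show ?thesis
    using proj_relation[OF assms] by (simp add: proj.S.nat_pow_2)
qed

lemma card_dual_numbers:
  assumes "finite (carrier R)" "UP_X R [^]\<^bsub>P\<^esub> (2::nat) \<in> S"
  shows "finite (carrier Q)" "card (carrier Q) \<le> card (carrier R) * card (carrier R)"
  using card_quadratic_quotient[OF assms(1) R.zero_closed R.zero_closed square_zero_relation[OF assms(2)]]
  by blast+

lemma omega_relation:
  assumes "UP_X R [^]\<^bsub>P\<^esub> (2::nat) \<oplus>\<^bsub>P\<^esub> UP_X R \<oplus>\<^bsub>P\<^esub> \<one>\<^bsub>P\<^esub> \<in> S"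
  shows "X \<otimes>\<^bsub>Q\<^esub> X \<oplus>\<^bsub>Q\<^esub> X \<oplus>\<^bsub>Q\<^esub> \<one>\<^bsub>Q\<^esub> = \<zero>\<^bsub>Q\<^esub>"
  using proj_relation[OF assms] by (simp add: proj.S.nat_pow_2)

lemma card_omega_quotient:
  assumes "finite (carrier R)" "UP_X R [^]\<^bsub>P\<^esub> (2::nat) \<oplus>\<^bsub>P\<^esub> UP_X R \<oplus>\<^bsub>P\<^esub> \<one>\<^bsub>P\<^esub> \<in> S"
  shows "finite (carrier Q)" "card (carrier Q) \<le> card (carrier R) * card (carrier R)"
proof -
  interpret const: ring_hom_cring R Q const by (rule const_hom)
  have neg: "const (\<ominus> \<one>) = \<ominus>\<^bsub>Q\<^esub> \<one>\<^bsub>Q\<^esub>"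
    using const.hom_a_inv[OF R.one_closed] by simp
  have "X \<otimes>\<^bsub>Q\<^esub> X = \<ominus>\<^bsub>Q\<^esub> (X \<oplus>\<^bsub>Q\<^esub> \<one>\<^bsub>Q\<^esub>)"
    using omega_relation[OF assms(2)] by (intro proj.S.minus_equality[symmetric]) (simp_all add: proj.S.a_assoc)
  also have "\<dots> = const (\<ominus> \<one>) \<oplus>\<^bsub>Q\<^esub> const (\<ominus> \<one>) \<otimes>\<^bsub>Q\<^esub> X"
    unfolding neg by (simp add: proj.S.minus_add proj.S.l_minus proj.S.a_comm)
  finally have rel: "X \<otimes>\<^bsub>Q\<^esub> X = const (\<ominus> \<one>) \<oplus>\<^bsub>Q\<^esub> const (\<ominus> \<one>) \<otimes>\<^bsub>Q\<^esub> X" .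
  have "\<ominus> \<one> \<in> carrier R" by simp
  from card_quadratic_quotient[OF assms(1) this this rel]
  show "finite (carrier Q)" "card (carrier Q) \<le> card (carrier R) * card (carrier R)" by blast+
qed

end

lemma Z2x_x2_eq: "Z2x_x2 = UP_quot (residue_ring 2) {UP_X (residue_ring 2) [^]\<^bsub>UP (residue_ring 2)\<^esub> (2::nat)}"
  by (simp add: Z2x_x2_def Let_def)

lemma monomial_relation_closed:
  assumes "1 < n" shows "UP_X (residue_ring n) [^]\<^bsub>UP (residue_ring n)\<^esub> (k::nat) \<in> carrier (UP (residue_ring n))"
  using cring.UP_closed_simps[OF residue_ring_cring[OF assms]] by (intro monoid.nat_pow_closed)

lemma card_Z2x_x2: "finite (carrier Z2x_x2)" "card (carrier Z2x_x2) \<le> 4"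
proof -
  interpret polynomial_quotient "residue_ring 2" "{UP_X (residue_ring 2) [^]\<^bsub>UP (residue_ring 2)\<^esub> (2::nat)}"
    by (intro residue_polynomial_quotient) (simp_all add: monomial_relation_closed)
  show "finite (carrier Z2x_x2)" "card (carrier Z2x_x2) \<le> 4"
    unfolding Z2x_x2_eq using card_dual_numbers by (simp_all add: carrier_residue_ring)
qed

lemma (in cring) iso_Z2x_x2:
  assumes "\<one> \<oplus> \<one> = \<zero>" "x \<in> carrier R" "x \<otimes> x = \<zero>" "ring_generated_by R {\<zero>, \<one>, x}"
    and "finite (carrier R)" "4 \<le> card (carrier R)"
  shows "R \<simeq> Z2x_x2"
  unfolding Z2x_x2_eq
proof (rule iso_residue_quotient)
  show "\<forall>s\<in>{UP_X (residue_ring 2) [^]\<^bsub>UP (residue_ring 2)\<^esub> (2::nat)}. \<phi> s = \<zero>"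
    if "ring_hom_cring (UP (residue_ring 2)) R \<phi>" "\<phi> (UP_X (residue_ring 2)) = x" for \<phi>
  proof -
    interpret \<phi>: ring_hom_cring "UP (residue_ring 2)" R \<phi> by fact
    show ?thesis
      using that(2) assms(2,3) cring.UP_closed_simps[OF residue_ring_cring[of 2]]
      by (simp add: nat_pow_2)
  qed
qed (use assms card_Z2x_x2 in \<open>simp_all add: Z2x_x2_eq[symmetric] monomial_relation_closed add_pow_small\<close>)

lemma Z3x_x2_eq: "Z3x_x2 = UP_quot (residue_ring 3) {UP_X (residue_ring 3) [^]\<^bsub>UP (residue_ring 3)\<^esub> (2::nat)}"
  by (simp add: Z3x_x2_def Let_def)

lemma card_Z3x_x2: "finite (carrier Z3x_x2)" "card (carrier Z3x_x2) \<le> 9"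
proof -
  interpret polynomial_quotient "residue_ring 3" "{UP_X (residue_ring 3) [^]\<^bsub>UP (residue_ring 3)\<^esub> (2::nat)}"
    by (intro residue_polynomial_quotient) (simp_all add: monomial_relation_closed)
  show "finite (carrier Z3x_x2)" "card (carrier Z3x_x2) \<le> 9"
    unfolding Z3x_x2_eq using card_dual_numbers by (simp_all add: carrier_residue_ring)
qed

lemma (in cring) iso_Z3x_x2:
  assumes "\<one> \<oplus> \<one> \<oplus> \<one> = \<zero>" "x \<in> carrier R" "x \<otimes> x = \<zero>" "ring_generated_by R {\<zero>, \<one>, x}"
    and "finite (carrier R)" "9 \<le> card (carrier R)"
  shows "R \<simeq> Z3x_x2"
  unfolding Z3x_x2_eq
proof (rule iso_residue_quotient)
  show "\<forall>s\<in>{UP_X (residue_ring 3) [^]\<^bsub>UP (residue_ring 3)\<^esub> (2::nat)}. \<phi> s = \<zero>"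
    if "ring_hom_cring (UP (residue_ring 3)) R \<phi>" "\<phi> (UP_X (residue_ring 3)) = x" for \<phi>
  proof -
    interpret \<phi>: ring_hom_cring "UP (residue_ring 3)" R \<phi> by fact
    show ?thesis
      using that(2) assms(2,3) cring.UP_closed_simps[OF residue_ring_cring[of 3]]
      by (simp add: nat_pow_2)
  qed
qed (use assms card_Z3x_x2 in \<open>simp_all add: Z3x_x2_eq[symmetric] monomial_relation_closed add_pow_small\<close>)

lemma Z2x_x3_eq: "Z2x_x3 = UP_quot (residue_ring 2) {UP_X (residue_ring 2) [^]\<^bsub>UP (residue_ring 2)\<^esub> (3::nat)}"
  by (simp add: Z2x_x3_def Let_def)

lemma card_Z2x_x3: "finite (carrier Z2x_x3)" "card (carrier Z2x_x3) \<le> 8"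
proof -
  let ?S = "{UP_X (residue_ring 2) [^]\<^bsub>UP (residue_ring 2)\<^esub> (3::nat)}"
  interpret polynomial_quotient "residue_ring 2" ?S
    by (intro residue_polynomial_quotient) (simp_all add: monomial_relation_closed)
  have "X \<otimes>\<^bsub>Q\<^esub> X \<otimes>\<^bsub>Q\<^esub> X = \<zero>\<^bsub>Q\<^esub>"
    using proj_relation[of "UP_X (residue_ring 2) [^]\<^bsub>UP (residue_ring 2)\<^esub> (3::nat)"]
    by (simp add: proj.S.nat_pow_3)
  from card_cubic_quotient[OF _ this]
  show "finite (carrier Z2x_x3)" "card (carrier Z2x_x3) \<le> 8"
    unfolding Z2x_x3_eq by (simp_all add: carrier_residue_ring)
qed

lemma (in cring) iso_Z2x_x3:
  assumes "\<one> \<oplus> \<one> = \<zero>" "x \<in> carrier R" "x \<otimes> x \<otimes> x = \<zero>" "ring_generated_by R {\<zero>, \<one>, x}"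
    and "finite (carrier R)" "8 \<le> card (carrier R)"
  shows "R \<simeq> Z2x_x3"
  unfolding Z2x_x3_eq
proof (rule iso_residue_quotient)
  show "\<forall>s\<in>{UP_X (residue_ring 2) [^]\<^bsub>UP (residue_ring 2)\<^esub> (3::nat)}. \<phi> s = \<zero>"
    if "ring_hom_cring (UP (residue_ring 2)) R \<phi>" "\<phi> (UP_X (residue_ring 2)) = x" for \<phi>
  proof -
    interpret \<phi>: ring_hom_cring "UP (residue_ring 2)" R \<phi> by fact
    show ?thesis
      using that(2) assms(2,3) cring.UP_closed_simps[OF residue_ring_cring[of 2]]
      by (simp add: nat_pow_3)
  qed
qed (use assms card_Z2x_x3 in \<open>simp_all add: Z2x_x3_eq[symmetric] monomial_relation_closed add_pow_small\<close>)

lemma (in ring_hom_cring) hom_minus: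
  "a \<in> carrier R \<Longrightarrow> b \<in> carrier R \<Longrightarrow> h (a \<ominus> b) = h a \<ominus>\<^bsub>S\<^esub> h b"
  by (simp add: a_minus_def)

text \<open>Over a ring of coefficients \<open>{0, 1, 2, 3}\<close> the relation \<open>2 X = 0\<close> makes all multiples of \<open>X\<close> by
constants equal to \<open>0\<close> or \<open>X\<close>. It holds in two of the quotients, by definition in one and because
\<open>2 X = X\<^sup>3\<close> in the other.\<close>

lemma (in polynomial_quotient) card_two_X_zero:
  assumes R: "carrier R = {\<zero>, \<one>, \<one> \<oplus> \<one>, \<one> \<oplus> \<one> \<oplus> \<one>}"
    and kill: "const (\<one> \<oplus> \<one>) \<otimes>\<^bsub>Q\<^esub> X = \<zero>\<^bsub>Q\<^esub>"
    and c: "c \<in> carrier R" and sq: "X \<otimes>\<^bsub>Q\<^esub> X = const c"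
  shows "finite (carrier Q)" "card (carrier Q) \<le> 8"
proof -
  interpret const: ring_hom_cring R Q const by (rule const_hom)
  have "const (\<one> \<oplus> \<one> \<oplus> \<one>) \<otimes>\<^bsub>Q\<^esub> X = const (\<one> \<oplus> \<one>) \<otimes>\<^bsub>Q\<^esub> X \<oplus>\<^bsub>Q\<^esub> X"
    by (simp add: proj.S.l_distr)
  then have "const (\<one> \<oplus> \<one> \<oplus> \<one>) \<otimes>\<^bsub>Q\<^esub> X = X"
    unfolding kill by simp
  moreover have "const \<zero> \<otimes>\<^bsub>Q\<^esub> X = \<zero>\<^bsub>Q\<^esub>" "const \<one> \<otimes>\<^bsub>Q\<^esub> X = X"
    by simp_all
  ultimately have "const b \<otimes>\<^bsub>Q\<^esub> X \<in> {\<zero>\<^bsub>Q\<^esub>, X}" if "b \<in> carrier R" for b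
    using that kill unfolding R by (elim insertE emptyE; blast)
  moreover have "X \<otimes>\<^bsub>Q\<^esub> X = const c \<oplus>\<^bsub>Q\<^esub> const \<zero> \<otimes>\<^bsub>Q\<^esub> X"
    using sq c by simp
  moreover have fin: "finite (carrier R)"
    unfolding R by simp
  ultimately have *: "finite (carrier Q)" "card (carrier Q) \<le> card (carrier R) * 2"
    using card_quadratic_killed[OF _ c R.zero_closed] by blast+
  have "card (carrier R) \<le> 4"
    unfolding R using card_length[of "[\<zero>, \<one>, \<one> \<oplus> \<one>, \<one> \<oplus> \<one> \<oplus> \<one>]"] by (simp del: card_insert_disjoint)
  then show "finite (carrier Q)" "card (carrier Q) \<le> 8" using * by simp_all
qed

lemma residue_ring_4_facts:
  "carrier (residue_ring 4) = {\<zero>\<^bsub>residue_ring 4\<^esub>, \<one>\<^bsub>residue_ring 4\<^esub>,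
     \<one>\<^bsub>residue_ring 4\<^esub> \<oplus>\<^bsub>residue_ring 4\<^esub> \<one>\<^bsub>residue_ring 4\<^esub>,
     \<one>\<^bsub>residue_ring 4\<^esub> \<oplus>\<^bsub>residue_ring 4\<^esub> \<one>\<^bsub>residue_ring 4\<^esub> \<oplus>\<^bsub>residue_ring 4\<^esub> \<one>\<^bsub>residue_ring 4\<^esub>}"
  "\<one>\<^bsub>residue_ring 4\<^esub> \<oplus>\<^bsub>residue_ring 4\<^esub> \<one>\<^bsub>residue_ring 4\<^esub> = 2"
  by (auto simp: carrier_residue_ring residue_ring_simps)

lemma Z4x_x3_x2m2_eq: "Z4x_x3_x2m2 = UP_quot (residue_ring 4)
   {UP_X (residue_ring 4) [^]\<^bsub>UP (residue_ring 4)\<^esub> (3::nat),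
    UP_X (residue_ring 4) [^]\<^bsub>UP (residue_ring 4)\<^esub> (2::nat) \<ominus>\<^bsub>UP (residue_ring 4)\<^esub> UP_const (residue_ring 4) 2}"
  by (simp add: Z4x_x3_x2m2_def Let_def)

lemma Z4_UP_closed:
  "UP_const (residue_ring 4) 2 \<in> carrier (UP (residue_ring 4))"
  "UP_X (residue_ring 4) \<in> carrier (UP (residue_ring 4))"
  "cring (UP (residue_ring 4))"
proof -
  interpret Z: cring "residue_ring 4" by (rule residue_ring_cring) simp
  interpret UP: UP_cring "residue_ring 4" "UP (residue_ring 4)" by unfold_locales simp
  show "cring (UP (residue_ring 4))" by (rule UP.P.is_cring)
  show "UP_const (residue_ring 4) 2 \<in> carrier (UP (residue_ring 4))"
    "UP_X (residue_ring 4) \<in> carrier (UP (residue_ring 4))"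
    using Z.UP_closed_simps by (simp_all add: carrier_residue_ring)
qed

lemma Z4x_x3_x2m2_relations_closed:
  "{UP_X (residue_ring 4) [^]\<^bsub>UP (residue_ring 4)\<^esub> (3::nat),
    UP_X (residue_ring 4) [^]\<^bsub>UP (residue_ring 4)\<^esub> (2::nat) \<ominus>\<^bsub>UP (residue_ring 4)\<^esub> UP_const (residue_ring 4) 2}
    \<subseteq> carrier (UP (residue_ring 4))"
proof -
  interpret UP: cring "UP (residue_ring 4)" by (rule Z4_UP_closed(3))
  show ?thesis using Z4_UP_closed by simp
qed

lemma card_Z4x_x3_x2m2: "finite (carrier Z4x_x3_x2m2)" "card (carrier Z4x_x3_x2m2) \<le> 8"
proof -
  let ?P = "UP (residue_ring 4)" and ?x = "UP_X (residue_ring 4)"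
  let ?S = "{?x [^]\<^bsub>?P\<^esub> (3::nat), ?x [^]\<^bsub>?P\<^esub> (2::nat) \<ominus>\<^bsub>?P\<^esub> UP_const (residue_ring 4) 2}"
  interpret polynomial_quotient "residue_ring 4" ?S
    by (intro residue_polynomial_quotient Z4x_x3_x2m2_relations_closed) simp
  have two: "2 \<in> carrier (residue_ring 4)" by (simp add: carrier_residue_ring)
  have "proj (?x [^]\<^bsub>?P\<^esub> (3::nat)) = \<zero>\<^bsub>Q\<^esub>" by (rule proj_relation) simp
  then have cube: "X \<otimes>\<^bsub>Q\<^esub> X \<otimes>\<^bsub>Q\<^esub> X = \<zero>\<^bsub>Q\<^esub>"
    by (simp add: proj.S.nat_pow_3)
  have "proj (?x [^]\<^bsub>?P\<^esub> (2::nat) \<ominus>\<^bsub>?P\<^esub> UP_const (residue_ring 4) 2) = \<zero>\<^bsub>Q\<^esub>"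
    by (rule proj_relation) simp
  then have "X \<otimes>\<^bsub>Q\<^esub> X \<ominus>\<^bsub>Q\<^esub> const 2 = \<zero>\<^bsub>Q\<^esub>"
    using two by (simp add: proj.S.nat_pow_2 proj.hom_minus)
  then have sq: "X \<otimes>\<^bsub>Q\<^esub> X = const 2"
    using two by simp
  show "finite (carrier Z4x_x3_x2m2)" "card (carrier Z4x_x3_x2m2) \<le> 8"
    unfolding Z4x_x3_x2m2_eq
    using card_two_X_zero[OF residue_ring_4_facts(1) _ two sq] cube
    unfolding sq residue_ring_4_facts(2) by blast+
qed

lemma (in cring) iso_Z4x_x3_x2m2:
  assumes "(\<one> \<oplus> \<one>) \<otimes> (\<one> \<oplus> \<one>) = \<zero>" "x \<in> carrier R" "x \<otimes> x = \<one> \<oplus> \<one>" "x \<otimes> x \<otimes> x = \<zero>"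
    "ring_generated_by R {\<zero>, \<one>, x}"
    and "finite (carrier R)" "8 \<le> card (carrier R)"
  shows "R \<simeq> Z4x_x3_x2m2"
  unfolding Z4x_x3_x2m2_eq
proof (rule iso_residue_quotient[OF _ _ assms(2) Z4x_x3_x2m2_relations_closed _ assms(5,6)])
  fix \<phi> assume "ring_hom_cring (UP (residue_ring 4)) R \<phi>" and X: "\<phi> (UP_X (residue_ring 4)) = x"
    and const: "\<And>a. a \<in> carrier (residue_ring 4) \<Longrightarrow> \<phi> (UP_const (residue_ring 4) a) = [a] \<cdot> \<one>"
  then interpret \<phi>: ring_hom_cring "UP (residue_ring 4)" R \<phi> by blast
  have "\<phi> (UP_const (residue_ring 4) 2) = \<one> \<oplus> \<one>"
    using const[of 2] by (simp add: carrier_residue_ring add_pow_small)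
  then show "\<forall>s\<in>{UP_X (residue_ring 4) [^]\<^bsub>UP (residue_ring 4)\<^esub> (3::nat),
    UP_X (residue_ring 4) [^]\<^bsub>UP (residue_ring 4)\<^esub> (2::nat) \<ominus>\<^bsub>UP (residue_ring 4)\<^esub> UP_const (residue_ring 4) 2}.
    \<phi> s = \<zero>"
    using X assms(2-4) Z4_UP_closed by (simp add: nat_pow_2 nat_pow_3 a_minus_def r_neg)
qed (use assms card_Z4x_x3_x2m2 in \<open>simp_all add: Z4x_x3_x2m2_eq[symmetric] add_pow_4_one\<close>)

lemma Z4x_2x_x2_eq: "Z4x_2x_x2 = UP_quot (residue_ring 4)
   {UP_const (residue_ring 4) 2 \<otimes>\<^bsub>UP (residue_ring 4)\<^esub> UP_X (residue_ring 4),
    UP_X (residue_ring 4) [^]\<^bsub>UP (residue_ring 4)\<^esub> (2::nat)}"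
  by (simp add: Z4x_2x_x2_def Let_def)

lemma Z4x_2x_x2_relations_closed:
  "{UP_const (residue_ring 4) 2 \<otimes>\<^bsub>UP (residue_ring 4)\<^esub> UP_X (residue_ring 4),
    UP_X (residue_ring 4) [^]\<^bsub>UP (residue_ring 4)\<^esub> (2::nat)} \<subseteq> carrier (UP (residue_ring 4))"
proof -
  interpret UP: cring "UP (residue_ring 4)" by (rule Z4_UP_closed(3))
  show ?thesis using Z4_UP_closed by simp
qed

lemma card_Z4x_2x_x2: "finite (carrier Z4x_2x_x2)" "card (carrier Z4x_2x_x2) \<le> 8"
proof -
  let ?P = "UP (residue_ring 4)" and ?x = "UP_X (residue_ring 4)"
  let ?S = "{UP_const (residue_ring 4) 2 \<otimes>\<^bsub>?P\<^esub> ?x, ?x [^]\<^bsub>?P\<^esub> (2::nat)}"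
  interpret polynomial_quotient "residue_ring 4" ?S
    by (intro residue_polynomial_quotient Z4x_2x_x2_relations_closed) simp
  interpret const: ring_hom_cring "residue_ring 4" Q const by (rule const_hom)
  have two: "2 \<in> carrier (residue_ring 4)" by (simp add: carrier_residue_ring)
  have "proj (UP_const (residue_ring 4) 2 \<otimes>\<^bsub>?P\<^esub> ?x) = \<zero>\<^bsub>Q\<^esub>" by (rule proj_relation) simp
  then have kill: "const 2 \<otimes>\<^bsub>Q\<^esub> X = \<zero>\<^bsub>Q\<^esub>"
    using two by simp
  have "proj (?x [^]\<^bsub>?P\<^esub> (2::nat)) = \<zero>\<^bsub>Q\<^esub>" by (rule proj_relation) simp
  then have sq: "X \<otimes>\<^bsub>Q\<^esub> X = const \<zero>\<^bsub>residue_ring 4\<^esub>"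
    by (simp add: proj.S.nat_pow_2)
  show "finite (carrier Z4x_2x_x2)" "card (carrier Z4x_2x_x2) \<le> 8"
    unfolding Z4x_2x_x2_eq
    using card_two_X_zero[OF residue_ring_4_facts(1) _ R.zero_closed sq] kill
    unfolding residue_ring_4_facts(2) by blast+
qed

lemma (in cring) iso_Z4x_2x_x2:
  assumes "(\<one> \<oplus> \<one>) \<otimes> (\<one> \<oplus> \<one>) = \<zero>" "x \<in> carrier R" "x \<otimes> x = \<zero>" "(\<one> \<oplus> \<one>) \<otimes> x = \<zero>"
    "ring_generated_by R {\<zero>, \<one>, x}"
    and "finite (carrier R)" "8 \<le> card (carrier R)"
  shows "R \<simeq> Z4x_2x_x2"
  unfolding Z4x_2x_x2_eq
proof (rule iso_residue_quotient[OF _ _ assms(2) Z4x_2x_x2_relations_closed _ assms(5,6)])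
  fix \<phi> assume "ring_hom_cring (UP (residue_ring 4)) R \<phi>" and X: "\<phi> (UP_X (residue_ring 4)) = x"
    and const: "\<And>a. a \<in> carrier (residue_ring 4) \<Longrightarrow> \<phi> (UP_const (residue_ring 4) a) = [a] \<cdot> \<one>"
  then interpret \<phi>: ring_hom_cring "UP (residue_ring 4)" R \<phi> by blast
  have "\<phi> (UP_const (residue_ring 4) 2) = \<one> \<oplus> \<one>"
    using const[of 2] by (simp add: carrier_residue_ring add_pow_small)
  then show "\<forall>s\<in>{UP_const (residue_ring 4) 2 \<otimes>\<^bsub>UP (residue_ring 4)\<^esub> UP_X (residue_ring 4),
    UP_X (residue_ring 4) [^]\<^bsub>UP (residue_ring 4)\<^esub> (2::nat)}. \<phi> s = \<zero>"
    using X assms(2-4) Z4_UP_closed by (simp add: nat_pow_2)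
qed (use assms card_Z4x_2x_x2 in \<open>simp_all add: Z4x_2x_x2_eq[symmetric] add_pow_4_one\<close>)

text \<open>In a local ring with \<open>4 = 0\<close> a root of \<open>t\<^sup>2 + t + 1\<close> reduces to a primitive cube root of unity in the
residue field, which is then of characteristic 2 and has at least four elements. Both conditions
pass along homomorphisms.\<close>

definition has_omega :: "('a, 'm) ring_scheme \<Rightarrow> bool" where
  "has_omega A \<longleftrightarrow> (\<one>\<^bsub>A\<^esub> \<oplus>\<^bsub>A\<^esub> \<one>\<^bsub>A\<^esub>) \<otimes>\<^bsub>A\<^esub> (\<one>\<^bsub>A\<^esub> \<oplus>\<^bsub>A\<^esub> \<one>\<^bsub>A\<^esub>) = \<zero>\<^bsub>A\<^esub> \<and>
     (\<exists>t\<in>carrier A. t \<otimes>\<^bsub>A\<^esub> t \<oplus>\<^bsub>A\<^esub> t \<oplus>\<^bsub>A\<^esub> \<one>\<^bsub>A\<^esub> = \<zero>\<^bsub>A\<^esub>)"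

lemma (in ring_hom_cring) four_eq_zero_transfer:
  assumes "(\<one> \<oplus> \<one>) \<otimes> (\<one> \<oplus> \<one>) = \<zero>"
  shows "(\<one>\<^bsub>S\<^esub> \<oplus>\<^bsub>S\<^esub> \<one>\<^bsub>S\<^esub>) \<otimes>\<^bsub>S\<^esub> (\<one>\<^bsub>S\<^esub> \<oplus>\<^bsub>S\<^esub> \<one>\<^bsub>S\<^esub>) = \<zero>\<^bsub>S\<^esub>"
proof -
  have "h ((\<one> \<oplus> \<one>) \<otimes> (\<one> \<oplus> \<one>)) = \<zero>\<^bsub>S\<^esub>"
    unfolding assms by simp
  then show ?thesis by simp
qed

lemma (in ring_hom_cring) has_omega_transfer:
  assumes "has_omega R" shows "has_omega S"
proof -
  obtain t where t: "t \<in> carrier R" "t \<otimes> t \<oplus> t \<oplus> \<one> = \<zero>"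
    and four: "(\<one> \<oplus> \<one>) \<otimes> (\<one> \<oplus> \<one>) = \<zero>"
    using assms unfolding has_omega_def by blast
  have "h (t \<otimes> t \<oplus> t \<oplus> \<one>) = \<zero>\<^bsub>S\<^esub>"
    unfolding t(2) by simp
  then have "h t \<otimes>\<^bsub>S\<^esub> h t \<oplus>\<^bsub>S\<^esub> h t \<oplus>\<^bsub>S\<^esub> \<one>\<^bsub>S\<^esub> = \<zero>\<^bsub>S\<^esub>"
    using t(1) by simp
  then show ?thesis
    using four_eq_zero_transfer[OF four] t(1) unfolding has_omega_def by blast
qed

lemma omega_relation_closed:
  assumes "1 < n"
  shows "UP_X (residue_ring n) [^]\<^bsub>UP (residue_ring n)\<^esub> (2::nat) \<oplus>\<^bsub>UP (residue_ring n)\<^esub> UP_X (residue_ring n)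
      \<oplus>\<^bsub>UP (residue_ring n)\<^esub> \<one>\<^bsub>UP (residue_ring n)\<^esub> \<in> carrier (UP (residue_ring n))"
proof -
  interpret UP: ring "UP (residue_ring n)"
    by (rule cring.UP_closed_simps[OF residue_ring_cring[OF assms]])
  show ?thesis
    using cring.UP_closed_simps[OF residue_ring_cring[OF assms]] by simp
qed

lemma (in polynomial_quotient) has_omega_quotient:
  assumes "UP_X R [^]\<^bsub>P\<^esub> (2::nat) \<oplus>\<^bsub>P\<^esub> UP_X R \<oplus>\<^bsub>P\<^esub> \<one>\<^bsub>P\<^esub> \<in> S"
    and "(\<one> \<oplus> \<one>) \<otimes> (\<one> \<oplus> \<one>) = \<zero>"
  shows "has_omega Q"
  unfolding has_omega_def
  using ring_hom_cring.four_eq_zero_transfer[OF const_hom assms(2)] omega_relation[OF assms(1)] X_closed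
  by blast

lemma GF4_eq: "GF4 = UP_quot (residue_ring 2) {UP_X (residue_ring 2) [^]\<^bsub>UP (residue_ring 2)\<^esub> (2::nat)
   \<oplus>\<^bsub>UP (residue_ring 2)\<^esub> UP_X (residue_ring 2) \<oplus>\<^bsub>UP (residue_ring 2)\<^esub> \<one>\<^bsub>UP (residue_ring 2)\<^esub>}"
  by (simp add: GF4_def Let_def)

lemma GF4_polynomial_quotient:
  "polynomial_quotient (residue_ring 2) {UP_X (residue_ring 2) [^]\<^bsub>UP (residue_ring 2)\<^esub> (2::nat)
   \<oplus>\<^bsub>UP (residue_ring 2)\<^esub> UP_X (residue_ring 2) \<oplus>\<^bsub>UP (residue_ring 2)\<^esub> \<one>\<^bsub>UP (residue_ring 2)\<^esub>}"
  using omega_relation_closed[of 2] by (intro residue_polynomial_quotient) simp_all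

lemma GF4_facts: "cring GF4" "finite (carrier GF4)" "card (carrier GF4) \<le> 4" "has_omega GF4"
proof -
  interpret polynomial_quotient "residue_ring 2" "{UP_X (residue_ring 2) [^]\<^bsub>UP (residue_ring 2)\<^esub> (2::nat)
   \<oplus>\<^bsub>UP (residue_ring 2)\<^esub> UP_X (residue_ring 2) \<oplus>\<^bsub>UP (residue_ring 2)\<^esub> \<one>\<^bsub>UP (residue_ring 2)\<^esub>}"
    by (rule GF4_polynomial_quotient)
  show "cring GF4" unfolding GF4_eq by (rule proj.S.is_cring)
  show "finite (carrier GF4)" "card (carrier GF4) \<le> 4"
    unfolding GF4_eq using card_omega_quotient by (simp_all add: carrier_residue_ring)
  show "has_omega GF4"
    unfolding GF4_eq by (rule has_omega_quotient) (simp_all add: residue_ring_simps)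
qed

text \<open>A root of \<open>t\<^sup>2 + t + 1\<close> in a ring of characteristic 2 turns it into an algebra over the field with four
elements.\<close>

lemma (in cring) GF4_hom:
  assumes "\<one> \<oplus> \<one> = \<zero>" "t \<in> carrier R" "t \<otimes> t \<oplus> t \<oplus> \<one> = \<zero>"
  obtains h where "ring_hom_cring GF4 R h" "t \<in> h ` carrier GF4"
proof -
  interpret Z: polynomial_quotient "residue_ring 2" "{UP_X (residue_ring 2) [^]\<^bsub>UP (residue_ring 2)\<^esub> (2::nat)
   \<oplus>\<^bsub>UP (residue_ring 2)\<^esub> UP_X (residue_ring 2) \<oplus>\<^bsub>UP (residue_ring 2)\<^esub> \<one>\<^bsub>UP (residue_ring 2)\<^esub>}"
    by (rule GF4_polynomial_quotient)
  have "[(2::int)] \<cdot> \<one> = \<zero>" using assms(1) by (simp add: add_pow_small)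
  then have hom: "ring_hom_cring (residue_ring 2) R (\<lambda>k. [k] \<cdot> \<one>)"
    by (intro residue_ring_hom) simp_all
  let ?e = "eval (residue_ring 2) R (\<lambda>k. [k] \<cdot> \<one>) t"
  interpret e: ring_hom_cring "UP (residue_ring 2)" R ?e
    by (rule Z.eval_hom(1)[OF hom assms(2)])
  have eX: "?e (UP_X (residue_ring 2)) = t"
    by (rule Z.eval_hom(2)[OF hom assms(2)])
  have "?e (UP_X (residue_ring 2) [^]\<^bsub>UP (residue_ring 2)\<^esub> (2::nat)
   \<oplus>\<^bsub>UP (residue_ring 2)\<^esub> UP_X (residue_ring 2) \<oplus>\<^bsub>UP (residue_ring 2)\<^esub> \<one>\<^bsub>UP (residue_ring 2)\<^esub>) = \<zero>"
    using eX assms(2,3) by (simp add: nat_pow_2)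
  then obtain \<psi> where \<psi>: "ring_hom_cring Z.Q R \<psi>" "\<And>f. f \<in> carrier Z.P \<Longrightarrow> \<psi> (Z.proj f) = ?e f"
    using Z.lift[OF e.ring_hom_cring_axioms] by blast
  have "\<psi> Z.X = t" using \<psi>(2)[OF Z.UP_X_closed] eX by simp
  then have "t \<in> \<psi> ` carrier Z.Q" using Z.X_closed by blast
  then show ?thesis
    using that \<psi>(1) unfolding GF4_eq by blast
qed

lemma F4x_x2_eq: "F4x_x2 = UP_quot GF4 {UP_X GF4 [^]\<^bsub>UP GF4\<^esub> (2::nat)}"
  by (simp add: F4x_x2_def Let_def)

lemma F4x_x2_polynomial_quotient: "polynomial_quotient GF4 {UP_X GF4 [^]\<^bsub>UP GF4\<^esub> (2::nat)}"
proof -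
  interpret cring GF4 by (rule GF4_facts)
  show ?thesis
    using UP_closed_simps(1,3) by unfold_locales (simp add: monoid.nat_pow_closed)
qed

lemma F4x_x2_facts: "cring F4x_x2" "finite (carrier F4x_x2)" "card (carrier F4x_x2) \<le> 16" "has_omega F4x_x2"
proof -
  interpret polynomial_quotient GF4 "{UP_X GF4 [^]\<^bsub>UP GF4\<^esub> (2::nat)}"
    by (rule F4x_x2_polynomial_quotient)
  show "cring F4x_x2" unfolding F4x_x2_eq by (rule proj.S.is_cring)
  note card = card_dual_numbers[OF GF4_facts(2)]
  show "finite (carrier F4x_x2)" unfolding F4x_x2_eq using card(1) by simp
  have "card (carrier GF4) * card (carrier GF4) \<le> 4 * 4"
    using GF4_facts(3) by (intro mult_le_mono)
  then show "card (carrier F4x_x2) \<le> 16" unfolding F4x_x2_eq using card(2) by simp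
  show "has_omega F4x_x2"
    unfolding F4x_x2_eq by (rule ring_hom_cring.has_omega_transfer[OF const_hom GF4_facts(4)])
qed

lemma (in cring) iso_F4x_x2:
  assumes "\<one> \<oplus> \<one> = \<zero>" and t: "t \<in> carrier R" "t \<otimes> t \<oplus> t \<oplus> \<one> = \<zero>"
    and x: "x \<in> carrier R" "x \<otimes> x = \<zero>" and gen: "ring_generated_by R {\<zero>, \<one>, t, x}"
    and fin: "finite (carrier R)" "16 \<le> card (carrier R)"
  shows "R \<simeq> F4x_x2"
proof -
  interpret Q: polynomial_quotient GF4 "{UP_X GF4 [^]\<^bsub>UP GF4\<^esub> (2::nat)}"
    by (rule F4x_x2_polynomial_quotient)
  obtain h where h: "ring_hom_cring GF4 R h" "t \<in> h ` carrier GF4"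
    using GF4_hom[OF assms(1) t] by blast
  interpret h: ring_hom_cring GF4 R h by (rule h)
  have "\<zero> \<in> h ` carrier GF4" "\<one> \<in> h ` carrier GF4"
    using h.hom_zero h.hom_one Q.R.zero_closed Q.R.one_closed by (metis image_eqI)+
  then have "{\<zero>, \<one>, t, x} \<subseteq> h ` carrier GF4 \<union> {x}"
    using h(2) by blast
  note gen' = ring_generated_by_mono[OF gen this]
  show ?thesis
    unfolding F4x_x2_eq
  proof (rule Q.ring_isoI[OF h(1) x(1) _ gen' fin(1)])
    show "\<forall>s\<in>{UP_X GF4 [^]\<^bsub>UP GF4\<^esub> (2::nat)}. \<phi> s = \<zero>"
      if "ring_hom_cring (UP GF4) R \<phi>" "\<phi> (UP_X GF4) = x" for \<phi>
    proof -
      interpret \<phi>: ring_hom_cring "UP GF4" R \<phi> by fact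
      show ?thesis using that(2) x by (simp add: nat_pow_2)
    qed
  qed (use F4x_x2_facts fin(2) in \<open>simp_all add: F4x_x2_eq[symmetric]\<close>)
qed

lemma Z4x_x2px1_eq: "Z4x_x2px1 = UP_quot (residue_ring 4) {UP_X (residue_ring 4) [^]\<^bsub>UP (residue_ring 4)\<^esub> (2::nat)
   \<oplus>\<^bsub>UP (residue_ring 4)\<^esub> UP_X (residue_ring 4) \<oplus>\<^bsub>UP (residue_ring 4)\<^esub> \<one>\<^bsub>UP (residue_ring 4)\<^esub>}"
  by (simp add: Z4x_x2px1_def Let_def)

lemma Z4x_x2px1_facts:
  "cring Z4x_x2px1" "finite (carrier Z4x_x2px1)" "card (carrier Z4x_x2px1) \<le> 16" "has_omega Z4x_x2px1"
proof -
  interpret polynomial_quotient "residue_ring 4" "{UP_X (residue_ring 4) [^]\<^bsub>UP (residue_ring 4)\<^esub> (2::nat)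
   \<oplus>\<^bsub>UP (residue_ring 4)\<^esub> UP_X (residue_ring 4) \<oplus>\<^bsub>UP (residue_ring 4)\<^esub> \<one>\<^bsub>UP (residue_ring 4)\<^esub>}"
    using omega_relation_closed[of 4] by (intro residue_polynomial_quotient) simp_all
  show "cring Z4x_x2px1" unfolding Z4x_x2px1_eq by (rule proj.S.is_cring)
  show "finite (carrier Z4x_x2px1)" "card (carrier Z4x_x2px1) \<le> 16"
    unfolding Z4x_x2px1_eq using card_omega_quotient by (simp_all add: carrier_residue_ring)
  show "has_omega Z4x_x2px1"
    unfolding Z4x_x2px1_eq by (rule has_omega_quotient) (simp_all add: residue_ring_simps)
qed

lemma (in cring) iso_Z4x_x2px1:
  assumes "(\<one> \<oplus> \<one>) \<otimes> (\<one> \<oplus> \<one>) = \<zero>" and t: "t \<in> carrier R" "t \<otimes> t \<oplus> t \<oplus> \<one> = \<zero>"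
    and gen: "ring_generated_by R {\<zero>, \<one>, t}"
    and fin: "finite (carrier R)" "16 \<le> card (carrier R)"
  shows "R \<simeq> Z4x_x2px1"
  unfolding Z4x_x2px1_eq
proof (rule iso_residue_quotient[OF _ _ t(1) _ _ gen fin(1)])
  show "\<forall>s\<in>{UP_X (residue_ring 4) [^]\<^bsub>UP (residue_ring 4)\<^esub> (2::nat)
   \<oplus>\<^bsub>UP (residue_ring 4)\<^esub> UP_X (residue_ring 4) \<oplus>\<^bsub>UP (residue_ring 4)\<^esub> \<one>\<^bsub>UP (residue_ring 4)\<^esub>}. \<phi> s = \<zero>"
    if "ring_hom_cring (UP (residue_ring 4)) R \<phi>" "\<phi> (UP_X (residue_ring 4)) = t" for \<phi>
  proof -
    interpret \<phi>: ring_hom_cring "UP (residue_ring 4)" R \<phi> by fact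
    show ?thesis
      using that(2) t Z4_UP_closed by (simp add: nat_pow_2)
  qed
qed (use assms(1) fin(2) Z4x_x2px1_facts omega_relation_closed[of 4] in
  \<open>simp_all add: Z4x_x2px1_eq[symmetric] add_pow_4_one\<close>)

text \<open>The ring \<open>k[x, y]\<close> modulo the square of the ideal \<open>(x, y)\<close>, with \<open>y\<close> as the outer indeterminate.\<close>

locale two_variable_polynomials = k?: cring k for k :: "('a, 'm) ring_scheme" (structure)
begin

abbreviation "x \<equiv> UP_const (UP k) (UP_X k)"
abbreviation "y \<equiv> UP_X (UP k)"

sublocale inner: polynomial_quotient k "{}"
  by unfold_locales simp

sublocale polynomial_quotient "UP k" "{x [^]\<^bsub>UP (UP k)\<^esub> (2::nat), x \<otimes>\<^bsub>UP (UP k)\<^esub> y, y [^]\<^bsub>UP (UP k)\<^esub> (2::nat)}"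
proof (intro polynomial_quotient.intro polynomial_quotient_axioms.intro inner.UP.P.is_cring)
  interpret UP: UP_cring "UP k" "UP (UP k)" by unfold_locales simp
  have "y \<in> carrier (UP (UP k))" "x \<in> carrier (UP (UP k))"
    using cring.UP_closed_simps[OF inner.UP.P.is_cring] inner.UP_X_closed by blast+
  then show "{x [^]\<^bsub>UP (UP k)\<^esub> (2::nat), x \<otimes>\<^bsub>UP (UP k)\<^esub> y, y [^]\<^bsub>UP (UP k)\<^esub> (2::nat)} \<subseteq> carrier (UP (UP k))"
    by simp
qed

text \<open>Every class is a combination of \<open>1, x, y\<close>. The induction is nested as the polynomials are: the
constants of the outer ring are polynomials in \<open>x\<close>.\<close>

lemma card_square_zero_ideal:
  assumes fin: "finite (carrier k)"
  shows "finite (carrier Q)" "card (carrier Q) \<le> card (carrier k) ^ 3"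
proof -
  define \<kappa> where "\<kappa> = (\<lambda>a. const (UP_const k a))"
  interpret const: ring_hom_cring "UP k" Q const by (rule const_hom)
  have "\<kappa> \<in> ring_hom k Q"
    using ring_hom_trans[OF ring_hom_cring.homh[OF inner.UP_const_hom] const.homh]
    by (simp add: comp_def \<kappa>_def)
  then interpret \<kappa>: ring_hom_cring k Q \<kappa>
    by (intro ring_hom_cringI k.is_cring proj.S.is_cring)
  define \<xi> where "\<xi> = proj x"
  have xy: "\<xi> \<in> carrier Q" "X \<in> carrier Q"
    unfolding \<xi>_def by simp_all
  have "proj (x [^]\<^bsub>P\<^esub> (2::nat)) = \<zero>\<^bsub>Q\<^esub>" "proj (x \<otimes>\<^bsub>P\<^esub> y) = \<zero>\<^bsub>Q\<^esub>" "proj (y [^]\<^bsub>P\<^esub> (2::nat)) = \<zero>\<^bsub>Q\<^esub>"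
    by (rule proj_relation, simp)+
  then have rel: "\<xi> \<otimes>\<^bsub>Q\<^esub> \<xi> = \<zero>\<^bsub>Q\<^esub>" "\<xi> \<otimes>\<^bsub>Q\<^esub> X = \<zero>\<^bsub>Q\<^esub>" "X \<otimes>\<^bsub>Q\<^esub> X = \<zero>\<^bsub>Q\<^esub>"
    by (simp_all add: proj.S.nat_pow_2 \<xi>_def)
  let ?E = "{\<kappa> a \<oplus>\<^bsub>Q\<^esub> \<kappa> b \<otimes>\<^bsub>Q\<^esub> \<xi> \<oplus>\<^bsub>Q\<^esub> \<kappa> c \<otimes>\<^bsub>Q\<^esub> X | a b c.
    a \<in> carrier k \<and> b \<in> carrier k \<and> c \<in> carrier k}"
  have "\<xi> \<otimes>\<^bsub>Q\<^esub> \<xi> \<in> {\<zero>\<^bsub>Q\<^esub>, X}" using rel(1) by simp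
  note closed = \<kappa>.three_term_closed[OF xy this rel(2)]
  have const_E: "const f \<in> ?E" if "f \<in> carrier (UP k)" for f
    using that
  proof (induction rule: inner.UP.UP_induct)
    case (const a)
    then show ?case
      using closed(1)[OF const] by (simp add: \<kappa>_def UP_const_def)
  next
    case (add f g)
    then show ?case
      using closed(2)[OF add(3,4)] by simp
  next
    case (mult_X f)
    then show ?case
      using closed(3)[OF mult_X(2)] const.hom_mult[OF mult_X(1) inner.UP_X_closed]
      by (simp add: \<xi>_def UP_X_def)
  qed
  have "q \<in> ?E" if "q \<in> carrier Q" for q
    using that
  proof (induction rule: quotient_induct)
    case (const f)
    then show ?case by (rule const_E)
  next
    case (add p q)
    show ?case by (rule closed(2)[OF add(3,4)])
  next
    case (mult_X q)
    show ?case by (rule closed(4)[OF rel(3) mult_X(2)])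
  qed
  then have sub: "carrier Q \<subseteq> ?E" by blast
  note card = \<kappa>.card_three_term[OF fin, of \<xi> X]
  show "finite (carrier Q)"
    using sub card(1) finite_subset by blast
  show "card (carrier Q) \<le> card (carrier k) ^ 3"
    using card_mono[OF card(1) sub] card(2) by linarith
qed

text \<open>The map from the outer polynomial ring evaluates the coefficients at \<open>u\<close> and the outer indeterminate
at \<open>v\<close>.\<close>

lemma iso_square_zero_ideal:
  assumes hom: "ring_hom_cring k A h" and uv: "u \<in> carrier A" "v \<in> carrier A"
    and rel: "u \<otimes>\<^bsub>A\<^esub> u = \<zero>\<^bsub>A\<^esub>" "u \<otimes>\<^bsub>A\<^esub> v = \<zero>\<^bsub>A\<^esub>" "v \<otimes>\<^bsub>A\<^esub> v = \<zero>\<^bsub>A\<^esub>"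
    and gen: "ring_generated_by A (h ` carrier k \<union> {u, v})"
    and fin: "finite (carrier A)" "finite (carrier Q)" and card: "card (carrier Q) \<le> card (carrier A)"
  shows "A \<simeq> Q"
proof -
  interpret h: ring_hom_cring k A h by (rule hom)
  define e where "e = eval k A h u"
  have e: "ring_hom_cring (UP k) A e" "e (UP_X k) = u" "\<And>a. a \<in> carrier k \<Longrightarrow> e (UP_const k a) = h a"
    unfolding e_def using inner.eval_hom[OF hom uv(1)] by blast+
  have "h a \<in> e ` carrier (UP k)" if "a \<in> carrier k" for a
    using e(3)[OF that] inner.UP_const_closed[OF that] by (metis image_eqI)
  moreover have "u \<in> e ` carrier (UP k)"
    using e(2) inner.UP_X_closed by blast
  ultimately have "h ` carrier k \<union> {u, v} \<subseteq> e ` carrier (UP k) \<union> {v}"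
    by blast
  note gen' = ring_generated_by_mono[OF gen this]
  show ?thesis
  proof (rule ring_isoI[OF e(1) uv(2) _ gen' fin card])
    fix \<phi> assume "ring_hom_cring P A \<phi>" "\<phi> y = v"
      and const: "\<And>f. f \<in> carrier (UP k) \<Longrightarrow> \<phi> (UP_const (UP k) f) = e f"
    then interpret \<phi>: ring_hom_cring P A \<phi> by blast
    have "\<phi> x = u" using const[OF inner.UP_X_closed] e(2) by simp
    then show "\<forall>s\<in>{x [^]\<^bsub>P\<^esub> (2::nat), x \<otimes>\<^bsub>P\<^esub> y, y [^]\<^bsub>P\<^esub> (2::nat)}. \<phi> s = \<zero>\<^bsub>A\<^esub>"
      using \<open>\<phi> y = v\<close> uv rel by (simp add: h.S.nat_pow_2)
  qed
qed

end

lemma Z2_two_variable: "two_variable_polynomials (residue_ring 2)"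
  unfolding two_variable_polynomials_def by (rule residue_ring_cring) simp

lemma card_Z2xy_x2_xy_y2: "finite (carrier Z2xy_x2_xy_y2)" "card (carrier Z2xy_x2_xy_y2) \<le> 8"
  using two_variable_polynomials.card_square_zero_ideal[OF Z2_two_variable]
  unfolding Z2xy_x2_xy_y2_def Let_def by (simp_all add: carrier_residue_ring)

lemma (in cring) iso_Z2xy_x2_xy_y2:
  assumes "\<one> \<oplus> \<one> = \<zero>" "u \<in> carrier R" "v \<in> carrier R" "u \<otimes> u = \<zero>" "u \<otimes> v = \<zero>" "v \<otimes> v = \<zero>"
    and gen: "ring_generated_by R {\<zero>, \<one>, u, v}"
    and fin: "finite (carrier R)" "8 \<le> card (carrier R)"
  shows "R \<simeq> Z2xy_x2_xy_y2"
proof -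
  have hom: "ring_hom_cring (residue_ring 2) R (\<lambda>k::int. [k] \<cdot> \<one>)"
    using assms(1) by (intro residue_ring_hom) (simp_all add: add_pow_small)
  interpret h: ring_hom_cring "residue_ring 2" R "\<lambda>k::int. [k] \<cdot> \<one>" by (rule hom)
  have "\<zero> \<in> (\<lambda>k::int. [k] \<cdot> \<one>) ` carrier (residue_ring 2)"
    "\<one> \<in> (\<lambda>k::int. [k] \<cdot> \<one>) ` carrier (residue_ring 2)"
    using h.hom_zero h.hom_one h.R.zero_closed h.R.one_closed by (metis image_eqI)+
  then have "{\<zero>, \<one>, u, v} \<subseteq> (\<lambda>k::int. [k] \<cdot> \<one>) ` carrier (residue_ring 2) \<union> {u, v}"
    by blast
  note gen' = ring_generated_by_mono[OF gen this]
  note iso = two_variable_polynomials.iso_square_zero_ideal[OF Z2_two_variable hom assms(2-6) gen' fin(1)]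
  show ?thesis
    using iso card_Z2xy_x2_xy_y2 fin(2) unfolding Z2xy_x2_xy_y2_def Let_def by simp
qed

section \<open>Classification by the size of the maximal ideal\<close>

text \<open>Lagrange's theorem in the factor group.\<close>

lemma (in normal) pow_index_in_subgroup:
  assumes "x \<in> carrier G"
  shows "x [^] card (rcosets H) \<in> H"
proof -
  interpret Q: group "G Mod H" by (rule factorgroup_is_group)
  interpret proj: group_hom G "G Mod H" "\<lambda>a. H #> a"
    using r_coset_hom_Mod by unfold_locales
  have "(H #> x) [^]\<^bsub>G Mod H\<^esub> card (rcosets H) = \<one>\<^bsub>G Mod H\<^esub>"
    using Q.pow_order_eq_1[OF proj.hom_closed[OF assms]] by (simp add: order_def FactGroup_def)
  then have "H #> (x [^] card (rcosets H)) = H"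
    using proj.hom_nat_pow[OF assms] by (simp add: FactGroup_def)
  then show ?thesis
    using coset_join1 subgroup_axioms assms by blast
qed

lemma (in group) pow_card_subgroup:
  assumes "subgroup H G" "x \<in> H"
  shows "x [^] card H = \<one>"
proof -
  interpret H: group "G\<lparr>carrier := H\<rparr>"
    using assms(1) by (rule subgroup_imp_group)
  show ?thesis
    using H.pow_order_eq_1[of x] assms(2) nat_pow_consistent[of x _ H] by (simp add: order_def)
qed

context finite_local_ring
begin

text \<open>The number \<open>q\<close> is the cardinality of the residue field.\<close>

lemma nonunits_index:
  obtains q :: nat where "q * card \<mm> = card (carrier R)" "[q] \<cdot> \<one> \<in> \<mm>"
proof -
  have sub: "subgroup \<mm> (add_monoid R)" by (rule mm.a_subgroup)
  have "normal \<mm> (add_monoid R)"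
    using add.subgroup_imp_normal[OF sub] .
  from normal.pow_index_in_subgroup[OF this, of \<one>]
  have "[card (rcosets\<^bsub>add_monoid R\<^esub> \<mm>)] \<cdot> \<one> \<in> \<mm>"
    by (simp add: add_pow_def)
  moreover have "card (rcosets\<^bsub>add_monoid R\<^esub> \<mm>) * card \<mm> = card (carrier R)"
    using add.lagrange[OF sub] by (simp add: order_def)
  ultimately show ?thesis using that by blast
qed

lemma card_nonunits_mult:
  assumes "z \<in> \<mm>" shows "[card \<mm>] \<cdot> z = \<zero>"
  using add.pow_card_subgroup[OF mm.a_subgroup assms] by (simp add: add_pow_def)

text \<open>The integer \<open>|\<mm>|\<close> kills the nonzero elements of \<open>\<mm>\<close> and therefore is not a unit.\<close>

lemma card_nonunits_mult_one:
  assumes "\<mm> \<noteq> {\<zero>}" shows "[card \<mm>] \<cdot> \<one> \<in> \<mm>"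
proof -
  obtain z where z: "z \<in> \<mm>" "z \<noteq> \<zero>"
    using assms nonunits_closed(6) by blast
  have "z \<otimes> [card \<mm>] \<cdot> \<one> = [card \<mm>] \<cdot> z"
    using z by (simp add: add_pow_rdistr)
  then have "z \<otimes> [card \<mm>] \<cdot> \<one> = \<zero>"
    using card_nonunits_mult[OF z(1)] by simp
  then show ?thesis
    using unit_cancel[of z "[card \<mm>] \<cdot> \<one>"] z by (metis DiffD1 add.nat_pow_closed one_closed)
qed

lemma nonunits_prime:
  assumes "a \<in> carrier R" "b \<in> carrier R" "a \<notin> \<mm>" "b \<notin> \<mm>"
  shows "a \<otimes> b \<notin> \<mm>"
  using assms Units_m_closed by blast

lemma minus_add_cancel_right:
  "a \<in> carrier R \<Longrightarrow> b \<in> carrier R \<Longrightarrow> (a \<ominus> b) \<oplus> b = a"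
  by (simp add: a_minus_def a_assoc l_neg)

lemma nonunit_minus_commute:
  assumes "a \<in> carrier R" "b \<in> carrier R" "a \<ominus> b \<in> \<mm>" shows "b \<ominus> a \<in> \<mm>"
proof -
  have "b \<ominus> a = \<ominus> (a \<ominus> b)"
    using assms(1,2) by algebra
  then show ?thesis using nonunits_closed(2)[OF assms(3)] by simp
qed

text \<open>The elements of \<open>T\<close> have distinct residue classes. If \<open>n\<close> is the order of the residue field, \<open>T\<close> is
a system of representatives, by which residue classes are counted inside the ring itself.\<close>

definition incongruent :: "nat \<Rightarrow> 'a set \<Rightarrow> bool" where
  "incongruent n T \<longleftrightarrow> T \<subseteq> carrier R \<and> finite T \<and> card T = n \<and>
     (\<forall>s\<in>T. \<forall>t\<in>T. s \<noteq> t \<longrightarrow> s \<ominus> t \<notin> \<mm>)"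

lemma incongruent_card: "incongruent n T \<Longrightarrow> n * card \<mm> \<le> card (carrier R)"
  using card_mult_nonunits_le[of T] unfolding incongruent_def by blast

lemma incongruent_insert:
  assumes T: "incongruent n T" and a: "a \<in> carrier R" "\<And>t. t \<in> T \<Longrightarrow> a \<ominus> t \<notin> \<mm>"
  shows "incongruent (Suc n) (insert a T)"
proof -
  have "a \<notin> T"
    using a(2)[of a] a(1) nonunits_closed(6) by (auto simp: a_minus_def r_neg)
  moreover have "t \<ominus> a \<notin> \<mm>" if "t \<in> T" for t
  proof -
    have "t \<in> carrier R" using T that unfolding incongruent_def by blast
    then show ?thesis
      using nonunit_minus_commute[of t a] a(2)[OF that] a(1) by blast
  qed
  moreover have "T \<subseteq> carrier R" "finite T" "card T = n"
    "\<And>s t. s \<in> T \<Longrightarrow> t \<in> T \<Longrightarrow> s \<noteq> t \<Longrightarrow> s \<ominus> t \<notin> \<mm>"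
    using T unfolding incongruent_def by blast+
  ultimately have "insert a T \<subseteq> carrier R" "finite (insert a T)" "card (insert a T) = Suc n"
    "\<And>s t. s \<in> insert a T \<Longrightarrow> t \<in> insert a T \<Longrightarrow> s \<noteq> t \<Longrightarrow> s \<ominus> t \<notin> \<mm>"
    using a by (blast, simp, simp, blast)
  then show ?thesis
    unfolding incongruent_def by blast
qed

lemma minus_zero_right: "a \<in> carrier R \<Longrightarrow> a \<ominus> \<zero> = a"
  by (simp add: a_minus_def)

lemma incongruent_0_1: "incongruent 2 {\<one>, \<zero>}"
proof -
  have "incongruent 0 {}" unfolding incongruent_def by simp
  from incongruent_insert[OF this zero_closed] have "incongruent (Suc 0) {\<zero>}" by blast
  from incongruent_insert[OF this one_closed] show ?thesis
    using one_notin_nonunits minus_zero_right[OF one_closed] by (simp add: numeral_2_eq_2)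
qed

lemma congruent_if_index:
  assumes T: "incongruent n T" and card: "card (carrier R) = n * card \<mm>" and a: "a \<in> carrier R"
  shows "\<exists>t\<in>T. a \<ominus> t \<in> \<mm>"
proof (rule ccontr)
  assume "\<not> ?thesis"
  then have "incongruent (Suc n) (insert a T)"
    using incongruent_insert[OF T a] by blast
  from incongruent_card[OF this] have "Suc n * card \<mm> \<le> n * card \<mm>"
    using card by simp
  moreover have "card \<mm> > 0"
    using nonunits_closed(6) finite_nonunits card_gt_0_iff by blast
  ultimately show False by simp
qed

lemma index_generates:
  assumes T: "incongruent n T" and card: "card (carrier R) = n * card \<mm>"
    and B: "T \<subseteq> B" "\<mm> \<subseteq> B" "\<And>u v. u \<in> B \<Longrightarrow> v \<in> B \<Longrightarrow> u \<oplus> v \<in> B"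
  shows "carrier R \<subseteq> B"
proof
  fix a assume a: "a \<in> carrier R"
  then obtain t where t: "t \<in> T" "a \<ominus> t \<in> \<mm>"
    using congruent_if_index[OF T card] by blast
  then have "t \<in> carrier R" using T unfolding incongruent_def by blast
  then have "a = (a \<ominus> t) \<oplus> t"
    using minus_add_cancel_right a by simp
  then show "a \<in> B"
    using B t by (metis subsetD)
qed

text \<open>The bound \<open>|A| \<le> |\<mm>| |ann z|\<close> leaves no room for \<open>ann z\<close> to be smaller than \<open>\<mm>\<close>.\<close>

lemma nonunits_mult_zero:
  assumes card: "card (carrier R) = card \<mm> * card \<mm>" and "z \<in> \<mm>" "w \<in> \<mm>"
  shows "z \<otimes> w = \<zero>"
proof (cases "z = \<zero>")
  case False
  have sub: "annihilator R z \<subseteq> \<mm>"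
    using annihilator_subset_nonunits False assms(2) by blast
  have "card \<mm> * card \<mm> \<le> card \<mm> * card (annihilator R z)"
    using card_le_nonunits_mult_annihilator[OF assms(2)] card by simp
  moreover have "card \<mm> > 0"
    using nonunits_closed(6) finite_nonunits card_gt_0_iff by blast
  ultimately have "card \<mm> \<le> card (annihilator R z)" by simp
  then have "annihilator R z = \<mm>"
    using card_seteq[OF finite_nonunits sub] by blast
  then show ?thesis
    using assms(3) unfolding annihilator_def by blast
qed (use assms in simp)

text \<open>Let \<open>q\<close> be the order of the residue field. Then \<open>2 \<le> q \<le> |\<mm>|\<close>, and \<open>q + 1 \<noteq> |\<mm>|\<close> because
\<open>q\<close> and \<open>|\<mm>|\<close>, read as multiples of 1, are both nonunits.\<close>

lemma index_cases:
  assumes "\<mm> \<noteq> {\<zero>}" and le: "card \<mm> \<le> 4"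
  obtains "card \<mm> = 2" "card (carrier R) = 2 * 2"
  | "card \<mm> = 3" "card (carrier R) = 3 * 3"
  | "card \<mm> = 4" "card (carrier R) = 2 * 4"
  | "card \<mm> = 4" "card (carrier R) = 4 * 4"
proof -
  obtain q :: nat where q: "q * card \<mm> = card (carrier R)" "[q] \<cdot> \<one> \<in> \<mm>"
    by (rule nonunits_index)
  obtain z where z: "z \<in> \<mm>" "z \<noteq> \<zero>"
    using assms nonunits_closed(6) by blast
  have "card {\<zero>, z} \<le> card \<mm>"
    using z nonunits_closed(6) finite_nonunits by (intro card_mono) auto
  then have M2: "card \<mm> \<ge> 2" using z by simp
  have "2 * card \<mm> \<le> q * card \<mm>"
    using incongruent_card[OF incongruent_0_1] q(1) by simp
  then have q2: "2 \<le> q" using M2 by simp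
  have "card (annihilator R z) \<le> card \<mm>"
    using annihilator_subset_nonunits[of z] z finite_nonunits by (intro card_mono) auto
  then have "q * card \<mm> \<le> card \<mm> * card \<mm>"
    using card_le_nonunits_mult_annihilator[OF z(1)] q(1) by (metis mult_le_mono2 order_trans)
  then have qM: "q \<le> card \<mm>" using M2 by simp
  have "Suc q \<noteq> card \<mm>"
  proof
    assume "Suc q = card \<mm>"
    then have "[q] \<cdot> \<one> \<oplus> \<one> \<in> \<mm>"
      using card_nonunits_mult_one[OF assms(1)] by (metis add.nat_pow_Suc)
    then have "([q] \<cdot> \<one> \<oplus> \<one>) \<ominus> [q] \<cdot> \<one> \<in> \<mm>"
      using q(2) nonunits_closed(3) by blast
    moreover have "([q] \<cdot> \<one> \<oplus> \<one>) \<ominus> [q] \<cdot> \<one> = \<one>"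
    proof -
      have "[q] \<cdot> \<one> \<in> carrier R" by simp
      then show ?thesis by algebra
    qed
    ultimately show False by simp
  qed
  then have "q = 2 \<and> card \<mm> = 2 \<or> q = 3 \<and> card \<mm> = 3 \<or> q = 2 \<and> card \<mm> = 4 \<or> q = 4 \<and> card \<mm> = 4"
    using q2 qM M2 le by presburger
  then show ?thesis
    using q(1) that by auto
qed

lemma two_nonunit:
  assumes "card (carrier R) = 2 * card \<mm>" shows "\<one> \<oplus> \<one> \<in> \<mm>"
proof -
  have "\<exists>t\<in>{\<one>, \<zero>}. (\<one> \<oplus> \<one>) \<ominus> t \<in> \<mm>"
    using assms by (intro congruent_if_index[OF incongruent_0_1]) simp_all
  moreover have "(\<one> \<oplus> \<one>) \<ominus> \<one> = \<one>" by algebra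
  ultimately show ?thesis
    using minus_zero_right[of "\<one> \<oplus> \<one>"] one_notin_nonunits by auto
qed

lemma ring_generated_by_index:
  assumes "incongruent n T" "card (carrier R) = n * card \<mm>"
    and "\<And>B. G \<subseteq> B \<Longrightarrow> (\<And>u v. u \<in> B \<Longrightarrow> v \<in> B \<Longrightarrow> u \<oplus> v \<in> B) \<Longrightarrow>
      (\<And>u v. u \<in> B \<Longrightarrow> v \<in> B \<Longrightarrow> u \<otimes> v \<in> B) \<Longrightarrow> T \<subseteq> B \<and> \<mm> \<subseteq> B"
  shows "ring_generated_by R G"
  unfolding ring_generated_by_def
proof (intro allI impI)
  fix B assume "G \<subseteq> B" "\<forall>u\<in>B. \<forall>v\<in>B. u \<oplus> v \<in> B \<and> u \<otimes> v \<in> B"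
  then show "carrier R \<subseteq> B"
    using index_generates[OF assms(1,2), of B] assms(3)[of B] by blast
qed

lemma four_nonunits:
  assumes "card \<mm> = 4" "x \<in> \<mm>" "y \<in> \<mm>" "x \<noteq> \<zero>" "y \<noteq> \<zero>" "x \<noteq> y" "x \<oplus> y \<noteq> \<zero>"
  shows "\<mm> = {\<zero>, x, y, x \<oplus> y}"
proof -
  have c: "x \<in> carrier R" "y \<in> carrier R" using assms by auto
  have "x \<oplus> y \<noteq> x" "x \<oplus> y \<noteq> y"
    using c assms(4,5) by simp_all
  then have "card {\<zero>, x, y, x \<oplus> y} = 4"
    using assms(4-7) by (simp add: card_insert_if eq_commute[of \<zero>] eq_commute[of x "x \<oplus> y"] eq_commute[of y "x \<oplus> y"])
  moreover have "{\<zero>, x, y, x \<oplus> y} \<subseteq> \<mm>"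
    using assms nonunits_closed(1)[OF assms(2,3)] nonunits_closed(6) by blast
  ultimately show ?thesis
    using card_subset_eq[OF finite_nonunits] assms(1) by metis
qed

text \<open>Either 2 is the nonzero nonunit, or the characteristic is 2 and the nonzero nonunit has square
zero.\<close>

lemma classification_2:
  assumes M: "card \<mm> = 2" and card: "card (carrier R) = 4"
  shows "R \<simeq> residue_ring 4 \<or> R \<simeq> Z2x_x2"
proof -
  have card': "card (carrier R) = 2 * card \<mm>" "card (carrier R) = card \<mm> * card \<mm>"
    using assms by simp_all
  have two: "\<one> \<oplus> \<one> \<in> \<mm>" by (rule two_nonunit[OF card'(1)])
  have zero: "\<zero> \<in> \<mm>" by (rule nonunits_closed)
  obtain z where z: "\<mm> = {\<zero>, z}" "z \<noteq> \<zero>"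
    using M zero unfolding card_2_iff by (metis doubleton_eq_iff insertE singletonD)
  then have zm: "z \<in> \<mm>" by simp
  show ?thesis
  proof (cases "\<one> \<oplus> \<one> = \<zero>")
    case True
    have "R \<simeq> Z2x_x2"
    proof (rule iso_Z2x_x2[OF True _ nonunits_mult_zero[OF card'(2) zm zm]])
      show "ring_generated_by R {\<zero>, \<one>, z}"
        using z by (intro ring_generated_by_index[OF incongruent_0_1 card'(1)]) auto
    qed (use zm card finite_carrier in auto)
    then show ?thesis ..
  next
    case False
    have "R \<simeq> residue_ring 4"
    proof (rule iso_residue_ring_if_generated)
      show "[(4::int)] \<cdot> \<one> = \<zero>"
        unfolding add_pow_4_one using nonunits_mult_zero[OF card'(2) two two] .
      show "carrier R \<subseteq> B" if B: "\<zero> \<in> B" "\<one> \<in> B" "\<And>u v. u \<in> B \<Longrightarrow> v \<in> B \<Longrightarrow> u \<oplus> v \<in> B" for B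
      proof (rule index_generates[OF incongruent_0_1 card'(1) _ _ B(3)])
        have "z = \<one> \<oplus> \<one>" using two z(1) False by blast
        then show "\<mm> \<subseteq> B" using z(1) B(1) B(3)[OF B(2,2)] by simp
      qed (use B in auto)
    qed (use card finite_carrier in auto)
    then show ?thesis ..
  qed
qed

text \<open>As before with 3 in place of 2; the nonunits are \<open>0, z, 2 z\<close>.\<close>

lemma classification_3:
  assumes M: "card \<mm> = 3" and card: "card (carrier R) = 9"
  shows "R \<simeq> residue_ring 9 \<or> R \<simeq> Z3x_x2"
proof -
  have card': "card (carrier R) = 3 * card \<mm>" "card (carrier R) = card \<mm> * card \<mm>"
    using assms by simp_all
  have zero: "\<zero> \<in> \<mm>" by (rule nonunits_closed)
  have triple: "z \<oplus> z \<oplus> z = \<zero>" if "z \<in> \<mm>" for z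
    using card_nonunits_mult[OF that] that by (simp add: M numeral_3_eq_3)
  have mm: "\<mm> = {\<zero>, z, z \<oplus> z}" if z: "z \<in> \<mm>" "z \<noteq> \<zero>" for z
  proof -
    have zc: "z \<in> carrier R" using z by blast
    have "z \<oplus> z \<noteq> \<zero>"
      using triple[OF z(1)] z(2) zc by (metis l_zero)
    moreover have "z \<oplus> z \<noteq> z"
      using zc z(2) by simp
    ultimately have "card {\<zero>, z, z \<oplus> z} = 3"
      using z(2) by (simp add: card_insert_if eq_commute[of \<zero>] eq_commute[of z "z \<oplus> z"])
    moreover have "{\<zero>, z, z \<oplus> z} \<subseteq> \<mm>"
      using z(1) nonunits_closed(1)[OF z(1) z(1)] zero by blast
    ultimately show ?thesis
      using card_subset_eq[OF finite_nonunits] M by metis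
  qed
  have "\<mm> \<noteq> {\<zero>}"
  proof
    assume "\<mm> = {\<zero>}"
    then have "card \<mm> = card {\<zero>}" by (rule arg_cong)
    then show False using M by simp
  qed
  then obtain z where z: "z \<in> \<mm>" "z \<noteq> \<zero>"
    using zero by blast
  define three where "three = \<one> \<oplus> \<one> \<oplus> \<one>"
  have three: "three \<in> \<mm>"
    using card_nonunits_mult_one[OF \<open>\<mm> \<noteq> {\<zero>}\<close>] by (simp add: M numeral_3_eq_3 three_def)
  have two: "\<one> \<oplus> \<one> \<notin> \<mm>"
  proof
    assume "\<one> \<oplus> \<one> \<in> \<mm>"
    then have "three \<ominus> (\<one> \<oplus> \<one>) \<in> \<mm>" using three nonunits_closed(3) by blast
    moreover have "three \<ominus> (\<one> \<oplus> \<one>) = \<one>" unfolding three_def by algebra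
    ultimately show False by simp
  qed
  have T: "incongruent 3 {\<one> \<oplus> \<one>, \<one>, \<zero>}"
  proof -
    have "(\<one> \<oplus> \<one>) \<ominus> t \<notin> \<mm>" if "t \<in> {\<one>, \<zero>}" for t
    proof -
      have "(\<one> \<oplus> \<one>) \<ominus> \<one> = \<one>" by algebra
      then show ?thesis
        using that two one_notin_nonunits minus_zero_right[of "\<one> \<oplus> \<one>"] by auto
    qed
    from incongruent_insert[OF incongruent_0_1 _ this] show ?thesis
      by (simp add: numeral_3_eq_3 numeral_2_eq_2)
  qed
  show ?thesis
  proof (cases "three = \<zero>")
    case True
    have "R \<simeq> Z3x_x2"
    proof (rule iso_Z3x_x2[OF True[unfolded three_def] _ nonunits_mult_zero[OF card'(2) z(1) z(1)]])
      show "ring_generated_by R {\<zero>, \<one>, z}"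
        using mm[OF z] by (intro ring_generated_by_index[OF T card'(1)]) auto
    qed (use z card finite_carrier in auto)
    then show ?thesis ..
  next
    case False
    have "R \<simeq> residue_ring 9"
    proof (rule iso_residue_ring_if_generated)
      have "[(3 * 3 :: int)] \<cdot> \<one> = three \<otimes> three"
        unfolding add_pow_mult_one add_pow_small(3)[OF one_closed] three_def ..
      then show "[(9::int)] \<cdot> \<one> = \<zero>"
        using nonunits_mult_zero[OF card'(2) three three] by simp
      show "carrier R \<subseteq> B" if B: "\<zero> \<in> B" "\<one> \<in> B" "\<And>u v. u \<in> B \<Longrightarrow> v \<in> B \<Longrightarrow> u \<oplus> v \<in> B" for B
      proof (rule index_generates[OF T card'(1) _ _ B(3)])
        have 3: "three \<in> B" using B unfolding three_def by blast
        then show "\<mm> \<subseteq> B"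
          using B(1) B(3)[OF 3 3] by (subst mm[OF three False]) simp
      qed (use B in auto)
    qed (use card finite_carrier in auto)
    then show ?thesis ..
  qed
qed

lemma another_nonunit:
  assumes "card \<mm> = 4" obtains x where "x \<in> \<mm>" "x \<noteq> \<zero>" "x \<noteq> y"
proof -
  have "\<not> \<mm> \<subseteq> {\<zero>, y}"
  proof
    assume "\<mm> \<subseteq> {\<zero>, y}"
    then have "card \<mm> \<le> card {\<zero>, y}" by (intro card_mono) simp_all
    also have "\<dots> \<le> 2" by (simp add: card_insert_if)
    finally show False using assms by simp
  qed
  then show ?thesis using that by blast
qed

lemma card_carrier_mult_one: "[int (card (carrier R))] \<cdot> \<one> = \<zero>"
  using add.pow_order_eq_1[of \<one>] by (simp add: add_pow_def int_pow_int order_def)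

lemma mult_nonunit_neq:
  assumes "x \<in> \<mm>" "m \<in> \<mm>" "x \<noteq> \<zero>" shows "x \<otimes> m \<noteq> x" "m \<otimes> x \<noteq> x"
  using fixed_by_nonunit[of x m] assms m_comm[of x m] by auto

text \<open>If \<open>4 \<noteq> 0\<close>, all nonunits are multiples of 2. If \<open>4 = 0 \<noteq> 2\<close>, a further nonunit \<open>x\<close> satisfies
\<open>2 x = 0\<close>, and \<open>x\<^sup>2\<close> is \<open>0\<close> or \<open>2\<close>. If \<open>2 = 0\<close>, either some nonunit has nonzero square and its
powers span \<open>\<mm>\<close>, or all products of nonunits vanish. In each case the remaining values of the
products are impossible since no nonzero \<open>x\<close> is of the form \<open>x m\<close> with \<open>m \<in> \<mm>\<close>.\<close>

lemma classification_4_index_2: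
  assumes M: "card \<mm> = 4" and card: "card (carrier R) = 8"
  shows "R \<simeq> residue_ring 8 \<or> R \<simeq> Z2x_x3 \<or> R \<simeq> Z4x_x3_x2m2 \<or> R \<simeq> Z4x_2x_x2 \<or> R \<simeq> Z2xy_x2_xy_y2"
proof -
  have card': "card (carrier R) = 2 * card \<mm>"
    using assms by simp
  define two where "two = \<one> \<oplus> \<one>"
  have two: "two \<in> \<mm>" unfolding two_def by (rule two_nonunit[OF card'])
  have twoc: "two \<in> carrier R" using two by blast
  have two_mult: "two \<otimes> x = x \<oplus> x" if "x \<in> carrier R" for x
    using that by (simp add: two_def l_distr)
  note gen = ring_generated_by_index[OF incongruent_0_1 card']
  have fin: "finite (carrier R)" "8 \<le> card (carrier R)"
    using card finite_carrier by simp_all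
  consider (char8) "two \<otimes> two \<noteq> \<zero>" | (char4) "two \<otimes> two = \<zero>" "two \<noteq> \<zero>" | (char2) "two = \<zero>"
    by blast
  then show ?thesis
  proof cases
    case char8
    then have two_nz: "two \<noteq> \<zero>" using twoc by auto
    \<comment> \<open>Otherwise \<open>2 (-2) = 2\<close> with \<open>-2\<close> a nonunit.\<close>
    have "two \<oplus> two \<otimes> two \<noteq> \<zero>"
    proof
      assume "two \<oplus> two \<otimes> two = \<zero>"
      then have "\<ominus> (two \<otimes> two) = two"
        using twoc by (intro minus_equality) simp_all
      then have "two \<otimes> (\<ominus> two) = two"
        using twoc by (simp add: r_minus)
      then show False
        using mult_nonunit_neq(1)[OF two nonunits_closed(2)[OF two] two_nz] by blast
    qed
    then have mm: "\<mm> = {\<zero>, two, two \<otimes> two, two \<oplus> two \<otimes> two}"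
      using four_nonunits[OF M two nonunits_closed(4)[OF two twoc] two_nz char8]
        mult_nonunit_neq(1)[OF two two two_nz] by metis
    have "R \<simeq> residue_ring 8"
    proof (rule iso_residue_ring_if_generated)
      show "[(8::int)] \<cdot> \<one> = \<zero>"
        using card_carrier_mult_one card by simp
      show "carrier R \<subseteq> B" if B: "\<zero> \<in> B" "\<one> \<in> B" "\<And>u v. u \<in> B \<Longrightarrow> v \<in> B \<Longrightarrow> u \<oplus> v \<in> B" for B
      proof (rule index_generates[OF incongruent_0_1 card' _ _ B(3)])
        have 2: "two \<in> B" using B unfolding two_def by blast
        have 4: "two \<otimes> two \<in> B" using B(3)[OF 2 2] two_mult[OF twoc] by simp
        show "\<mm> \<subseteq> B" using B(1) 2 4 B(3)[OF 2 4] by (subst mm) blast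
      qed (use B in auto)
    qed (use card finite_carrier in auto)
    then show ?thesis by blast
  next
    case char4
    obtain x where x: "x \<in> \<mm>" "x \<noteq> \<zero>" "x \<noteq> two"
      using another_nonunit[OF M] by blast
    have xc: "x \<in> carrier R" using x by blast
    have sum: "x \<oplus> two \<noteq> \<zero>"
    proof
      assume "x \<oplus> two = \<zero>"
      then have "x \<oplus> two = two \<oplus> two" using char4 two_mult[OF twoc] by simp
      then show False using x(3) xc twoc by simp
    qed
    have mm: "\<mm> = {\<zero>, x, two, x \<oplus> two}"
      using four_nonunits[OF M x(1) two x(2) char4(2) x(3) sum] .
    have "two \<otimes> x \<noteq> x \<oplus> two"
      unfolding two_mult[OF xc] using x(3) xc twoc by simp
    moreover have "two \<otimes> x \<in> {\<zero>, x, two, x \<oplus> two}"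
      using nonunits_closed(4)[OF two xc] mm by blast
    ultimately have kill: "two \<otimes> x = \<zero>"
      using mult_nonunit_neq[OF x(1) two x(2)] mult_nonunit_neq[OF two x(1) char4(2)] by blast
    have "x \<otimes> x \<noteq> x \<oplus> two"
    proof
      assume xx: "x \<otimes> x = x \<oplus> two"
      have "x \<otimes> x \<otimes> x = (x \<oplus> two) \<otimes> x" by (simp only: xx)
      also have "\<dots> = x \<otimes> x" using xc twoc kill by (simp add: l_distr)
      finally have "x \<otimes> x = \<zero>"
        using fixed_by_nonunit[OF m_closed[OF xc xc] x(1)] by blast
      then show False using xx sum by simp
    qed
    moreover have "x \<otimes> x \<in> {\<zero>, x, two, x \<oplus> two}"
      using nonunits_closed(4)[OF x(1) xc] mm by blast
    ultimately have sq: "x \<otimes> x = \<zero> \<or> x \<otimes> x = two"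
      using mult_nonunit_neq(1)[OF x(1) x(1) x(2)] by blast
    have generated: "ring_generated_by R {\<zero>, \<one>, x}"
    proof (rule gen)
      fix B assume B: "{\<zero>, \<one>, x} \<subseteq> B" "\<And>u v. u \<in> B \<Longrightarrow> v \<in> B \<Longrightarrow> u \<oplus> v \<in> B"
      then have "two \<in> B" unfolding two_def by blast
      then show "{\<one>, \<zero>} \<subseteq> B \<and> \<mm> \<subseteq> B" using B mm by simp
    qed
    from sq show ?thesis
    proof
      assume "x \<otimes> x = \<zero>"
      then have "R \<simeq> Z4x_2x_x2"
        using char4(1) kill unfolding two_def by (intro iso_Z4x_2x_x2[OF _ xc _ _ generated fin])
      then show ?thesis by blast
    next
      assume "x \<otimes> x = two"
      then have "R \<simeq> Z4x_x3_x2m2"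
        using char4(1) kill unfolding two_def by (intro iso_Z4x_x3_x2m2[OF _ xc _ _ generated fin]) simp_all
      then show ?thesis by blast
    qed
  next
    case char2
    have double: "x \<oplus> x = \<zero>" if "x \<in> carrier R" for x
      using two_mult[OF that] char2 that by simp
    have sum_nz: "x \<oplus> y \<noteq> \<zero>" if "x \<in> carrier R" "y \<in> carrier R" "x \<noteq> y" for x y
      using double[OF that(2)] that by (metis add.right_cancel)
    have 2: "\<one> \<oplus> \<one> = \<zero>" using char2 unfolding two_def .
    show ?thesis
    proof (cases "\<exists>x\<in>\<mm>. x \<otimes> x \<noteq> \<zero>")
      case True
      then obtain x where x: "x \<in> \<mm>" "x \<otimes> x \<noteq> \<zero>" by blast
      then have xc: "x \<in> carrier R" and x0: "x \<noteq> \<zero>" by auto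
      have sq: "x \<otimes> x \<in> \<mm>" using nonunits_closed(4)[OF x(1) xc] .
      have ne: "x \<noteq> x \<otimes> x"
        using mult_nonunit_neq(1)[OF x(1) x(1) x0] by metis
      have mm: "\<mm> = {\<zero>, x, x \<otimes> x, x \<oplus> x \<otimes> x}"
        using four_nonunits[OF M x(1) sq x0 x(2) ne sum_nz[OF xc m_closed[OF xc xc] ne]] .
      have "x \<otimes> x \<otimes> x \<noteq> x"
        using mult_nonunit_neq(2)[OF x(1) sq x0] .
      moreover have "x \<otimes> x \<otimes> x \<noteq> x \<otimes> x"
        using mult_nonunit_neq(1)[OF sq x(1) x(2)] .
      moreover have "x \<otimes> x \<otimes> x \<noteq> x \<oplus> x \<otimes> x"
      proof
        assume cube: "x \<otimes> x \<otimes> x = x \<oplus> x \<otimes> x"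
        have "x \<otimes> (x \<otimes> x \<oplus> x) = x \<otimes> x \<otimes> x \<oplus> x \<otimes> x"
          using xc by (simp add: r_distr m_assoc)
        also have "\<dots> = x \<oplus> (x \<otimes> x \<oplus> x \<otimes> x)"
          unfolding cube using xc by (simp add: a_assoc)
        also have "\<dots> = x"
          using double[of "x \<otimes> x"] xc by simp
        finally show False
          using mult_nonunit_neq(1)[OF x(1) nonunits_closed(1)[OF sq x(1)] x0] by blast
      qed
      moreover have "x \<otimes> x \<otimes> x \<in> {\<zero>, x, x \<otimes> x, x \<oplus> x \<otimes> x}"
        using nonunits_closed(4)[OF sq xc] mm by blast
      ultimately have "x \<otimes> x \<otimes> x = \<zero>" by blast
      moreover have "ring_generated_by R {\<zero>, \<one>, x}"
      proof (rule gen)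
        fix B assume "{\<zero>, \<one>, x} \<subseteq> B" "\<And>u v. u \<in> B \<Longrightarrow> v \<in> B \<Longrightarrow> u \<oplus> v \<in> B"
          "\<And>u v. u \<in> B \<Longrightarrow> v \<in> B \<Longrightarrow> u \<otimes> v \<in> B"
        then show "{\<one>, \<zero>} \<subseteq> B \<and> \<mm> \<subseteq> B" using mm by simp
      qed
      ultimately have "R \<simeq> Z2x_x3"
        using 2 xc fin by (intro iso_Z2x_x3)
      then show ?thesis by blast
    next
      case False
      obtain x where x: "x \<in> \<mm>" "x \<noteq> \<zero>"
        using another_nonunit[OF M] by blast
      obtain y where y: "y \<in> \<mm>" "y \<noteq> \<zero>" "y \<noteq> x"
        using another_nonunit[OF M] by blast
      have c: "x \<in> carrier R" "y \<in> carrier R" and sq: "x \<otimes> x = \<zero>" "y \<otimes> y = \<zero>"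
        using x y False by blast+
      have mm: "\<mm> = {\<zero>, x, y, x \<oplus> y}"
        using four_nonunits[OF M x(1) y(1) x(2) y(2) y(3)[symmetric] sum_nz[OF c y(3)[symmetric]]] .
      have "x \<otimes> y \<noteq> x \<oplus> y"
      proof
        assume xy: "x \<otimes> y = x \<oplus> y"
        have "x \<otimes> y = x \<otimes> (x \<oplus> y)"
          using c sq by (simp add: r_distr)
        also have "\<dots> = x \<otimes> (x \<otimes> y)"
          by (simp only: xy)
        also have "\<dots> = \<zero>"
          using c sq by (simp add: m_assoc[symmetric])
        finally have "x \<otimes> y = \<zero>" .
        then show False
          using xy sum_nz[OF c y(3)[symmetric]] by simp
      qed
      moreover have "x \<otimes> y \<in> {\<zero>, x, y, x \<oplus> y}"
        using nonunits_closed(4)[OF x(1) c(2)] mm by blast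
      ultimately have xy: "x \<otimes> y = \<zero>"
        using mult_nonunit_neq(1)[OF x(1) y(1) x(2)] mult_nonunit_neq(2)[OF y(1) x(1) y(2)] by blast
      have "ring_generated_by R {\<zero>, \<one>, x, y}"
      proof (rule gen)
        fix B assume "{\<zero>, \<one>, x, y} \<subseteq> B" "\<And>u v. u \<in> B \<Longrightarrow> v \<in> B \<Longrightarrow> u \<oplus> v \<in> B"
        then show "{\<one>, \<zero>} \<subseteq> B \<and> \<mm> \<subseteq> B" using mm by simp
      qed
      then have "R \<simeq> Z2xy_x2_xy_y2"
        using 2 c sq xy fin by (intro iso_Z2xy_x2_xy_y2)
      then show ?thesis by blast
    qed
  qed
qed

text \<open>An element whose residue class is neither \<open>0\<close> nor \<open>1\<close> yields the four residue classes
\<open>0, 1, t, t + 1\<close> when the residue field has characteristic 2.\<close>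

lemma incongruent_omega:
  assumes two: "\<one> \<oplus> \<one> \<in> \<mm>" and t: "t \<in> carrier R" "t \<notin> \<mm>" "t \<ominus> \<one> \<notin> \<mm>"
  shows "t \<oplus> \<one> \<notin> \<mm>" "incongruent 4 {t \<oplus> \<one>, t, \<one>, \<zero>}"
proof -
  show t1: "t \<oplus> \<one> \<notin> \<mm>"
  proof
    assume "t \<oplus> \<one> \<in> \<mm>"
    then have "(t \<oplus> \<one>) \<ominus> (\<one> \<oplus> \<one>) \<in> \<mm>"
      using two nonunits_closed(3) by blast
    moreover have "(t \<oplus> \<one>) \<ominus> (\<one> \<oplus> \<one>) = t \<ominus> \<one>"
      using t(1) by algebra
    ultimately show False using t(3) by simp
  qed
  have "t \<ominus> s \<notin> \<mm>" if "s \<in> {\<one>, \<zero>}" for s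
    using that t minus_zero_right[OF t(1)] by auto
  from incongruent_insert[OF incongruent_0_1 t(1) this]
  have 3: "incongruent 3 {t, \<one>, \<zero>}" by (simp add: numeral_3_eq_3 numeral_2_eq_2)
  have "(t \<oplus> \<one>) \<ominus> t = \<one>" "(t \<oplus> \<one>) \<ominus> \<one> = t" "(t \<oplus> \<one>) \<ominus> \<zero> = t \<oplus> \<one>"
    using t(1) by algebra+
  then have "(t \<oplus> \<one>) \<ominus> s \<notin> \<mm>" if "s \<in> {t, \<one>, \<zero>}" for s
    using that t t1 one_notin_nonunits by (elim insertE emptyE; metis)
  from incongruent_insert[OF 3 _ this]
  show "incongruent 4 {t \<oplus> \<one>, t, \<one>, \<zero>}"
    using t(1) by (simp add: numeral_eq_Suc)
qed

text \<open>The residue field has four elements, so any class \<open>a\<close> other than \<open>0\<close> and \<open>1\<close> satisfies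
\<open>a\<^sup>2 = a + 1\<close>; this root is lifted to the ring.\<close>

lemma omega_exists:
  assumes M: "card \<mm> = 4" and card: "card (carrier R) = 16"
  obtains t where "\<one> \<oplus> \<one> \<in> \<mm>" "t \<in> carrier R" "t \<notin> \<mm>" "t \<ominus> \<one> \<notin> \<mm>" "t \<otimes> t \<oplus> t \<oplus> \<one> = \<zero>"
proof -
  have card': "card (carrier R) = 4 * card \<mm>" and "card (carrier R) = card \<mm> * card \<mm>"
    using assms by simp_all
  note mult_zero = nonunits_mult_zero[OF this(2)]
  have "\<mm> \<noteq> {\<zero>}" using another_nonunit[OF M] by blast
  from card_nonunits_mult_one[OF this] have "\<one> \<oplus> \<one> \<oplus> \<one> \<oplus> \<one> \<in> \<mm>"
    unfolding M by (simp add: numeral_eq_Suc)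
  moreover have "\<one> \<oplus> \<one> \<oplus> \<one> \<oplus> \<one> = (\<one> \<oplus> \<one>) \<otimes> (\<one> \<oplus> \<one>)"
    by algebra
  ultimately have two: "\<one> \<oplus> \<one> \<in> \<mm>"
    using nonunits_prime[of "\<one> \<oplus> \<one>" "\<one> \<oplus> \<one>"] by (metis a_closed one_closed)
  obtain a where a: "a \<in> carrier R" "a \<notin> \<mm>" "a \<ominus> \<one> \<notin> \<mm>"
  proof -
    have "\<not> carrier R \<subseteq> \<mm> \<union> (\<lambda>m. m \<oplus> \<one>) ` \<mm>"
    proof
      assume "carrier R \<subseteq> \<mm> \<union> (\<lambda>m. m \<oplus> \<one>) ` \<mm>"
      then have "card (carrier R) \<le> card (\<mm> \<union> (\<lambda>m. m \<oplus> \<one>) ` \<mm>)"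
        using finite_nonunits by (intro card_mono) auto
      also have "\<dots> \<le> card \<mm> + card ((\<lambda>m. m \<oplus> \<one>) ` \<mm>)"
        by (rule card_Un_le)
      also have "\<dots> \<le> card \<mm> + card \<mm>"
        using card_image_le[OF finite_nonunits] by simp
      finally show False using M card by simp
    qed
    then obtain a where "a \<in> carrier R" "a \<notin> \<mm>" "a \<notin> (\<lambda>m. m \<oplus> \<one>) ` \<mm>" by blast
    moreover from this have "a \<ominus> \<one> \<notin> \<mm>"
      using minus_add_cancel_right[of a \<one>] by (metis image_eqI one_closed)
    ultimately show ?thesis using that by blast
  qed
  note T = incongruent_omega[OF two a]
  have a1: "a \<oplus> \<one> \<in> carrier R" "a \<ominus> \<one> \<in> carrier R" using a(1) by simp_all
  have "\<exists>s\<in>{a \<oplus> \<one>, a, \<one>, \<zero>}. a \<otimes> a \<ominus> s \<in> \<mm>"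
    using a(1) by (intro congruent_if_index[OF T(2) card']) simp
  moreover have "a \<otimes> a \<ominus> \<zero> = a \<otimes> a" "a \<otimes> a \<ominus> \<one> = (a \<ominus> \<one>) \<otimes> (a \<oplus> \<one>)"
    "a \<otimes> a \<ominus> a = a \<otimes> (a \<ominus> \<one>)"
    using a(1) by algebra+
  ultimately have "a \<otimes> a \<ominus> (a \<oplus> \<one>) \<in> \<mm>"
    using nonunits_prime[OF a(1,1) a(2,2)] nonunits_prime[OF a1(2,1) a(3) T(1)]
      nonunits_prime[OF a(1) a1(2) a(2,3)] by (elim bexE insertE emptyE; metis)
  then have "(a \<otimes> a \<ominus> (a \<oplus> \<one>)) \<oplus> (\<one> \<oplus> \<one>) \<otimes> (a \<oplus> \<one>) \<in> \<mm>"
    using nonunits_closed(1) nonunits_closed(4)[OF two a1(1)] by blast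
  moreover define u where "u = a \<otimes> a \<oplus> a \<oplus> \<one>"
  moreover have "(a \<otimes> a \<ominus> (a \<oplus> \<one>)) \<oplus> (\<one> \<oplus> \<one>) \<otimes> (a \<oplus> \<one>) = a \<otimes> a \<oplus> a \<oplus> \<one>"
    using a(1) by algebra
  ultimately have u: "u \<in> \<mm>" by (simp only:)
  then have uc: "u \<in> carrier R" by blast
  \<comment> \<open>One Newton step: \<open>a\<close> is a root modulo the maximal ideal, whose square is zero.\<close>
  define t where "t = a \<ominus> u"
  have tc: "t \<in> carrier R" unfolding t_def using a(1) uc by simp
  have "t \<otimes> t \<oplus> t \<oplus> \<one> = (a \<otimes> a \<oplus> a \<oplus> \<one>) \<ominus> u \<ominus> (\<one> \<oplus> \<one>) \<otimes> u \<otimes> a \<oplus> u \<otimes> u"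
    unfolding t_def using a(1) uc by algebra
  also have "\<dots> = u \<ominus> u \<ominus> (\<one> \<oplus> \<one>) \<otimes> u \<otimes> a \<oplus> u \<otimes> u"
    by (simp only: u_def[symmetric])
  also have "\<dots> = \<zero>"
    using mult_zero[OF two u] mult_zero[OF u u] uc a(1) by (simp add: a_minus_def r_neg)
  finally have root: "t \<otimes> t \<oplus> t \<oplus> \<one> = \<zero>" .
  have "t \<oplus> u = a" "(t \<ominus> \<one>) \<oplus> u = a \<ominus> \<one>"
    unfolding t_def using a(1) uc by algebra+
  then have "t \<notin> \<mm>" "t \<ominus> \<one> \<notin> \<mm>"
    using a(2,3) u nonunits_closed(1) by metis+
  then show ?thesis by (rule that[OF two tc _ _ root])
qed

text \<open>For a nonzero \<open>x \<in> \<mm>\<close> the nonunits are \<open>0, x, x t, x + x t\<close>. In characteristic 2 the ring is generated by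
\<open>x\<close> over the field of \<open>0, 1, t, t + 1\<close>; otherwise \<open>x = 2\<close> may be chosen and \<open>t\<close> alone generates
it.\<close>

lemma classification_4_index_4:
  assumes M: "card \<mm> = 4" and card: "card (carrier R) = 16"
  shows "R \<simeq> F4x_x2 \<or> R \<simeq> Z4x_x2px1"
proof -
  have card': "card (carrier R) = 4 * card \<mm>" and "card (carrier R) = card \<mm> * card \<mm>"
    using assms by simp_all
  note mult_zero = nonunits_mult_zero[OF this(2)]
  obtain t where two: "\<one> \<oplus> \<one> \<in> \<mm>" and t: "t \<in> carrier R" "t \<notin> \<mm>" "t \<ominus> \<one> \<notin> \<mm>"
    and root: "t \<otimes> t \<oplus> t \<oplus> \<one> = \<zero>"
    using omega_exists[OF assms] by metis
  note T = incongruent_omega[OF two t]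
  have mm: "\<mm> = {\<zero>, x, x \<otimes> t, x \<oplus> x \<otimes> t}" if x: "x \<in> \<mm>" "x \<noteq> \<zero>" for x
  proof (rule four_nonunits[OF M x(1) nonunits_closed(4)[OF x(1) t(1)] x(2)])
    have xc: "x \<in> carrier R" using x by blast
    show "x \<otimes> t \<noteq> \<zero>"
      using unit_cancel[OF xc t(1,2)] x(2) by blast
    show "x \<noteq> x \<otimes> t"
    proof
      assume eq: "x = x \<otimes> t"
      have "x \<otimes> (t \<ominus> \<one>) = x \<otimes> t \<ominus> x"
        using xc t(1) by algebra
      then have "x \<otimes> (t \<ominus> \<one>) = \<zero>"
        using eq[symmetric] xc by (simp add: a_minus_def r_neg)
      then show False
        using unit_cancel[OF xc _ t(3)] x(2) t(1) by simp
    qed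
    have "x \<oplus> x \<otimes> t = x \<otimes> (t \<oplus> \<one>)"
      using xc t(1) by algebra
    then show "x \<oplus> x \<otimes> t \<noteq> \<zero>"
      using unit_cancel[OF xc _ T(1)] x(2) t(1) by (metis a_closed one_closed)
  qed
  have gen: "ring_generated_by R (insert x {\<zero>, \<one>, t})" if x: "x \<in> \<mm>" "x \<noteq> \<zero>" for x
  proof (rule ring_generated_by_index[OF T(2) card'])
    fix B assume "insert x {\<zero>, \<one>, t} \<subseteq> B" "\<And>u v. u \<in> B \<Longrightarrow> v \<in> B \<Longrightarrow> u \<oplus> v \<in> B"
      "\<And>u v. u \<in> B \<Longrightarrow> v \<in> B \<Longrightarrow> u \<otimes> v \<in> B"
    then show "{t \<oplus> \<one>, t, \<one>, \<zero>} \<subseteq> B \<and> \<mm> \<subseteq> B"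
      unfolding mm[OF x] by simp
  qed
  have fin: "finite (carrier R)" "16 \<le> card (carrier R)"
    using card finite_carrier by simp_all
  show ?thesis
  proof (cases "\<one> \<oplus> \<one> = \<zero>")
    case True
    obtain x where x: "x \<in> \<mm>" "x \<noteq> \<zero>"
      using another_nonunit[OF M] by blast
    have "ring_generated_by R {\<zero>, \<one>, t, x}"
      using ring_generated_by_mono[OF gen[OF x]] by (simp add: insert_commute)
    then have "R \<simeq> F4x_x2"
      using x(1) by (intro iso_F4x_x2[OF True t(1) root _ mult_zero[OF x(1) x(1)] _ fin]) auto
    then show ?thesis by blast
  next
    case False
    have "ring_generated_by R {\<zero>, \<one>, t}"
      unfolding ring_generated_by_def
    proof (intro allI impI)
      fix B assume B: "{\<zero>, \<one>, t} \<subseteq> B" "\<forall>u\<in>B. \<forall>v\<in>B. u \<oplus> v \<in> B \<and> u \<otimes> v \<in> B"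
      then have "insert (\<one> \<oplus> \<one>) {\<zero>, \<one>, t} \<subseteq> B" by simp
      then show "carrier R \<subseteq> B"
        using gen[OF two False] B(2) unfolding ring_generated_by_def by simp
    qed
    then have "R \<simeq> Z4x_x2px1"
      by (intro iso_Z4x_x2px1[OF mult_zero[OF two two] t(1) root _ fin])
    then show ?thesis by blast
  qed
qed

text \<open>The residue field has at least two elements, and at least four if the ring contains a root of
\<open>t\<^sup>2 + t + 1\<close> and \<open>4 = 0\<close>: in that case \<open>t \<equiv> 1\<close> would give \<open>3 \<in> \<mm>\<close>, while \<open>2 \<in> \<mm>\<close>.\<close>

lemma card_nonunits_le_4:
  assumes "card (carrier R) \<le> 9 \<or> card (carrier R) \<le> 16 \<and> has_omega R"
  shows "card \<mm> \<le> 4"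
  using assms
proof
  assume "card (carrier R) \<le> 9"
  then show ?thesis
    using incongruent_card[OF incongruent_0_1] by linarith
next
  assume *: "card (carrier R) \<le> 16 \<and> has_omega R"
  then obtain t where four: "(\<one> \<oplus> \<one>) \<otimes> (\<one> \<oplus> \<one>) = \<zero>" and t: "t \<in> carrier R"
    and root: "t \<otimes> t \<oplus> t \<oplus> \<one> = \<zero>"
    unfolding has_omega_def by blast
  have two: "\<one> \<oplus> \<one> \<in> \<mm>"
    using nonunits_prime[of "\<one> \<oplus> \<one>" "\<one> \<oplus> \<one>"] nonunits_closed(6) unfolding four
    by (metis a_closed one_closed)
  have "t \<notin> \<mm>"
  proof
    assume "t \<in> \<mm>"
    then have "\<ominus> (t \<otimes> t \<oplus> t) \<in> \<mm>"
      using t nonunits_closed(1,2,4) by blast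
    moreover have "\<ominus> (t \<otimes> t \<oplus> t) = \<one>"
      using root t by (intro minus_equality) (simp_all add: a_comm)
    ultimately show False by simp
  qed
  moreover have "t \<ominus> \<one> \<notin> \<mm>"
  proof
    assume t1: "t \<ominus> \<one> \<in> \<mm>"
    have c: "t \<oplus> \<one> \<oplus> \<one> \<in> carrier R" using t by simp
    have "\<ominus> ((t \<ominus> \<one>) \<otimes> (t \<oplus> \<one> \<oplus> \<one>)) = \<one> \<oplus> \<one> \<oplus> \<one> \<ominus> (t \<otimes> t \<oplus> t \<oplus> \<one>)"
      using t by algebra
    also have "\<dots> = \<one> \<oplus> \<one> \<oplus> \<one>"
      unfolding root by (rule minus_zero_right) simp
    finally have "\<one> \<oplus> \<one> \<oplus> \<one> \<in> \<mm>"
      using nonunits_closed(2)[OF nonunits_closed(4)[OF t1 c]] by (simp only:)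
    then have "\<one> \<oplus> \<one> \<oplus> \<one> \<ominus> (\<one> \<oplus> \<one>) \<in> \<mm>"
      using two nonunits_closed(3) by blast
    moreover have "\<one> \<oplus> \<one> \<oplus> \<one> \<ominus> (\<one> \<oplus> \<one>) = \<one>" by algebra
    ultimately show False by simp
  qed
  ultimately have "4 * card \<mm> \<le> card (carrier R)"
    using incongruent_card incongruent_omega(2)[OF two t] by blast
  then show ?thesis using * by linarith
qed

end

lemma isomorphic_card_nonunits:
  assumes "finite_local_ring A" "A \<simeq> Q"
    and "card (carrier Q) \<le> 9 \<or> cring Q \<and> card (carrier Q) \<le> 16 \<and> has_omega Q"
  shows "card (carrier A - Units A) \<le> 4"
proof -
  interpret finite_local_ring A by fact
  obtain h where h: "h \<in> ring_iso A Q"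
    using assms(2) unfolding is_ring_iso_def by blast
  have "inv_into (carrier A) h \<in> ring_hom Q A"
    using ring_iso_set_sym[OF ring_axioms h] unfolding ring_iso_def by blast
  then have "has_omega A" if "cring Q" "has_omega Q"
    using ring_hom_cring.has_omega_transfer[OF ring_hom_cringI[OF that(1) is_cring]] that(2) by blast
  then show ?thesis
    using card_nonunits_le_4 ring_iso_same_card[OF assms(2)] assms(3) by metis
qed

theorem theorem3p7:
  fixes A :: "('a, 'm) ring_scheme"
  assumes "cring A" and "finite (carrier A)" and "\<one>\<^bsub>A\<^esub> \<noteq> \<zero>\<^bsub>A\<^esub>"
    and "local_ring A"
    and "\<not> field A"
  shows "outerplanar (line_graph (essential_graph A)) \<longleftrightarrow>
      A \<simeq> residue_ring 4 \<or>
      A \<simeq> residue_ring 9 \<or>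
      A \<simeq> residue_ring 8 \<or>
      A \<simeq> Z2x_x2 \<or>
      A \<simeq> Z3x_x2 \<or>
      A \<simeq> Z2x_x3 \<or>
      A \<simeq> Z4x_x3_x2m2 \<or>
      A \<simeq> F4x_x2 \<or>
      A \<simeq> Z4x_2x_x2 \<or>
      A \<simeq> Z2xy_x2_xy_y2 \<or>
      A \<simeq> Z4x_x2px1"
    (is "_ \<longleftrightarrow> ?list")
proof -
  have local: "finite_local_ring A"
    using assms(1-4) by (simp add: finite_local_ring_def finite_local_ring_axioms_def)
  interpret finite_local_ring A by (rule local)
  let ?mm = "carrier A - Units A"
  have nontrivial: "?mm \<noteq> {\<zero>\<^bsub>A\<^esub>}"
  proof
    assume "?mm = {\<zero>\<^bsub>A\<^esub>}"
    then have "maximalideal {\<zero>\<^bsub>A\<^esub>} A"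
      using maximalideal_nonunits by simp
    then show False
      using zeromaximalideal_fieldI assms(5) by blast
  qed
  show ?thesis
    unfolding outerplanar_line_graph_iff
  proof
    assume "card ?mm \<le> 4"
    from nontrivial this show ?list
    proof (cases rule: index_cases)
      case 1
      then show ?thesis using classification_2 by auto
    next
      case 2
      then show ?thesis using classification_3 by auto
    next
      case 3
      then show ?thesis using classification_4_index_2 by auto
    next
      case 4
      then show ?thesis using classification_4_index_4 by auto
    qed
  next
    note iso = isomorphic_card_nonunits[OF local]
    have "card (carrier (residue_ring n)) \<le> 9" if "n \<le> 9" for n
      using that by (simp add: carrier_residue_ring)
    then have "card (carrier Q) \<le> 9" if "Q \<in> {residue_ring 4, residue_ring 9, residue_ring 8}" for Q
      using that by auto
    moreover assume ?list
    ultimately show "card ?mm \<le> 4"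
      using card_Z2x_x2(2) card_Z3x_x2(2) card_Z2x_x3(2) card_Z4x_x3_x2m2(2) card_Z4x_2x_x2(2)
        card_Z2xy_x2_xy_y2(2) F4x_x2_facts Z4x_x2px1_facts
      by (elim disjE) (rule iso, assumption, force)+
  qed
qed

end
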